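(* Let $p=p_1\ldots p_m$ be a string of pairwise distinct integers from $[n]$ and let $t=t_1\ldots t_n$ be a permutation of $[n]$. All occurrences of $p$ as a consecutive motif in $t$ can be found in average time $O\left(\frac{m\log m}{\log\log m}+\frac{n\log m}{m\log\log m}\right)$.
   Context: Strings $u_1\ldots u_k$, $v_1\ldots v_k$ with pairwise distinct entries are order-isomorphic if for all $a<b$, $u_a>u_b \iff v_a>v_b$. The pattern $p$ occurs in $t$ at position $i$ if $p$ is order-isomorphic to $t_i\ldots t_{i+m-1}$. The average is taken over a random text $t$, all permutations of $[n]$ being equiprobable. The computational model is the word RAM. *)

theory Defs
  imports "HOL-Probability.Probability" "HOL-Combinatorics.Multiset_Permutations"
begin

definition order_iso :: "nat list \<Rightarrow> nat list \<Rightarrow> bool" where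
  "order_iso u v \<longleftrightarrow> length u = length v \<and>
     (\<forall>a b. a < b \<and> b < length u \<longrightarrow> (u ! a > u ! b \<longleftrightarrow> v ! a > v ! b))"

text \<open>Positions are counted from 1.\<close>

definition occurs_at :: "nat list \<Rightarrow> nat list \<Rightarrow> nat \<Rightarrow> bool" where
  "occurs_at p t i \<longleftrightarrow> 1 \<le> i \<and> i + length p \<le> length t + 1 \<and>
     order_iso p (take (length p) (drop (i - 1) t))"

text \<open>
  A word RAM with word length \<open>w\<close>, given as a parameter of the semantics and not of the
  program. Words are the natural numbers below \<open>2 ^ w\<close>. A program names finitely many
  registers; the memory is addressed by words, and every instruction costs one time unit.
\<close>

datatype word_op = Add | Sub | Mul | Div | Mod | BitAnd | BitOr | BitXor | ShiftL | ShiftR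

type_synonym reg = nat

datatype instr =
    Const reg nat
  | Op word_op reg reg reg    \<comment> \<open>the first register is the destination\<close>
  | Load reg reg              \<comment> \<open>destination, register holding the address\<close>
  | Store reg reg             \<comment> \<open>register holding the address, source\<close>
  | Jump nat
  | JumpLess reg reg nat
  | JumpEq reg reg nat

type_synonym program = "instr list"

record config =
  pc :: nat
  regs :: "reg \<Rightarrow> nat"
  mem :: "nat \<Rightarrow> nat"

context
  includes bit_operations_syntax
begin

text \<open>Division by zero yields zero, and \<open>x\<close> modulo zero is \<open>x\<close>.\<close>

fun apply_op :: "nat \<Rightarrow> word_op \<Rightarrow> nat \<Rightarrow> nat \<Rightarrow> nat" where
  "apply_op w Add x y = (x + y) mod 2 ^ w"
| "apply_op w Sub x y = nat ((int x - int y) mod 2 ^ w)"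
| "apply_op w Mul x y = (x * y) mod 2 ^ w"
| "apply_op w Div x y = x div y"
| "apply_op w Mod x y = x mod y"
| "apply_op w BitAnd x y = x AND y"
| "apply_op w BitOr x y = x OR y"
| "apply_op w BitXor x y = x XOR y"
| "apply_op w ShiftL x y = push_bit y x mod 2 ^ w"
| "apply_op w ShiftR x y = drop_bit y x"

end

fun exec :: "nat \<Rightarrow> instr \<Rightarrow> config \<Rightarrow> config" where
  "exec w (Const d k) s = s\<lparr>pc := pc s + 1, regs := (regs s)(d := k mod 2 ^ w)\<rparr>"
| "exec w (Op f d a b) s =
     s\<lparr>pc := pc s + 1, regs := (regs s)(d := apply_op w f (regs s a) (regs s b))\<rparr>"
| "exec w (Load d a) s = s\<lparr>pc := pc s + 1, regs := (regs s)(d := mem s (regs s a))\<rparr>"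
| "exec w (Store a b) s = s\<lparr>pc := pc s + 1, mem := (mem s)(regs s a := regs s b)\<rparr>"
| "exec w (Jump l) s = s\<lparr>pc := l\<rparr>"
| "exec w (JumpLess a b l) s = s\<lparr>pc := if regs s a < regs s b then l else pc s + 1\<rparr>"
| "exec w (JumpEq a b l) s = s\<lparr>pc := if regs s a = regs s b then l else pc s + 1\<rparr>"

definition halted :: "program \<Rightarrow> config \<Rightarrow> bool" where
  "halted P s \<longleftrightarrow> length P \<le> pc s"

definition step :: "nat \<Rightarrow> program \<Rightarrow> config \<Rightarrow> config" where
  "step w P s = (if halted P s then s else exec w (P ! pc s) s)"

definition terminates :: "nat \<Rightarrow> program \<Rightarrow> config \<Rightarrow> bool" where
  "terminates w P s \<longleftrightarrow> (\<exists>k. halted P ((step w P ^^ k) s))"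

text \<open>The number of steps is meaningful only for computations that terminate.\<close>

definition run_time :: "nat \<Rightarrow> program \<Rightarrow> config \<Rightarrow> nat" where
  "run_time w P s = (LEAST k. halted P ((step w P ^^ k) s))"

definition final_config :: "nat \<Rightarrow> program \<Rightarrow> config \<Rightarrow> config" where
  "final_config w P s = (step w P ^^ run_time w P s) s"

text \<open>
  Input convention: registers 0 and 1 hold the lengths of pattern and text, the memory holds
  the pattern followed by the text from address 0 on, and everything else is zero.
  Output convention: register 0 holds the address and register 1 the length of an array.
\<close>

definition initial :: "nat list \<Rightarrow> nat list \<Rightarrow> config" where
  "initial p t = \<lparr>pc = 0,
     regs = (\<lambda>_. 0)(0 := length p, 1 := length t),
     mem = (\<lambda>a. if a < length p + length t then (p @ t) ! a else 0)\<rparr>"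

definition result_of :: "config \<Rightarrow> nat list" where
  "result_of s = map (mem s) [regs s 0 ..< regs s 0 + regs s 1]"

definition finds_occurrences :: "nat \<Rightarrow> program \<Rightarrow> nat list \<Rightarrow> nat list \<Rightarrow> bool" where
  "finds_occurrences w P p t \<longleftrightarrow> terminates w P (initial p t) \<and>
     distinct (result_of (final_config w P (initial p t))) \<and>
     set (result_of (final_config w P (initial p t))) = {i. occurs_at p t i}"

definition average_time :: "nat \<Rightarrow> program \<Rightarrow> nat list \<Rightarrow> nat \<Rightarrow> real" where
  "average_time w P p n =
     measure_pmf.expectation (pmf_of_set (permutations_of_set {1..n}))
       (\<lambda>t. real (run_time w P (initial p t)))"

end

theory Submission
  imports Defs
begin

text \<open>
  Let \<open>b\<close> be the least number with \<open>b! \<ge> m ^ 4\<close>, so \<open>b = O(log m / log log m)\<close>. Each text window of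
  length \<open>m\<close> contains exactly one of the blocks of length \<open>b\<close> that start at the multiples of
  \<open>m + 1 - b\<close>. If the block at such a position is not order-isomorphic to a factor of the pattern,
  no occurrence contains it. For a random text a block is order-isomorphic to one of the at most \<open>m\<close>
  factors with probability at most \<open>m / b! \<le> m ^ -3\<close>, which pays for checking all \<open>O(m)\<close>
  windows around it by brute force in time \<open>O(m ^ 3)\<close>.

  The order type of a block is encoded as the number whose base-\<open>b\<close> digits are the positions
  in increasing order of the entries. Since \<open>b ^ b \<le> (b!)\<^sup>2 \<le> m ^ 10\<close>, this number is a valid
  address, and the codes of the pattern factors are marked directly in the initially zero memory. For the
  pattern, a sorted window is moved by one deletion and one insertion, which costs \<open>O(b)\<close> per factor even
  in the worst case. A text block is sorted by distributing it to \<open>b\<close> buckets according to value;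
  insertion then costs one step per pair in a common bucket, and the expected number of such pairs is \<open>O(b)\<close>.
  If \<open>m < 2b\<close>, then \<open>m\<close> is bounded, and brute force suffices.
\<close>

section \<open>A structured language compiled to the word RAM\<close>

text \<open>The average is over the text only, while the pattern is arbitrary. Preprocessing must
  therefore be fast in the worst case, and bucketing, which relies on random values, is reserved for
  text blocks. Plain insertion sort there would cost order \<open>b ^ 2\<close> per block and lose a
  factor \<open>b\<close>. The filter is one-sided: every reported start is verified directly, so
  correctness rests on the fact that a matching window always has a marked code. Injectivity of the
  codes matters for the expected cost. The sampled positions are fixed in advance and never depend
  on earlier comparisons, so the total cost is averaged block by block through linearity of
  expectation. Expectations are kept as sums of natural numbers over all permutations, with
  inequalities multiplied out instead of divided; logarithms enter only when the block length is
  estimated. The word length enters the program proofs through a single inequality that covers all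
  addresses and intermediate products. A structured language with step counts separates loop
  reasoning from jump addresses.\<close>

type_synonym rstate = "nat \<Rightarrow> nat"
type_synonym mstate = "nat \<Rightarrow> nat"

datatype com =
    Skip
  | SETC reg nat
  | SETOP word_op reg reg reg
  | LOAD reg reg
  | STORE reg reg
  | Seq com com (infixr ";;" 60)
  | IfLess reg reg com com
  | IfEq reg reg com com
  | While reg reg com

text \<open>The time index is the exact number of RAM steps of the compiled code. A false test costs
  one more step than a true one, for the jump over the other branch. A loop round pays for the test
  and the jump back, and leaving the loop pays for the failed test and the jump out.\<close>

inductive bs :: "nat \<Rightarrow> com \<Rightarrow> rstate \<Rightarrow> mstate \<Rightarrow> nat \<Rightarrow> rstate \<Rightarrow> mstate \<Rightarrow> bool" for w where
  Skip: "bs w Skip R M 0 R M"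
| SETC: "bs w (SETC d k) R M 1 (R(d := k mod 2 ^ w)) M"
| SETOP: "bs w (SETOP f d a b) R M 1 (R(d := apply_op w f (R a) (R b))) M"
| LOAD: "bs w (LOAD d a) R M 1 (R(d := M (R a))) M"
| STORE: "bs w (STORE a b) R M 1 R (M(R a := R b))"
| Seq: "bs w c1 R M t1 R1 M1 \<Longrightarrow> bs w c2 R1 M1 t2 R2 M2 \<Longrightarrow> bs w (c1 ;; c2) R M (t1 + t2) R2 M2"
| IfLessT: "R a < R b \<Longrightarrow> bs w c1 R M t R' M' \<Longrightarrow> bs w (IfLess a b c1 c2) R M (t + 1) R' M'"
| IfLessF: "\<not> R a < R b \<Longrightarrow> bs w c2 R M t R' M' \<Longrightarrow> bs w (IfLess a b c1 c2) R M (t + 2) R' M'"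
| IfEqT: "R a = R b \<Longrightarrow> bs w c1 R M t R' M' \<Longrightarrow> bs w (IfEq a b c1 c2) R M (t + 1) R' M'"
| IfEqF: "R a \<noteq> R b \<Longrightarrow> bs w c2 R M t R' M' \<Longrightarrow> bs w (IfEq a b c1 c2) R M (t + 2) R' M'"
| WhileF: "\<not> R a < R b \<Longrightarrow> bs w (While a b c) R M 2 R M"
| WhileT: "R a < R b \<Longrightarrow> bs w c R M t1 R1 M1 \<Longrightarrow> bs w (While a b c) R1 M1 t2 R2 M2
    \<Longrightarrow> bs w (While a b c) R M (t1 + 2 + t2) R2 M2"

inductive_cases SkipE: "bs w Skip R M t R' M'"
inductive_cases SETCE: "bs w (SETC d k) R M t R' M'"
inductive_cases SETOPE: "bs w (SETOP f d a b) R M t R' M'"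
inductive_cases LOADE: "bs w (LOAD d a) R M t R' M'"
inductive_cases STOREE: "bs w (STORE a b) R M t R' M'"
inductive_cases SeqE: "bs w (c1 ;; c2) R M t R' M'"
inductive_cases IfLessE: "bs w (IfLess a b c1 c2) R M t R' M'"
inductive_cases IfEqE: "bs w (IfEq a b c1 c2) R M t R' M'"

fun csize :: "com \<Rightarrow> nat" where
  "csize Skip = 0"
| "csize (c1 ;; c2) = csize c1 + csize c2"
| "csize (IfLess a b c1 c2) = csize c1 + csize c2 + 2"
| "csize (IfEq a b c1 c2) = csize c1 + csize c2 + 2"
| "csize (While a b c) = csize c + 3"
| "csize _ = 1"

text \<open>Jumps are absolute, so \<open>l\<close> is the address at which the code will stand. The
  branch for a false test comes first, directly behind the conditional jump.\<close>

fun compile :: "nat \<Rightarrow> com \<Rightarrow> program" where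
  "compile l Skip = []"
| "compile l (SETC d k) = [Const d k]"
| "compile l (SETOP f d a b) = [Op f d a b]"
| "compile l (LOAD d a) = [Load d a]"
| "compile l (STORE a b) = [Store a b]"
| "compile l (c1 ;; c2) = compile l c1 @ compile (l + csize c1) c2"
| "compile l (IfLess a b c1 c2) = JumpLess a b (l + 2 + csize c2) # compile (l + 1) c2
     @ Jump (l + csize c1 + csize c2 + 2) # compile (l + 2 + csize c2) c1"
| "compile l (IfEq a b c1 c2) = JumpEq a b (l + 2 + csize c2) # compile (l + 1) c2
     @ Jump (l + csize c1 + csize c2 + 2) # compile (l + 2 + csize c2) c1"
| "compile l (While a b c) = JumpLess a b (l + 2) # Jump (l + csize c + 3) # compile (l + 2) c
     @ [Jump l]"

lemma length_compile [simp]: "length (compile l c) = csize c"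
  by (induction l c rule: compile.induct) auto

text \<open>The bound on the length ensures that \<open>pc\<close> stays inside \<open>P\<close>, so
  that \<open>step\<close> executes an instruction instead of treating the machine as
  halted.\<close>

definition code_at :: "program \<Rightarrow> nat \<Rightarrow> program \<Rightarrow> bool" where
  "code_at P l q \<longleftrightarrow> l + length q \<le> length P \<and> (\<forall>i<length q. P ! (l + i) = q ! i)"

lemma code_at_append: "code_at P l (q1 @ q2) \<longleftrightarrow> code_at P l q1 \<and> code_at P (l + length q1) q2"
proof
  assume *: "code_at P l (q1 @ q2)"
  have "P ! (l + length q1 + i) = q2 ! i" if "i < length q2" for i
    using * that unfolding code_at_def
    by (metis add.assoc length_append nat_add_left_cancel_less nth_append_length_plus)
  moreover have "P ! (l + i) = q1 ! i" if "i < length q1" for i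
    using * that unfolding code_at_def by (auto simp: nth_append)
  ultimately show "code_at P l q1 \<and> code_at P (l + length q1) q2"
    using * by (auto simp: code_at_def)
next
  assume *: "code_at P l q1 \<and> code_at P (l + length q1) q2"
  have "P ! (l + i) = (q1 @ q2) ! i" if "i < length q1 + length q2" for i
  proof (cases "i < length q1")
    case False
    then obtain j where "i = length q1 + j" using le_Suc_ex not_less by blast
    then show ?thesis using * that by (auto simp: code_at_def add.assoc)
  qed (use * in \<open>auto simp: code_at_def nth_append\<close>)
  then show "code_at P l (q1 @ q2)" using * by (auto simp: code_at_def)
qed

lemma code_at_Cons: "code_at P l (i # q) \<longleftrightarrow> l < length P \<and> P ! l = i \<and> code_at P (Suc l) q"
  using code_at_append[of P l "[i]" q] by (auto simp: code_at_def)

lemma code_at_Nil [simp]: "code_at P l [] \<longleftrightarrow> l \<le> length P"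
  by (auto simp: code_at_def)

lemma code_at_nth: "code_at P l [i] \<Longrightarrow> l < length P \<and> P ! l = i"
  by (simp add: code_at_Cons)

abbreviation conf :: "nat \<Rightarrow> rstate \<Rightarrow> mstate \<Rightarrow> config" where
  "conf l R M \<equiv> \<lparr>pc = l, regs = R, mem = M\<rparr>"

lemma funpow_add_apply: "(f ^^ (a + b)) x = (f ^^ b) ((f ^^ a) x)"
  by (metis add.commute comp_apply funpow_add)

lemma step_conf: "l < length P \<Longrightarrow> step w P (conf l R M) = exec w (P ! l) (conf l R M)"
  by (simp add: step_def halted_def)

lemma compile_correct:
  "bs w c R M t R' M' \<Longrightarrow> code_at P l (compile l c)
    \<Longrightarrow> (step w P ^^ t) (conf l R M) = conf (l + csize c) R' M'"
proof (induction arbitrary: l rule: bs.induct)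
  case (Seq c1 R M t1 R1 M1 c2 t2 R2 M2)
  then show ?case by (simp add: funpow_add_apply code_at_append add.assoc)
next
  case (IfLessF R a b c2 M t R' M' c1)
  have at: "l < length P" "P ! l = JumpLess a b (l + 2 + csize c2)"
    "code_at P (l + 1) (compile (l + 1) c2)" "code_at P (l + 1 + csize c2) [Jump (l + csize c1 + csize c2 + 2)]"
    using IfLessF.prems by (auto simp: code_at_append code_at_Cons)
  \<comment> \<open>The steps are grouped as the test, the branch, and the jump over the other
    branch.\<close>
  have "(step w P ^^ (1 + (t + 1))) (conf l R M) = conf (l + csize (IfLess a b c1 c2)) R' M'"
    unfolding funpow_add_apply using at IfLessF.IH[OF at(3)] IfLessF.hyps code_at_nth[OF at(4)]
    by (simp add: step_conf)
  then show ?case by simp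
next
  case (IfEqF R a b c2 M t R' M' c1)
  have at: "l < length P" "P ! l = JumpEq a b (l + 2 + csize c2)"
    "code_at P (l + 1) (compile (l + 1) c2)" "code_at P (l + 1 + csize c2) [Jump (l + csize c1 + csize c2 + 2)]"
    using IfEqF.prems by (auto simp: code_at_append code_at_Cons)
  have "(step w P ^^ (1 + (t + 1))) (conf l R M) = conf (l + csize (IfEq a b c1 c2)) R' M'"
    unfolding funpow_add_apply using at IfEqF.IH[OF at(3)] IfEqF.hyps code_at_nth[OF at(4)]
    by (simp add: step_conf)
  then show ?case by simp
next
  case (IfLessT R a b c1 M t R' M' c2)
  have at: "l < length P" "P ! l = JumpLess a b (l + 2 + csize c2)"
    "code_at P (l + 2 + csize c2) (compile (l + 2 + csize c2) c1)"
    using IfLessT.prems by (auto simp: code_at_append code_at_Cons)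
  have "(step w P ^^ (1 + t)) (conf l R M) = conf (l + csize (IfLess a b c1 c2)) R' M'"
    unfolding funpow_add_apply using at IfLessT.IH[OF at(3)] IfLessT.hyps
    by (simp add: step_conf ac_simps)
  then show ?case by simp
next
  case (IfEqT R a b c1 M t R' M' c2)
  have at: "l < length P" "P ! l = JumpEq a b (l + 2 + csize c2)"
    "code_at P (l + 2 + csize c2) (compile (l + 2 + csize c2) c1)"
    using IfEqT.prems by (auto simp: code_at_append code_at_Cons)
  have "(step w P ^^ (1 + t)) (conf l R M) = conf (l + csize (IfEq a b c1 c2)) R' M'"
    unfolding funpow_add_apply using at IfEqT.IH[OF at(3)] IfEqT.hyps
    by (simp add: step_conf ac_simps)
  then show ?case by simp
next
  case (WhileF R a b c M)
  then have at: "l < length P" "P ! l = JumpLess a b (l + 2)" "Suc l < length P"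
     "P ! Suc l = Jump (l + csize c + 3)"
    by (auto simp: code_at_append code_at_Cons)
  have "(step w P ^^ (1 + 1)) (conf l R M) = conf (l + csize (While a b c)) R M"
    unfolding funpow_add_apply using at WhileF.hyps by (simp add: step_conf)
  then show ?case by (simp add: numeral_2_eq_2)
next
  case (WhileT R a b c M t1 R1 M1 t2 R2 M2)
  then have at: "l < length P" "P ! l = JumpLess a b (l + 2)"
     "code_at P (l + 2) (compile (l + 2) c)" "code_at P (l + 2 + csize c) [Jump l]"
    by (auto simp: code_at_append code_at_Cons)
  have "(step w P ^^ ((1 + (t1 + 1)) + t2)) (conf l R M) = conf (l + csize (While a b c)) R2 M2"
    using at WhileT.IH(1)[OF at(3)] WhileT.hyps code_at_nth[OF at(4)] WhileT.IH(2)[OF WhileT.prems]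
    unfolding funpow_add_apply by (simp add: step_conf)
  then show ?case by simp
qed (auto simp: step_conf dest!: code_at_nth)

lemma halted_steps: "halted P s \<Longrightarrow> (step w P ^^ k) s = s"
  by (induction k) (auto simp: step_def)

text \<open>Since \<open>run_time\<close> is a least number, reaching the end after \<open>t\<close>
  steps only bounds it. The final configurations agree nevertheless, because a halted configuration
  no longer changes.\<close>

lemma compile_run:
  assumes "bs w c R M t R' M'" "s = conf 0 R M"
  shows "terminates w (compile 0 c) s" "run_time w (compile 0 c) s \<le> t"
    "final_config w (compile 0 c) s = conf (csize c) R' M'"
proof -
  let ?P = "compile 0 c"
  have e: "(step w ?P ^^ t) s = conf (csize c) R' M'"
    using compile_correct[OF assms(1), of ?P 0] assms(2) by (simp add: code_at_def)
  then have h: "halted ?P ((step w ?P ^^ t) s)" by (simp add: halted_def)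
  then show "terminates w ?P s" unfolding terminates_def by blast
  show le: "run_time w ?P s \<le> t" unfolding run_time_def using h by (rule Least_le)
  have "halted ?P ((step w ?P ^^ run_time w ?P s) s)"
    unfolding run_time_def using h by (rule LeastI)
  from halted_steps[OF this, where w = w and k = "t - run_time w ?P s"]
  show "final_config w ?P s = conf (csize c) R' M'"
    using le e unfolding final_config_def by (simp flip: funpow_add_apply)
qed

section \<open>Total correctness with step counts\<close>

definition wp :: "nat \<Rightarrow> com \<Rightarrow> (rstate \<Rightarrow> mstate \<Rightarrow> nat \<Rightarrow> bool) \<Rightarrow> rstate \<Rightarrow> mstate \<Rightarrow> bool" where
  "wp w c Q R M \<longleftrightarrow> (\<exists>t R' M'. bs w c R M t R' M' \<and> Q R' M' t)"

lemma wp_simps [simp]: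
  "wp w Skip Q R M \<longleftrightarrow> Q R M 0"
  "wp w (SETC d k) Q R M \<longleftrightarrow> Q (R(d := k mod 2 ^ w)) M 1"
  "wp w (SETOP f d a b) Q R M \<longleftrightarrow> Q (R(d := apply_op w f (R a) (R b))) M 1"
  "wp w (LOAD d a) Q R M \<longleftrightarrow> Q (R(d := M (R a))) M 1"
  "wp w (STORE a b) Q R M \<longleftrightarrow> Q R (M(R a := R b)) 1"
  "wp w (c1 ;; c2) Q R M \<longleftrightarrow> wp w c1 (\<lambda>R1 M1 t1. wp w c2 (\<lambda>R2 M2 t2. Q R2 M2 (t1 + t2)) R1 M1) R M"
  "wp w (IfLess a b c1 c2) Q R M \<longleftrightarrow>
     (if R a < R b then wp w c1 (\<lambda>R' M' t. Q R' M' (t + 1)) R M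
      else wp w c2 (\<lambda>R' M' t. Q R' M' (t + 2)) R M)"
  "wp w (IfEq a b c1 c2) Q R M \<longleftrightarrow>
     (if R a = R b then wp w c1 (\<lambda>R' M' t. Q R' M' (t + 1)) R M
      else wp w c2 (\<lambda>R' M' t. Q R' M' (t + 2)) R M)"
proof -
  show "wp w (c1 ;; c2) Q R M \<longleftrightarrow> wp w c1 (\<lambda>R1 M1 t1. wp w c2 (\<lambda>R2 M2 t2. Q R2 M2 (t1 + t2)) R1 M1) R M"
    unfolding wp_def by (auto elim!: SeqE intro: bs.Seq) (blast intro: bs.Seq)+
  show "wp w (IfLess a b c1 c2) Q R M \<longleftrightarrow>
     (if R a < R b then wp w c1 (\<lambda>R' M' t. Q R' M' (t + 1)) R M
      else wp w c2 (\<lambda>R' M' t. Q R' M' (t + 2)) R M)"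
    unfolding wp_def using bs.IfLessT[of R a b w c1] bs.IfLessF[of R a b w c2]
    by (simp, safe; (elim IfLessE)?; force)
  show "wp w (IfEq a b c1 c2) Q R M \<longleftrightarrow>
     (if R a = R b then wp w c1 (\<lambda>R' M' t. Q R' M' (t + 1)) R M
      else wp w c2 (\<lambda>R' M' t. Q R' M' (t + 2)) R M)"
    unfolding wp_def using bs.IfEqT[of R a b w c1] bs.IfEqF[of R a b w c2]
    by (simp, safe; (elim IfEqE)?; force)
qed (unfold wp_def, (rule iffI, (elim exE conjE SkipE SETCE SETOPE LOADE STOREE; simp),
      (intro exI conjI; (rule bs.intros | assumption)))+)

text \<open>These rules execute the first instruction of a sequence and leave the rest folded.
  Proofs use them with the general rule for \<open>;;\<close> switched off, so that specifications
  of later blocks still apply.\<close>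

lemma wp_pre:
  "wp w (SETC d k ;; c) Q R M \<longleftrightarrow> wp w c (\<lambda>R' M' t. Q R' M' (1 + t)) (R(d := k mod 2 ^ w)) M"
  "wp w (SETOP f d a b ;; c) Q R M \<longleftrightarrow> wp w c (\<lambda>R' M' t. Q R' M' (1 + t)) (R(d := apply_op w f (R a) (R b))) M"
  "wp w (LOAD d a ;; c) Q R M \<longleftrightarrow> wp w c (\<lambda>R' M' t. Q R' M' (1 + t)) (R(d := M (R a))) M"
  "wp w (STORE a b ;; c) Q R M \<longleftrightarrow> wp w c (\<lambda>R' M' t. Q R' M' (1 + t)) R (M(R a := R b))"
  by simp_all

fun writes :: "com \<Rightarrow> reg set" where
  "writes Skip = {}"
| "writes (SETC d k) = {d}"
| "writes (SETOP f d a b) = {d}"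
| "writes (LOAD d a) = {d}"
| "writes (STORE a b) = {}"
| "writes (c1 ;; c2) = writes c1 \<union> writes c2"
| "writes (IfLess a b c1 c2) = writes c1 \<union> writes c2"
| "writes (IfEq a b c1 c2) = writes c1 \<union> writes c2"
| "writes (While a b c) = writes c"

lemma bs_writes: "bs w c R M t R' M' \<Longrightarrow> r \<notin> writes c \<Longrightarrow> R' r = R r"
  by (induction rule: bs.induct) auto

text \<open>The register frame comes for free: registers outside \<open>writes c\<close> keep their
  values and may be used in the new postcondition. Specifications thus state frames for the memory
  only.\<close>

lemma wp_conseq:
  assumes "wp w c Q R M"
    "\<And>R' M' t. Q R' M' t \<Longrightarrow> (\<And>r. r \<notin> writes c \<Longrightarrow> R' r = R r) \<Longrightarrow> Q' R' M' t"
  shows "wp w c Q' R M"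
  using assms bs_writes unfolding wp_def by meson

lemma wp_Seq:
  assumes "wp w c1 Q1 R M" "\<And>R1 M1 t1. Q1 R1 M1 t1 \<Longrightarrow> wp w c2 (\<lambda>R2 M2 t2. Q R2 M2 (t1 + t2)) R1 M1"
  shows "wp w (c1 ;; c2) Q R M"
  unfolding wp_simps using assms by (elim wp_conseq) blast

text \<open>The number \<open>N\<close> of rounds is known beforehand, the invariant is indexed by
  the round, and the cost \<open>T k\<close> may vary with it. This allows the cost of a round to
  depend on the text. Frame facts refer to the registers at loop entry.\<close>

lemma wp_while:
  assumes "I (0::nat) R M"
    and body: "\<And>k R1 M1. k < N \<Longrightarrow> I k R1 M1 \<Longrightarrow> (\<And>r. r \<notin> writes c \<Longrightarrow> R1 r = R r) \<Longrightarrow>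
           R1 a < R1 b \<and> wp w c (\<lambda>R' M' t. I (Suc k) R' M' \<and> t \<le> T k) R1 M1"
    and exit: "\<And>R1 M1. I N R1 M1 \<Longrightarrow> (\<And>r. r \<notin> writes c \<Longrightarrow> R1 r = R r) \<Longrightarrow> \<not> R1 a < R1 b"
  shows "wp w (While a b c) (\<lambda>R' M' t. I N R' M' \<and> t \<le> (\<Sum>k<N. T k + 2) + 2) R M"
proof -
  \<comment> \<open>Induction on the number \<open>j\<close> of rounds that remain.\<close>
  have *: "wp w (While a b c) (\<lambda>R' M' t. I N R' M' \<and> t \<le> (\<Sum>k=N-j..<N. T k + 2) + 2) R1 M1"
    if "I (N - j) R1 M1" "\<And>r. r \<notin> writes c \<Longrightarrow> R1 r = R r" "j \<le> N" for j R1 M1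
    using that
  proof (induction j arbitrary: R1 M1)
    case 0
    then have "bs w (While a b c) R1 M1 2 R1 M1" using exit[of R1 M1] by (intro bs.WhileF) auto
    then show ?case using 0 unfolding wp_def by force
  next
    case (Suc j)
    let ?k = "N - Suc j"
    have k: "?k < N" "Suc ?k = N - j" using Suc.prems by auto
    obtain t1 R2 M2 where b: "R1 a < R1 b" "bs w c R1 M1 t1 R2 M2" "I (N - j) R2 M2" "t1 \<le> T ?k"
      using body[OF k(1) Suc.prems(1,2)] k(2) unfolding wp_def by metis
    have "\<And>r. r \<notin> writes c \<Longrightarrow> R2 r = R r" using bs_writes[OF b(2)] Suc.prems(2) by simp
    then obtain t2 R3 M3 where r: "bs w (While a b c) R2 M2 t2 R3 M3" "I N R3 M3"
      "t2 \<le> (\<Sum>k=N-j..<N. T k + 2) + 2"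
      using Suc.IH[OF b(3)] Suc.prems(3) unfolding wp_def by auto
    have "{?k..<N} = insert ?k {N-j..<N}" using k by auto
    then have "(\<Sum>k=?k..<N. T k + 2) = T ?k + 2 + (\<Sum>k=N-j..<N. T k + 2)" using k by simp
    then have "t1 + 2 + t2 \<le> (\<Sum>k=?k..<N. T k + 2) + 2" using r(3) b(4) by linarith
    then show ?case using bs.WhileT[OF b(1,2) r(1)] r(2) unfolding wp_def by blast
  qed
  show ?thesis using *[of N R M] assms(1) by (simp add: lessThan_atLeast0)
qed

text \<open>Under bounds excluding overflow or underflow, word arithmetic is ordinary arithmetic.
  With the defining equations removed from the simplifier below, each use must supply such a
  bound.\<close>

lemma apply_op_exact:
  "x + y < 2 ^ w \<Longrightarrow> apply_op w Add x y = x + y"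
  "y \<le> x \<Longrightarrow> x < 2 ^ w \<Longrightarrow> apply_op w Sub x y = x - y"
  "x * y < 2 ^ w \<Longrightarrow> apply_op w Mul x y = x * y"
proof -
  assume "y \<le> x" "x < 2 ^ w"
  moreover have "int x < 2 ^ w" using \<open>x < 2 ^ w\<close> by (metis of_nat_less_iff of_nat_numeral of_nat_power)
  ultimately have "(int x - int y) mod 2 ^ w = int x - int y"
    by (intro mod_pos_pos_trivial) linarith+
  then show "apply_op w Sub x y = x - y" by simp
qed auto

declare apply_op.simps(1-3) [simp del]

section \<open>The building blocks of the program\<close>

text \<open>
  Registers 2 and 3 hold the constants 0 and 1. With \<open>D = m + n\<close>, registers 4 to 14 hold, in this order,
  \<open>D, m, n, b, 2 * D, 3 * D, 4 * D, 5 * D, n + 1 - m, m + 1 - b, n + 1\<close>. Register 15 counts the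
  occurrences found, register 37 is the length of the sorted array, and register 40 is the left end of the
  window that is encoded. The remaining registers are temporary.

  The memory consists of the input below \<open>D\<close>, the sorted array of addresses from \<open>D\<close>, the heads of the
  bucket lists from \<open>2 * D\<close>, their links from \<open>3 * D\<close>, the output from \<open>4 * D\<close> and the table of
  pattern codes from \<open>5 * D\<close>. Lists end with address 0, which is never an address of a text entry.
\<close>

definition INSERT :: com where
  "INSERT = LOAD 31 30 ;; SETOP Add 32 4 37 ;; SETC 33 1 ;;
    While 2 33
      (IfLess 4 32
        (SETOP Sub 34 32 3 ;; LOAD 35 34 ;; LOAD 36 35 ;;
         IfLess 31 36 (STORE 32 35 ;; SETOP Add 32 34 2) (SETC 33 0))
        (SETC 33 0)) ;;
    STORE 32 30 ;; SETOP Add 37 37 3"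

text \<open>All pairs are compared, without early exit, for the starts from register 20 up to but
  excluding register 21. Starts are zero-based here; register 29 adds one because reported positions
  count from 1.\<close>

definition VERIFY :: com where
  "VERIFY = While 20 21
    (SETC 22 1 ;; SETOP Add 23 2 2 ;;
     While 23 5
       (SETOP Add 24 2 2 ;;
        While 24 5
          (LOAD 25 23 ;; LOAD 26 24 ;; SETOP Add 29 5 20 ;;
           SETOP Add 27 29 23 ;; LOAD 27 27 ;; SETOP Add 28 29 24 ;; LOAD 28 28 ;;
           IfLess 25 26 (IfLess 27 28 Skip (SETC 22 0)) (IfLess 27 28 (SETC 22 0) Skip) ;;
           SETOP Add 24 24 3) ;;
        SETOP Add 23 23 3) ;;
     SETOP Add 29 20 3 ;;
     IfEq 22 3 (SETOP Add 28 10 15 ;; STORE 28 29 ;; SETOP Add 15 15 3) Skip ;;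
     SETOP Add 20 20 3)"

definition REMOVE :: com where
  "REMOVE = SETOP Add 41 4 2 ;; SETOP Add 42 4 2 ;; SETOP Add 43 4 37 ;;
    While 41 43
      (LOAD 44 41 ;;
       IfEq 44 40 Skip (STORE 42 44 ;; SETOP Add 42 42 3) ;;
       SETOP Add 41 41 3) ;;
    SETOP Sub 37 42 4"

definition CODE :: com where
  "CODE = SETC 48 0 ;; SETOP Add 45 4 2 ;; SETOP Add 46 4 37 ;;
    While 45 46
      (LOAD 47 45 ;; SETOP Sub 47 47 40 ;; SETOP Mul 48 48 7 ;; SETOP Add 48 48 47 ;;
       SETOP Add 45 45 3)"

section \<open>Insertion into sorted lists and base-\<open>b\<close> codes\<close>

lemma insort_key_takeWhile:
  "insort_key f x xs = takeWhile (\<lambda>y. f y < f x) xs @ x # dropWhile (\<lambda>y. f y < f x) xs"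
  by (induction xs) auto

lemma sorted_takeWhile_bound:
  fixes f :: "'a \<Rightarrow> 'b :: linorder"
  assumes "sorted (map f xs)" "length (takeWhile (\<lambda>y. f y < v) xs) \<le> j" "j < length xs"
  shows "v \<le> f (xs ! j)"
proof -
  let ?q = "length (takeWhile (\<lambda>y. f y < v) xs)"
  have "v \<le> f (xs ! ?q)" using assms(2,3) nth_length_takeWhile[of "\<lambda>y. f y < v" xs] by (simp add: not_less)
  also have "\<dots> \<le> f (xs ! j)" using sorted_nth_mono[OF assms(1), of ?q j] assms(2,3) by simp
  finally show ?thesis .
qed

text \<open>Horner's scheme. Subtracting the left end \<open>l\<close> turns addresses into offsets,
  so windows at different places become comparable.\<close>

definition code :: "nat \<Rightarrow> nat \<Rightarrow> nat list \<Rightarrow> nat" where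
  "code b l = foldl (\<lambda>c y. c * b + (y - l)) 0"

lemma code_snoc: "code b l (xs @ [y]) = code b l xs * b + (y - l)"
  by (simp add: code_def)

lemma code_less: "set xs \<subseteq> {l..<l + b} \<Longrightarrow> code b l xs < b ^ length xs"
proof (induction xs rule: rev_induct)
  case Nil
  then show ?case by (simp add: code_def)
next
  case (snoc y xs)
  have "code b l xs * b + (y - l) < code b l xs * b + b" using snoc.prems by auto
  also have "\<dots> = (code b l xs + 1) * b" by simp
  also have "\<dots> \<le> b ^ length xs * b" using snoc by (intro mult_right_mono) auto
  finally show ?case by (simp add: code_snoc mult.commute)
qed

text \<open>Uniqueness of base-\<open>b\<close> digits: \<open>mod b\<close> and
  \<open>div b\<close> split off the last one. The left ends may differ, because only offsets are
  recovered. This serves the probability bound, where a code must stand for a single order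
  type.\<close>

lemma code_inj:
  "\<lbrakk>length xs = length ys; set xs \<subseteq> {l..<l + b}; set ys \<subseteq> {l'..<l' + b}; code b l xs = code b l' ys\<rbrakk>
    \<Longrightarrow> map (\<lambda>x. x - l) xs = map (\<lambda>y. y - l') ys"
proof (induction xs arbitrary: ys rule: rev_induct)
  case Nil
  then show ?case by simp
next
  case (snoc x xs)
  then obtain zs y where ys: "ys = zs @ [y]" by (metis append_Nil2 append_eq_append_conv rev_exhaust)
  have lt: "x - l < b" "y - l' < b" using snoc.prems ys by auto
  have eq: "code b l xs * b + (x - l) = code b l' zs * b + (y - l')"
    using snoc.prems ys by (simp add: code_snoc)
  have "x - l = y - l'" using arg_cong[OF eq, of "\<lambda>z. z mod b"] lt by simp
  moreover have "code b l xs = code b l' zs" using arg_cong[OF eq, of "\<lambda>z. z div b"] lt by simp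
  ultimately show ?case using snoc ys by simp
qed

lemma code_shift: "set xs \<subseteq> {l..} \<Longrightarrow> code b (l + d) (map (\<lambda>x. x + d) xs) = code b l xs"
  by (induction xs rule: rev_induct) (auto simp: code_def)

text \<open>In the word bound, the linear part covers the arrays, since
  \<open>D \<le> 2 * n\<close>, and \<open>(n + 1) ^ 10\<close> covers the code table, whose indices
  are below \<open>b ^ b\<close>.\<close>

locale ram =
  fixes w m n :: nat and inp :: "nat \<Rightarrow> nat"
  assumes m_pos: "1 \<le> m" and m_le_n: "m \<le> n" and word: "16 * n + 16 + (n + 1) ^ 10 \<le> 2 ^ w"
begin

definition D :: nat where "D = m + n"

definition env :: "rstate \<Rightarrow> bool" where
  "env R \<longleftrightarrow> R 2 = 0 \<and> R 3 = 1 \<and> R 4 = D \<and> R 5 = m \<and> R 6 = n \<and> R 10 = 4 * D"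

lemma envD: "env R \<Longrightarrow> R 2 = 0" "env R \<Longrightarrow> R 3 = 1" "env R \<Longrightarrow> R 4 = D" "env R \<Longrightarrow> R 5 = m"
  "env R \<Longrightarrow> R 6 = n" "env R \<Longrightarrow> R 10 = 4 * D"
  by (auto simp: env_def)

lemma word': "8 * D + 16 < 2 ^ w" "m + n \<le> D" "1 < (2::nat) ^ w"
proof -
  have "0 < (n + 1) ^ 10" by simp
  then have "16 * n + 16 < 2 ^ w" using word by linarith
  moreover have "m + n \<le> 2 * n" using m_le_n by simp
  ultimately show "8 * D + 16 < 2 ^ w" "m + n \<le> D" "1 < (2::nat) ^ w" by (auto simp: D_def)
qed

lemma w_pos [simp]: "0 < w"
  using word'(3) by (cases w) auto

definition holds :: "nat list \<Rightarrow> mstate \<Rightarrow> bool" where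
  "holds xs M \<longleftrightarrow> (\<forall>j<length xs. M (D + j) = xs ! j)"

definition input :: "mstate \<Rightarrow> bool" where
  "input M \<longleftrightarrow> (\<forall>a<D. M a = inp a)"

text \<open>The time bound counts only entries larger than the new one, since exactly these are
  moved. This refined cost later turns into bucket collisions.\<close>

lemma INSERT:
  assumes env: "env R" and len: "R 37 = length xs" and xs: "holds xs M" "sorted (map inp xs)"
    "set xs \<subseteq> {..<D}" "length xs < D" and x: "R 30 = x" "x < D" "inp x \<notin> inp ` set xs" and inp: "input M"
  shows "wp w INSERT (\<lambda>R' M' t. R' 37 = length xs + 1 \<and> holds (insort_key inp x xs) M' \<and>
     (\<forall>a. a < D \<or> 2 * D \<le> a \<longrightarrow> M' a = M a) \<and>
     t \<le> 20 + 10 * length (filter (\<lambda>y. inp x < inp y) xs)) R M"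
proof -
  define q where "q = length (takeWhile (\<lambda>y. inp y < inp x) xs)"
  define s where "s = length xs - q"
  have qle: "q \<le> length xs" unfolding q_def by (rule length_takeWhile_le)
  have low: "inp (xs ! j) < inp x" if "j < q" for j
    using that unfolding q_def by (metis nth_mem set_takeWhileD takeWhile_nth)
  have high: "inp x < inp (xs ! j)" if "q \<le> j" "j < length xs" for j
  proof -
    have "inp x \<le> inp (xs ! j)" using sorted_takeWhile_bound[OF xs(2)] that q_def by blast
    moreover have "xs ! j \<in> set xs" using that by simp
    ultimately show ?thesis using x(3) by (metis image_eqI le_neq_implies_less)
  qed
  have tw: "takeWhile (\<lambda>y. inp y < inp x) xs = take q xs" unfolding q_def by (rule takeWhile_eq_take)
  have dw: "dropWhile (\<lambda>y. inp y < inp x) xs = drop q xs" unfolding q_def by (rule dropWhile_eq_drop)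
  have ins: "insort_key inp x xs = take q xs @ x # drop q xs" by (simp add: insort_key_takeWhile tw dw)
  have "filter (\<lambda>y. inp x < inp y) xs = filter (\<lambda>y. inp x < inp y) (take q xs) @ filter (\<lambda>y. inp x < inp y) (drop q xs)"
    by (simp flip: filter_append)
  also have "filter (\<lambda>y. inp x < inp y) (take q xs) = []"
    using low by (fastforce simp: filter_empty_conv in_set_conv_nth)
  also have "filter (\<lambda>y. inp x < inp y) (drop q xs) = drop q xs"
    using high by (fastforce simp: filter_id_conv in_set_conv_nth)
  finally have flen: "length (filter (\<lambda>y. inp x < inp y) xs) = s" by (simp add: s_def)
  have xsD: "xs ! j < D" if "j < length xs" for j using xs(3) that by (meson lessThan_iff nth_mem subsetD)
  have M0: "M (D + j) = xs ! j" if "j < length xs" for j using xs(1) that by (simp add: holds_def)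
  let ?L = "length xs"
  \<comment> \<open>Rounds \<open>k < s\<close> move one larger entry each, and round
    \<open>s\<close> only clears the flag. Hence there are \<open>s + 1\<close> rounds, and after
    \<open>k\<close> of them \<open>min k s\<close> entries have moved.\<close>
  define I where "I = (\<lambda>k (R1::rstate) (M1::mstate). R1 33 = (if k \<le> s then 1 else 0) \<and> R1 32 = D + ?L - min k s \<and>
     (\<forall>j<?L - min k s. M1 (D + j) = xs ! j) \<and>
     (\<forall>j<?L. ?L - min k s \<le> j \<longrightarrow> M1 (D + Suc j) = xs ! j) \<and>
     (\<forall>a. a < D \<or> 2 * D \<le> a \<longrightarrow> M1 a = M a))"
  let ?R = "R(31 := inp x, 32 := D + ?L, 33 := 1)"
  let ?body = "IfLess 4 32
        (SETOP Sub 34 32 3 ;; LOAD 35 34 ;; LOAD 36 35 ;;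
         IfLess 31 36 (STORE 32 35 ;; SETOP Add 32 34 2) (SETC 33 0))
        (SETC 33 0)"
  note b = word' len x envD[OF env]
  have step: "R1 2 < R1 33 \<and> wp w ?body (\<lambda>R' M' t. I (Suc k) R' M' \<and> t \<le> 8) R1 M1"
    if "k < s + 1" and I: "I k R1 M1" and fr: "\<And>r. r \<notin> writes ?body \<Longrightarrow> R1 r = ?R r" for k R1 M1
  proof -
    have c: "R1 2 = 0" "R1 3 = 1" "R1 4 = D" "R1 31 = inp x" using fr b by auto
    have k: "k \<le> s" "min k s = k" "s \<le> ?L" using that(1) s_def by auto
    have r: "R1 33 = 1" "R1 32 = D + ?L - k" using I k unfolding I_def by auto
    have inpM: "M1 a = inp a" if "a < D" for a using I that inp unfolding I_def input_def by auto
    show ?thesis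
    proof (cases "k = ?L")
      case True
      then have "s = k" using k by simp
      then show ?thesis using c r I True unfolding I_def by simp
    next
      case False
      then have kl: "k < ?L" using k by simp
      define j where "j = ?L - Suc k"
      have j: "j < ?L" "D + ?L - k = D + Suc j" "?L - k = Suc j" using kl j_def by auto
      have Mj: "M1 (D + j) = xs ! j" using I j k unfolding I_def by auto
      have sub: "apply_op w Sub (D + Suc j) 1 = D + j" using j b xs(4) by (subst apply_op_exact) auto
      have add: "apply_op w Add (D + j) 0 = D + j" using j b xs(4) by (subst apply_op_exact) auto
      have iM: "M1 (xs ! j) = inp (xs ! j)" using inpM xsD j by simp
      show ?thesis
      proof (cases "k < s")
        case True
        then have "q \<le> j" using j_def s_def kl by auto
        then have hi: "inp x < inp (xs ! j)" using high j by simp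
        have m': "min (Suc k) s = Suc k" using True by simp
        have e: "?L - Suc k = j" "D + ?L - Suc k = D + j" using j_def kl by auto
        have "I (Suc k) (R1(34 := D + j, 35 := xs ! j, 36 := inp (xs ! j), 32 := D + j)) (M1(D + Suc j := xs ! j))"
          unfolding I_def m' e using True I r c k j xs(4)
          by (auto simp: I_def)
        then show ?thesis using c r j Mj sub add iM hi by (simp add: fun_upd_twist)
      next
        case False
        then have ks: "k = s" "j < q" using k j_def s_def kl by auto
        then have lo: "\<not> inp x < inp (xs ! j)" using low[of j] by simp
        have "I (Suc k) (R1(34 := D + j, 35 := xs ! j, 36 := inp (xs ! j), 33 := 0)) M1"
          using I r ks j unfolding I_def by auto
        then show ?thesis using c r j Mj sub iM lo by simp
      qed
    qed
  qed
  have start: "I 0 ?R M" unfolding I_def using M0 by auto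
  have ex: "\<not> R1 2 < R1 33" if "I (s + 1) R1 M1" for R1 M1 using that by (simp add: I_def)
  have loop: "wp w (While 2 33 ?body) (\<lambda>R' M' t. I (s + 1) R' M' \<and> t \<le> (\<Sum>k<s+1. 8 + 2) + 2) ?R M"
    by (rule wp_while[of I, OF start step ex]) auto
  have D1: "D + ?L < 2 ^ w" using b xs(4) by simp
  have fin: "R' 37 = ?L \<and> holds (insort_key inp x xs) (M'(R' 32 := R' 30)) \<and>
     (\<forall>a. a < D \<or> 2 * D \<le> a \<longrightarrow> (M'(R' 32 := R' 30)) a = M a) \<and>
     t \<le> 10 * s + 12 \<and> R' 3 = 1"
    if I: "I (s + 1) R' M' \<and> t \<le> (\<Sum>k<s+1. 8 + 2) + 2" and fr: "\<And>r. r \<notin> writes (While 2 33 ?body) \<Longrightarrow> R' r = ?R r" for R' M' t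
  proof -
    have c: "R' 3 = 1" "R' 30 = x" "R' 37 = ?L" using fr b by auto
    have sl: "?L - s = q" "?L = q + s" using s_def qle by auto
    have r: "R' 32 = D + q" and m: "\<And>j. j < q \<Longrightarrow> M' (D + j) = xs ! j"
      "\<And>j. j < ?L \<Longrightarrow> q \<le> j \<Longrightarrow> M' (D + Suc j) = xs ! j" "\<And>a. a < D \<or> 2 * D \<le> a \<Longrightarrow> M' a = M a"
      using I sl unfolding I_def by auto
    have "holds (insort_key inp x xs) (M'(D + q := x))"
      unfolding holds_def
    proof (intro allI impI)
      fix j assume "j < length (insort_key inp x xs)"
      then have j: "j \<le> ?L" by simp
      consider "j < q" | "j = q" | i where "j = Suc i" "q \<le> i" "i < ?L"
        using j by (metis Suc_le_eq less_Suc_eq_le linorder_neqE_nat not0_implies_Suc not_less0)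
      then show "(M'(D + q := x)) (D + j) = insort_key inp x xs ! j"
        by cases (use m qle in \<open>auto simp: ins nth_append min_def Suc_diff_le\<close>)
    qed
    moreover have "D + q < 2 * D" using qle xs(4) by simp
    ultimately show ?thesis using c r m I by auto
  qed
  have "wp w (While 2 33 ?body) (\<lambda>R' M' t. R' 37 = ?L \<and> holds (insort_key inp x xs) (M'(R' 32 := R' 30)) \<and>
     (\<forall>a. a < D \<or> 2 * D \<le> a \<longrightarrow> (M'(R' 32 := R' 30)) a = M a) \<and> t \<le> 10 * s + 12 \<and> R' 3 = 1) ?R M"
    by (rule wp_conseq[OF loop fin])
  then show ?thesis
    unfolding INSERT_def using D1 b inp xs(4)
    by (simp add: input_def apply_op_exact flen) (erule wp_conseq, auto simp: apply_op_exact)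
qed

lemma CODE:
  assumes env: "env R" and len: "R 37 = length xs" "length xs = b" and xs: "holds xs M" "set xs \<subseteq> {l..<l + b}"
    and b: "R 7 = b" "R 40 = l" "b \<le> D" "l + b \<le> D" "b ^ b \<le> (n + 1) ^ 10"
  shows "wp w CODE (\<lambda>R' M' t. R' 48 = code b l xs \<and> M' = M \<and> t \<le> 7 * b + 5) R M"
proof -
  let ?body = "LOAD 47 45 ;; SETOP Sub 47 47 40 ;; SETOP Mul 48 48 7 ;; SETOP Add 48 48 47 ;;
       SETOP Add 45 45 3"
  let ?R = "R(48 := 0, 45 := D, 46 := D + b)"
  note e = word' len b envD[OF env]
  define I where "I = (\<lambda>k (R1::rstate) (M1::mstate). R1 45 = D + k \<and> R1 48 = code b l (take k xs) \<and> M1 = M)"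
  have step: "R1 45 < R1 46 \<and> wp w ?body (\<lambda>R' M' t. I (Suc k) R' M' \<and> t \<le> 5) R1 M1"
    if k: "k < b" and I: "I k R1 M1" and fr: "\<And>r. r \<notin> writes ?body \<Longrightarrow> R1 r = ?R r" for k R1 M1
  proof -
    have c: "R1 3 = 1" "R1 40 = l" "R1 46 = D + b" "R1 7 = b" using fr e by auto
    have r: "R1 45 = D + k" "R1 48 = code b l (take k xs)" "M1 = M" using I by (auto simp: I_def)
    have x: "M (D + k) = xs ! k" using xs(1) k len by (simp add: holds_def)
    have tk: "take (Suc k) xs = take k xs @ [xs ! k]" using k len by (simp add: take_Suc_conv_app_nth)
    have xk: "l \<le> xs ! k" "xs ! k < l + b" using xs(2) k len nth_mem[of k xs] by (auto simp: subset_iff)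
    \<comment> \<open>A partial Horner value is the code of a prefix and therefore already below
      \<open>b ^ b\<close>, so no intermediate operation overflows.\<close>
    have "code b l (take (Suc k) xs) < b ^ length (take (Suc k) xs)"
      using xs(2) by (intro code_less) (meson in_set_takeD subset_iff)
    also have "\<dots> \<le> b ^ b" using k by (intro power_increasing) auto
    finally have cl: "code b l (take k xs) * b + (xs ! k - l) < 2 ^ w"
      using b word by (simp add: code_snoc tk)
    then show ?thesis
      using c r x xk k b e by (simp add: I_def apply_op_exact code_snoc tk)
  qed
  have loop: "wp w (While 45 46 ?body) (\<lambda>R' M' t. I b R' M' \<and> t \<le> (\<Sum>k<b. 5 + 2) + 2) ?R M"
    by (rule wp_while[of I, OF _ step]) (auto simp: I_def code_def)
  have "wp w (While 45 46 ?body) (\<lambda>R' M' t. R' 48 = code b l xs \<and> M' = M \<and> t \<le> 7 * b + 2) ?R M"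
    by (rule wp_conseq[OF loop]) (auto simp: I_def len)
  then show ?thesis
    unfolding CODE_def using e by (simp add: apply_op_exact)
qed

lemma REMOVE:
  assumes env: "env R" and len: "R 37 = length xs" and xs: "holds xs M" "length xs \<le> D"
    and l: "R 40 = l"
  shows "wp w REMOVE (\<lambda>R' M' t. R' 37 = length (filter (\<lambda>y. y \<noteq> l) xs) \<and>
     holds (filter (\<lambda>y. y \<noteq> l) xs) M' \<and> (\<forall>a. a < D \<or> 2 * D \<le> a \<longrightarrow> M' a = M a) \<and>
     t \<le> 8 * length xs + 6) R M"
proof -
  let ?body = "LOAD 44 41 ;; IfEq 44 40 Skip (STORE 42 44 ;; SETOP Add 42 42 3) ;; SETOP Add 41 41 3"
  let ?L = "length xs"
  let ?R = "R(41 := D, 42 := D, 43 := D + ?L)"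
  let ?f = "\<lambda>k. filter (\<lambda>y. y \<noteq> l) (take k xs)"
  note e = word' len l envD[OF env]
  define I where "I = (\<lambda>k (R1::rstate) (M1::mstate). R1 41 = D + k \<and> R1 42 = D + length (?f k) \<and>
    holds (?f k) M1 \<and> (\<forall>j<?L. k \<le> j \<longrightarrow> M1 (D + j) = xs ! j) \<and> (\<forall>a. a < D \<or> 2 * D \<le> a \<longrightarrow> M1 a = M a))"
  have step: "R1 41 < R1 43 \<and> wp w ?body (\<lambda>R' M' t. I (Suc k) R' M' \<and> t \<le> 6) R1 M1"
    if k: "k < ?L" and I: "I k R1 M1" and fr: "\<And>r. r \<notin> writes ?body \<Longrightarrow> R1 r = ?R r" for k R1 M1
  proof -
    have c: "R1 3 = 1" "R1 40 = l" "R1 43 = D + ?L" using fr e by auto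
    have r: "R1 41 = D + k" "R1 42 = D + length (?f k)" "M1 (D + k) = xs ! k" using I k by (auto simp: I_def)
    have tk: "take (Suc k) xs = take k xs @ [xs ! k]" using k by (simp add: take_Suc_conv_app_nth)
    \<comment> \<open>The write position never passes the read position, so unread entries survive
      the compaction in place.\<close>
    have fl: "length (?f k) \<le> k" using length_filter_le[of "\<lambda>y. y \<noteq> l" "take k xs"] k by simp
    show ?thesis
    proof (cases "xs ! k = l")
      case True
      then have "?f (Suc k) = ?f k" by (simp add: tk)
      then show ?thesis using c r k e xs(2) True I by (simp add: I_def apply_op_exact)
    next
      case False
      then have f: "?f (Suc k) = ?f k @ [xs ! k]" by (simp add: tk)
      have "holds (?f k @ [xs ! k]) (M1(D + length (?f k) := xs ! k))"
        using I by (auto simp: I_def holds_def nth_append less_Suc_eq)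
      then show ?thesis using c r k e xs(2) False I fl unfolding I_def f
        by (simp add: apply_op_exact)
    qed
  qed
  have loop: "wp w (While 41 43 ?body) (\<lambda>R' M' t. I ?L R' M' \<and> t \<le> (\<Sum>k<?L. 6 + 2) + 2) ?R M"
    by (rule wp_while[of I, OF _ step]) (use xs in \<open>auto simp: I_def holds_def\<close>)
  have "length (?f ?L) \<le> D" using length_filter_le[of "\<lambda>y. y \<noteq> l" xs] xs(2) by (metis order.trans take_all order.refl)
  then have "wp w (While 41 43 ?body) (\<lambda>R' M' t. R' 4 = D \<and> R' 42 = D + length (filter (\<lambda>y. y \<noteq> l) xs) \<and> R' 42 \<le> 2 * D \<and>
     holds (filter (\<lambda>y. y \<noteq> l) xs) M' \<and> (\<forall>a. a < D \<or> 2 * D \<le> a \<longrightarrow> M' a = M a) \<and> t \<le> 8 * ?L + 2) ?R M"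
    by (intro wp_conseq[OF loop]) (auto simp: I_def e)
  then show ?thesis
    unfolding REMOVE_def using e xs(2)
    by (simp add: apply_op_exact) (erule wp_conseq, auto simp: apply_op_exact)
qed

text \<open>The start \<open>i\<close> is zero-based, and the text entry with index \<open>j\<close>
  sits at address \<open>m + j\<close>. All ordered pairs are compared by \<open><\<close>, as in
  the double loop of \<open>VERIFY\<close>.\<close>

definition matches :: "nat \<Rightarrow> bool" where
  "matches i \<longleftrightarrow> (\<forall>a<m. \<forall>c<m. inp a < inp c \<longleftrightarrow> inp (m + i + a) < inp (m + i + c))"

definition outputs :: "nat list \<Rightarrow> rstate \<Rightarrow> mstate \<Rightarrow> bool" where
  "outputs ys R M \<longleftrightarrow> R 15 = length ys \<and> (\<forall>j<length ys. M (4 * D + j) = ys ! j)"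

text \<open>The call appends to an earlier output \<open>ys\<close>, so that successive calls build
  one array. The condition \<open>length ys \<le> lo\<close> reflects that each earlier start
  produced at most one entry; it keeps the array below the code table at
  \<open>5 * D\<close>.\<close>

lemma VERIFY:
  assumes env: "env R" and lo: "R 20 = lo" and hi: "R 21 = hi" "hi + m \<le> n + 1"
    and out: "outputs ys R M" "length ys \<le> lo" and inp: "input M"
  shows "wp w VERIFY (\<lambda>R' M' t. outputs (ys @ map Suc (filter matches [lo..<hi])) R' M' \<and>
     (\<forall>a. a < 4 * D \<or> 5 * D \<le> a \<longrightarrow> M' a = M a) \<and>
     t \<le> (hi - lo) * (40 * m ^ 2) + 2) R M"
proof -
  let ?in = "LOAD 25 23 ;; LOAD 26 24 ;; SETOP Add 29 5 20 ;;
           SETOP Add 27 29 23 ;; LOAD 27 27 ;; SETOP Add 28 29 24 ;; LOAD 28 28 ;;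
           IfLess 25 26 (IfLess 27 28 Skip (SETC 22 0)) (IfLess 27 28 (SETC 22 0) Skip) ;;
           SETOP Add 24 24 3"
  let ?mid = "SETOP Add 24 2 2 ;; While 24 5 ?in ;; SETOP Add 23 23 3"
  let ?out = "SETC 22 1 ;; SETOP Add 23 2 2 ;; While 23 5 ?mid ;; SETOP Add 29 20 3 ;;
     IfEq 22 3 (SETOP Add 28 10 15 ;; STORE 28 29 ;; SETOP Add 15 15 3) Skip ;;
     SETOP Add 20 20 3"
  let ?chk = "\<lambda>i a c. inp a < inp c \<longleftrightarrow> inp (m + i + a) < inp (m + i + c)"
  note e = word' envD[OF env]
  have inner: "wp w (While 24 5 ?in) (\<lambda>R' M' t. R' 22 = (if ok \<and> (\<forall>c<m. ?chk i a c) then 1 else 0) \<and> M' = M1 \<and> t \<le> 15 * m + 2) R1 M1"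
    if R1: "env R1" "R1 20 = i" "R1 23 = a" "R1 24 = 0" "R1 22 = (if ok then 1 else 0)" "input M1" "i + m \<le> n" "a < m" for R1 M1 ok i a
  proof -
    define I where "I = (\<lambda>k (R2::rstate) (M2::mstate). R2 24 = k \<and> R2 22 = (if ok \<and> (\<forall>c<k. ?chk i a c) then 1 else 0) \<and> M2 = M1)"
    have step: "R2 24 < R2 5 \<and> wp w ?in (\<lambda>R' M' t. I (Suc k) R' M' \<and> t \<le> 13) R2 M2"
      if k: "k < m" and I: "I k R2 M2" and fr: "\<And>r. r \<notin> writes ?in \<Longrightarrow> R2 r = R1 r" for k R2 M2
    proof -
      have c: "R2 3 = 1" "R2 5 = m" "R2 20 = i" "R2 23 = a" using fr R1 envD[OF R1(1)] by auto
      have r: "R2 24 = k" "R2 22 = (if ok \<and> (\<forall>c<k. ?chk i a c) then 1 else 0)" "M2 = M1" using I by (auto simp: I_def)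
      have mm: "M1 a = inp a" "M1 k = inp k" "M1 (m + i + a) = inp (m + i + a)" "M1 (m + i + k) = inp (m + i + k)"
        using R1 k unfolding input_def D_def by auto
      have bd: "m + i < 2 ^ w" "m + i + a < 2 ^ w" "m + i + k < 2 ^ w" "k + 1 < 2 ^ w" using R1 k word'(1) by (simp_all add: D_def)
      show ?thesis using c r k mm bd by (auto simp: I_def apply_op_exact less_Suc_eq)
    qed
    have "wp w (While 24 5 ?in) (\<lambda>R' M' t. I m R' M' \<and> t \<le> (\<Sum>k<m. 13 + 2) + 2) R1 M1"
      by (rule wp_while[of I, OF _ step]) (use R1 envD[OF R1(1)] in \<open>auto simp: I_def\<close>)
    then show ?thesis by (rule wp_conseq) (auto simp: I_def)
  qed
  have middle: "wp w (While 23 5 ?mid) (\<lambda>R' M' t. R' 22 = (if matches i then 1 else 0) \<and> M' = M1 \<and> t \<le> m * (6 + 15 * m) + 2) R1 M1"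
    if R1: "env R1" "R1 20 = i" "R1 23 = 0" "R1 22 = 1" "input M1" "i + m \<le> n" for R1 M1 i
  proof -
    define I where "I = (\<lambda>k (R2::rstate) (M2::mstate). R2 23 = k \<and> R2 22 = (if \<forall>a<k. \<forall>c<m. ?chk i a c then 1 else 0) \<and> M2 = M1)"
    have step: "R2 23 < R2 5 \<and> wp w ?mid (\<lambda>R' M' t. I (Suc k) R' M' \<and> t \<le> 15 * m + 4) R2 M2"
      if k: "k < m" and I: "I k R2 M2" and fr: "\<And>r. r \<notin> writes ?mid \<Longrightarrow> R2 r = R1 r" for k R2 M2
    proof -
      have c: "R2 3 = 1" "R2 2 = 0" "R2 5 = m" "R2 20 = i" using fr R1 envD[OF R1(1)] by auto
      have r: "R2 23 = k" "R2 22 = (if \<forall>a<k. \<forall>c<m. ?chk i a c then 1 else 0)" "M2 = M1" using I by (auto simp: I_def)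
      have env2: "env (R2(24 := 0))" using fr R1(1) by (simp add: env_def)
      have row: "wp w (While 24 5 ?in) (\<lambda>R' M' t. R' 23 = k \<and> R' 3 = 1 \<and> R' 22 = (if (\<forall>a<k. \<forall>c<m. ?chk i a c) \<and> (\<forall>c<m. ?chk i k c) then 1 else 0) \<and> M' = M1 \<and> t \<le> 15 * m + 2) (R2(24 := 0)) M1"
        by (rule wp_conseq[OF inner[OF env2, of i k "\<forall>a<k. \<forall>c<m. ?chk i a c"]]) (use r c R1 k in auto)
      have "k + 1 < 2 ^ w" using k e R1 unfolding D_def by simp
      then have "wp w (While 24 5 ?in ;; SETOP Add 23 23 3) (\<lambda>R' M' t. I (Suc k) R' M' \<and> t \<le> 15 * m + 3) (R2(24 := 0)) M1"
        unfolding wp_simps(6) by (intro wp_conseq[OF row]) (auto simp: I_def apply_op_exact less_Suc_eq)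
      then show ?thesis using c r k by (simp add: apply_op_exact)
    qed
    have "wp w (While 23 5 ?mid) (\<lambda>R' M' t. I m R' M' \<and> t \<le> (\<Sum>k<m. (15 * m + 4) + 2) + 2) R1 M1"
      by (rule wp_while[of I, OF _ step]) (use R1 envD[OF R1(1)] in \<open>auto simp: I_def\<close>)
    then show ?thesis by (rule wp_conseq) (auto simp: I_def matches_def)
  qed
  define I where "I = (\<lambda>k (R1::rstate) (M1::mstate). R1 20 = lo + k \<and> outputs (ys @ map Suc (filter matches [lo..<lo + k])) R1 M1 \<and>
    (\<forall>a. a < 4 * D \<or> 5 * D \<le> a \<longrightarrow> M1 a = M a))"
  define N where "N = hi - lo"
  have step: "R1 20 < R1 21 \<and> wp w ?out (\<lambda>R' M' t. I (Suc k) R' M' \<and> t \<le> m * (6 + 15 * m) + 12) R1 M1"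
    if k: "k < N" and I: "I k R1 M1" and fr: "\<And>r. r \<notin> writes ?out \<Longrightarrow> R1 r = R r" for k R1 M1
  proof -
    have c: "R1 3 = 1" "R1 2 = 0" "R1 5 = m" "R1 21 = hi" "R1 10 = 4 * D" using fr hi e by auto
    let ?o = "ys @ map Suc (filter matches [lo..<lo + k])"
    have r: "R1 20 = lo + k" "R1 15 = length ?o" "outputs ?o R1 M1" "\<And>a. a < 4 * D \<or> 5 * D \<le> a \<Longrightarrow> M1 a = M a"
      using I by (auto simp: I_def outputs_def)
    have kb: "lo + k + m \<le> n" using k hi unfolding N_def by simp
    have ol: "length ?o \<le> lo + k" using out(2) length_filter_le[of matches "[lo..<lo + k]"] by simp
    have inp1: "input M1" using inp r(4) unfolding input_def by simp
    have up: "[lo..<lo + Suc k] = [lo..<lo + k] @ [lo + k]" by simp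
    let ?R1 = "R1(22 := 1, 23 := 0)"
    have mid: "wp w (While 23 5 ?mid) (\<lambda>R' M' t. R' 20 = lo + k \<and> R' 3 = 1 \<and> R' 10 = 4 * D \<and> R' 15 = length ?o \<and>
        R' 22 = (if matches (lo + k) then 1 else 0) \<and> M' = M1 \<and> t \<le> m * (6 + 15 * m) + 2) ?R1 M1"
      by (rule wp_conseq[OF middle[of _ "lo + k"]]) (use fr env r c kb inp1 in \<open>auto simp: env_def\<close>)
    have bd: "Suc (lo + k) < 2 ^ w" "4 * D + length ?o < 2 ^ w" "length ?o < D" "length ?o + 1 < 2 ^ w"
      using kb ol e m_pos unfolding D_def by simp_all
    have new: "outputs (?o @ [Suc (lo + k)]) R' (M1(4 * D + length ?o := Suc (lo + k)))"
      if "R' 15 = Suc (length ?o)" for R' :: rstate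
      using r(3) that unfolding outputs_def by (simp add: nth_append less_Suc_eq del: map_append filter_append append_assoc)
    have old: "outputs ?o R' M1" if "R' 15 = length ?o" for R' :: rstate
      using r(3) that unfolding outputs_def by simp
    have "wp w (While 23 5 ?mid ;; SETOP Add 29 20 3 ;;
     IfEq 22 3 (SETOP Add 28 10 15 ;; STORE 28 29 ;; SETOP Add 15 15 3) Skip ;;
     SETOP Add 20 20 3) (\<lambda>R' M' t. I (Suc k) R' M' \<and> t \<le> m * (6 + 15 * m) + 10) ?R1 M1"
      unfolding wp_simps(6)
    proof (rule wp_conseq[OF mid], goal_cases)
      case (1 R' M' t)
      show ?case
      proof (cases "matches (lo + k)")
        case True
        let ?R2 = "R'(29 := Suc (lo + k), 28 := 4 * D + length ?o, 15 := Suc (length ?o), 20 := Suc (lo + k))"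
        have "outputs (?o @ [Suc (lo + k)]) ?R2 (M1(4 * D + length ?o := Suc (lo + k)))" by (rule new) simp
        then have "I (Suc k) ?R2 (M1(4 * D + length ?o := Suc (lo + k)))"
          using r(4) bd(3) True by (simp add: I_def)
        then show ?thesis using 1 c r(1) bd True by (simp add: apply_op_exact)
      next
        case False
        let ?R2 = "R'(29 := Suc (lo + k), 20 := Suc (lo + k))"
        have "outputs ?o ?R2 M1" by (rule old) (use 1 in simp)
        then have "I (Suc k) ?R2 M1" using r(4) False by (simp add: I_def)
        then show ?thesis using 1 c r(1) bd False by (simp add: apply_op_exact)
      qed
    qed
    then have "wp w ?out (\<lambda>R' M' t. I (Suc k) R' M' \<and> t \<le> m * (6 + 15 * m) + 12) R1 M1"
      using c by (simp add: wp_pre apply_op_exact del: wp_simps(6)) (erule wp_conseq, simp)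
    then show ?thesis using c r k N_def by simp
  qed
  have loop: "wp w (While 20 21 ?out) (\<lambda>R' M' t. I N R' M' \<and> t \<le> (\<Sum>k<N. (m * (6 + 15 * m) + 12) + 2) + 2) R M"
    by (rule wp_while[of I, OF _ step]) (use lo hi out in \<open>auto simp: I_def N_def\<close>)
  have "14 + m * (6 + 15 * m) \<le> 40 * m ^ 2"
  proof -
    have "1 \<le> m * m" "m \<le> m * m" using m_pos by auto
    then have "6 * m + 15 * (m * m) + 14 \<le> 40 * (m * m)" by linarith
    then show ?thesis by (simp add: power2_eq_square distrib_left mult.commute mult.left_commute)
  qed
  then have tb: "N * (14 + m * (6 + 15 * m)) \<le> (hi - lo) * (40 * m ^ 2)" unfolding N_def by (rule mult_le_mono2)
  have "[lo..<lo + N] = [lo..<hi]" unfolding N_def by (cases "lo \<le> hi") auto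
  then show ?thesis unfolding VERIFY_def by (intro wp_conseq[OF loop]) (use tb in \<open>auto simp: I_def\<close>)
qed

end

section \<open>Preprocessing of the pattern\<close>

text \<open>Register 50 is the next pattern address to insert. The first window is sorted by plain
  insertion; its cost of order \<open>b ^ 2\<close> is absorbed by \<open>m * b\<close>.\<close>

definition PRE :: com where
  "PRE = SETC 37 0 ;; SETC 50 0 ;;
    While 50 7 (SETOP Add 30 50 2 ;; INSERT ;; SETOP Add 50 50 3) ;;
    SETC 40 0 ;; CODE ;; SETOP Add 51 11 48 ;; STORE 51 3 ;;
    While 50 5
      (REMOVE ;; SETOP Add 30 50 2 ;; INSERT ;; SETOP Add 40 40 3 ;; SETOP Add 50 50 3 ;;
       CODE ;; SETOP Add 51 11 48 ;; STORE 51 3)"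

text \<open>A new entry becomes the head of its list. This takes constant time and reverses the
  order inside a bucket.\<close>

definition BUCKET :: com where
  "BUCKET = SETOP Add 57 40 2 ;; SETOP Add 58 40 7 ;;
    While 57 58
      (LOAD 59 57 ;; SETOP Mul 59 59 7 ;; SETOP Div 59 59 14 ;; SETOP Add 60 8 59 ;;
       LOAD 61 60 ;; SETOP Add 62 9 57 ;; STORE 62 61 ;; STORE 60 57 ;; SETOP Add 57 57 3)"

text \<open>Each head is reset to 0 as soon as its list has been read, so the next block finds empty
  buckets without a separate clearing pass.\<close>

definition COLLECT :: com where
  "COLLECT = SETC 37 0 ;; SETOP Add 60 8 2 ;; SETOP Add 63 8 7 ;;
    While 60 63
      (LOAD 30 60 ;;
       While 2 30 (INSERT ;; SETOP Add 61 9 30 ;; LOAD 30 61) ;;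
       STORE 60 2 ;; SETOP Add 60 60 3)"

text \<open>The list of indices sorted by key. The inner sorted list merely picks an enumeration of
  \<open>S\<close>; for \<open>f\<close> injective on \<open>S\<close> the result does not depend on
  it.\<close>

definition lst :: "('a::linorder \<Rightarrow> 'b::linorder) \<Rightarrow> 'a set \<Rightarrow> 'a list" where
  "lst f S = sort_key f (sorted_list_of_set S)"

lemma lst_props:
  assumes "finite S"
  shows "sorted (map f (lst f S))" "set (lst f S) = S" "distinct (lst f S)" "length (lst f S) = card S"
  using assms by (auto simp: lst_def)

lemma lst_unique:
  assumes "finite S" "inj_on f S" "sorted (map f xs)" "distinct xs" "set xs = S"
  shows "xs = lst f S"
  using map_sorted_distinct_set_unique[of f xs "lst f S"] lst_props[OF assms(1), of f] assms
  by (simp add: distinct_map)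

lemma lst_insert:
  assumes "finite S" "inj_on f (insert x S)" "x \<notin> S"
  shows "insort_key f x (lst f S) = lst f (insert x S)"
  using lst_props[OF assms(1), of f] assms
  by (intro lst_unique) (auto simp: sorted_insort_key set_insort_key distinct_insort)

lemma lst_remove:
  assumes "finite S" "inj_on f S"
  shows "filter (\<lambda>y. y \<noteq> l) (lst f S) = lst f (S - {l})"
  using lst_props[OF assms(1), of f] assms
  by (intro lst_unique) (auto simp: sorted_filter intro: inj_on_subset)

context ram
begin

definition arr :: "nat set \<Rightarrow> rstate \<Rightarrow> mstate \<Rightarrow> bool" where
  "arr S R M \<longleftrightarrow> finite S \<and> R 37 = card S \<and> holds (lst inp S) M"

lemma INSERT_arr:
  assumes "env R" "arr S R M" "insert x S \<subseteq> {..<D}" "inj_on inp (insert x S)" "x \<notin> S" "R 30 = x" "input M"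
  shows "wp w INSERT (\<lambda>R' M' t. arr (insert x S) R' M' \<and>
     (\<forall>a. a < D \<or> 2 * D \<le> a \<longrightarrow> M' a = M a) \<and> t \<le> 20 + 10 * card {y \<in> S. inp x < inp y}) R M"
proof -
  have S: "finite S" "R 37 = card S" "holds (lst inp S) M" using assms by (auto simp: arr_def)
  note p = lst_props[OF S(1), of inp]
  have "card (insert x S) \<le> card {..<D}" using assms(3) by (intro card_mono) auto
  then have "card S < D" using S(1) assms(5) by simp
  moreover have "length (filter P (lst inp S)) = card {y \<in> S. P y}" for P
    using p by (metis distinct_card distinct_filter set_filter)
  moreover have "insort_key inp x (lst inp S) = lst inp (insert x S)" using lst_insert assms S by blast
  moreover have "inp x \<notin> inp ` S" using assms(4,5) by (auto simp: inj_on_def)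
  ultimately show ?thesis
    using INSERT[of R "lst inp S" M x] assms p S by (simp add: arr_def card_insert_disjoint)
qed

lemma REMOVE_arr:
  assumes "env R" "arr S R M" "card S \<le> D" "inj_on inp S" "R 40 = l"
  shows "wp w REMOVE (\<lambda>R' M' t. arr (S - {l}) R' M' \<and>
     (\<forall>a. a < D \<or> 2 * D \<le> a \<longrightarrow> M' a = M a) \<and> t \<le> 8 * card S + 6) R M"
proof -
  have S: "finite S" "R 37 = card S" "holds (lst inp S) M" using assms by (auto simp: arr_def)
  have "length (filter (\<lambda>y. y \<noteq> l) (lst inp S)) = card (S - {l})"
    using lst_remove[OF S(1) assms(4)] lst_props(4)[of "S - {l}"] S by simp
  then show ?thesis
    using REMOVE[of R "lst inp S" M l] assms lst_props[OF S(1), of inp] lst_remove[OF S(1) assms(4)] S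
    by (simp add: arr_def)
qed

end

text \<open>Because of \<open>2 * b \<le> m\<close> the distance \<open>m + 1 - b\<close> between
  blocks exceeds \<open>m / 2\<close>, which leaves \<open>O(n / m)\<close> blocks. The range
  condition concerns the text, the only part that is bucketed.\<close>

locale ramf = ram +
  fixes b :: nat
  assumes b_pos: "1 \<le> b" and b_le: "2 * b \<le> m" and b_pow: "b ^ b \<le> (n + 1) ^ 10"
    and inj_pattern: "inj_on inp {..<m}" and inj_text: "inj_on inp {m..<m + n}"
    and text_range: "\<And>a. m \<le> a \<Longrightarrow> a < m + n \<Longrightarrow> inp a \<le> n"
begin

definition envf :: "rstate \<Rightarrow> bool" where
  "envf R \<longleftrightarrow> env R \<and> R 7 = b \<and> R 8 = 2 * D \<and> R 9 = 3 * D \<and> R 11 = 5 * D \<and> R 12 = n + 1 - m \<and>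
     R 13 = m + 1 - b \<and> R 14 = n + 1"

lemma envfD: "envf R \<Longrightarrow> env R" "envf R \<Longrightarrow> R 7 = b" "envf R \<Longrightarrow> R 8 = 2 * D" "envf R \<Longrightarrow> R 9 = 3 * D"
  "envf R \<Longrightarrow> R 11 = 5 * D" "envf R \<Longrightarrow> R 12 = n + 1 - m" "envf R \<Longrightarrow> R 13 = m + 1 - b" "envf R \<Longrightarrow> R 14 = n + 1"
  by (auto simp: envf_def)

text \<open>Here \<open>l\<close> is a memory address, so one function encodes pattern factors
  (\<open>l \<le> m - b\<close>) as well as text blocks (\<open>l \<ge> m\<close>).\<close>

definition wcode :: "nat \<Rightarrow> nat" where
  "wcode l = code b l (lst inp {l..<l + b})"

lemma wcode_less: "5 * D + wcode l < 2 ^ w"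
proof -
  have "wcode l < b ^ length (lst inp {l..<l + b})"
    unfolding wcode_def by (rule code_less) (simp add: lst_props)
  also have "\<dots> \<le> (n + 1) ^ 10" using b_pow by (simp add: lst_props)
  finally have "wcode l < (n + 1) ^ 10" .
  moreover have "5 * D \<le> 16 * n" using m_le_n by (simp add: D_def)
  ultimately show ?thesis using word by linarith
qed

lemma CODE_arr:
  assumes "env R" "arr {l..<l + b} R M" "R 7 = b" "R 40 = l" "l + b \<le> D"
  shows "wp w CODE (\<lambda>R' M' t. R' 48 = wcode l \<and> M' = M \<and> t \<le> 7 * b + 5) R M"
  unfolding wcode_def
  using assms b_pow by (intro CODE) (auto simp: arr_def lst_props)

lemma PRE:
  assumes env: "envf R" and inp: "input M" and zero: "\<And>c. M (5 * D + c) = 0"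
  shows "wp w PRE (\<lambda>R' M' t. (\<forall>a. a < D \<or> 2 * D \<le> a \<and> a < 5 * D \<longrightarrow> M' a = M a) \<and>
     (\<forall>c. M' (5 * D + c) = (if c \<in> wcode ` {0..m - b} then 1 else 0)) \<and> t \<le> 200 * (m * b)) R M"
proof -
  let ?b1 = "SETOP Add 30 50 2 ;; INSERT ;; SETOP Add 50 50 3"
  let ?b2 = "REMOVE ;; SETOP Add 30 50 2 ;; INSERT ;; SETOP Add 40 40 3 ;; SETOP Add 50 50 3 ;;
       CODE ;; SETOP Add 51 11 48 ;; STORE 51 3"
  note e = word' envfD[OF env] envD[OF envfD(1)[OF env]]
  have mD: "m < D" "b \<le> m" using m_pos m_le_n b_le unfolding D_def by auto
  have fill: "wp w (While 50 7 ?b1) (\<lambda>R' M' t. arr {0..<b} R' M' \<and> R' 50 = b \<and>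
      (\<forall>a. a < D \<or> 2 * D \<le> a \<longrightarrow> M' a = M a) \<and> t \<le> b * (24 + 10 * b) + 2) R1 M"
    if R1: "envf R1" "R1 37 = 0" "R1 50 = 0" for R1
  proof -
    define I where "I = (\<lambda>k (R2::rstate) (M2::mstate). R2 50 = k \<and> arr {0..<k} R2 M2 \<and>
      (\<forall>a. a < D \<or> 2 * D \<le> a \<longrightarrow> M2 a = M a))"
    note e1 = envfD[OF R1(1)] envD[OF envfD(1)[OF R1(1)]]
    have step: "R2 50 < R2 7 \<and> wp w ?b1 (\<lambda>R' M' t. I (Suc k) R' M' \<and> t \<le> 22 + 10 * b) R2 M2"
      if k: "k < b" and I: "I k R2 M2" and fr: "\<And>r. r \<notin> writes ?b1 \<Longrightarrow> R2 r = R1 r" for k R2 M2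
    proof -
      have c: "R2 3 = 1" "R2 2 = 0" "R2 7 = b" using fr e1 by (auto simp: INSERT_def)
      have r: "R2 50 = k" "arr {0..<k} R2 M2" "\<And>a. a < D \<or> 2 * D \<le> a \<Longrightarrow> M2 a = M a" using I by (auto simp: I_def)
      have env2: "env (R2(30 := k))" using fr e1 by (auto simp: env_def INSERT_def)
      have kb: "k + 1 < 2 ^ w" using k mD e by simp
      have s: "insert k {0..<k} = {0..<Suc k}" by auto
      have "{0..<Suc k} \<subseteq> {..<m}" using k mD by auto
      note ij = inj_on_subset[OF inj_pattern this]
      have "wp w INSERT (\<lambda>R' M' t. arr {0..<Suc k} R' M' \<and>
          (\<forall>a. a < D \<or> 2 * D \<le> a \<longrightarrow> M' a = M2 a) \<and> t \<le> 20 + 10 * card {y \<in> {0..<k}. inp k < inp y}) (R2(30 := k)) M2"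
        unfolding s[symmetric]
      proof (rule INSERT_arr[OF env2])
        show "insert k {0..<k} \<subseteq> {..<D}" "inj_on inp (insert k {0..<k})"
          unfolding s using k mD ij by auto
      qed (use r inp in \<open>auto simp: arr_def input_def\<close>)
      moreover have "card {y \<in> {0..<k}. inp k < inp y} \<le> b"
      proof -
        have "card {y \<in> {0..<k}. inp k < inp y} \<le> card {0..<k}" by (intro card_mono) auto
        then show ?thesis using k by simp
      qed
      ultimately have "wp w (INSERT ;; SETOP Add 50 50 3) (\<lambda>R' M' t. I (Suc k) R' M' \<and> t \<le> 21 + 10 * b) (R2(30 := k)) M2"
        unfolding wp_simps(6) using c r kb
        by (elim wp_conseq) (auto simp: I_def apply_op_exact arr_def INSERT_def)
      then show ?thesis using c r k kb by (simp add: wp_pre apply_op_exact del: wp_simps(6)) ((erule wp_conseq, simp)?)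
    qed
    have "wp w (While 50 7 ?b1) (\<lambda>R' M' t. I b R' M' \<and> t \<le> (\<Sum>k<b. (22 + 10 * b) + 2) + 2) R1 M"
      by (rule wp_while[of I, OF _ step]) (use R1 e1 in \<open>auto simp: I_def arr_def holds_def lst_def INSERT_def\<close>)
    then show ?thesis by (rule wp_conseq) (auto simp: I_def)
  qed
  have slide: "wp w (While 50 5 ?b2) (\<lambda>R' M' t. (\<forall>a. a < D \<or> 2 * D \<le> a \<and> a < 5 * D \<longrightarrow> M' a = M1 a) \<and>
      (\<forall>c. M' (5 * D + c) = (if c \<in> wcode ` {0..m - b} then 1 else 0)) \<and> t \<le> (m - b) * (50 + 25 * b) + 2) R1 M1"
    if R1: "envf R1" "R1 40 = 0" "R1 50 = b" "arr {0..<b} R1 M1" "input M1"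
      "\<And>c. M1 (5 * D + c) = (if c \<in> wcode ` {0..0} then 1 else 0)" for R1 M1
  proof -
    define I where "I = (\<lambda>k (R2::rstate) (M2::mstate). R2 50 = k + b \<and> R2 40 = k \<and> arr {k..<k + b} R2 M2 \<and>
      (\<forall>a. a < D \<or> 2 * D \<le> a \<and> a < 5 * D \<longrightarrow> M2 a = M1 a) \<and>
      (\<forall>c. M2 (5 * D + c) = (if c \<in> wcode ` {0..k} then 1 else 0)))"
    note e1 = envfD[OF R1(1)] envD[OF envfD(1)[OF R1(1)]]
    have step: "R2 50 < R2 5 \<and> wp w ?b2 (\<lambda>R' M' t. I (Suc k) R' M' \<and> t \<le> 48 + 25 * b) R2 M2"
      if k: "k < m - b" and I: "I k R2 M2" and fr: "\<And>r. r \<notin> writes ?b2 \<Longrightarrow> R2 r = R1 r" for k R2 M2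
    proof -
      have c: "envf R2" using fr R1(1) by (auto simp: envf_def env_def INSERT_def REMOVE_def CODE_def)
      note e2 = envfD[OF c] envD[OF envfD(1)[OF c]]
      have r: "R2 50 = k + b" "R2 40 = k" "arr {k..<k + b} R2 M2"
        "\<And>a. a < D \<or> 2 * D \<le> a \<and> a < 5 * D \<Longrightarrow> M2 a = M1 a"
        "\<And>c. M2 (5 * D + c) = (if c \<in> wcode ` {0..k} then 1 else 0)"
        using I by (auto simp: I_def)
      have kb: "k + b + 1 < 2 ^ w" "k + b + 1 \<le> D" using k mD e by simp_all
      let ?S = "{k..<k + b} - {k}"
      have sub: "insert (k + b) ?S = {Suc k..<Suc k + b}" using b_pos by auto
      have sm: "{Suc k..<Suc k + b} \<subseteq> {..<m}" "{k..<k + b} \<subseteq> {..<m}" using k by auto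
      have rem: "wp w REMOVE (\<lambda>R' M' t. R' 40 = k \<and> R' 50 = k + b \<and> envf R' \<and> arr ?S R' M' \<and> (\<forall>a. a < D \<or> 2 * D \<le> a \<longrightarrow> M' a = M2 a) \<and> t \<le> 8 * b + 6) R2 M2"
        by (rule wp_conseq[OF REMOVE_arr[of R2 "{k..<k + b}" M2 k]])
          (use e2 r c mD inj_on_subset[OF inj_pattern sm(2)] in \<open>auto simp: envf_def env_def REMOVE_def\<close>)
      have ins: "wp w INSERT (\<lambda>R' M' t. R' 40 = k \<and> R' 50 = k + b \<and> envf R' \<and> arr {Suc k..<Suc k + b} R' M' \<and>
          (\<forall>a. a < D \<or> 2 * D \<le> a \<longrightarrow> M' a = M2 a) \<and> t \<le> 20 + 10 * b) (R3(30 := k + b)) M3"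
        if R3: "R3 40 = k" "R3 50 = k + b" "envf R3" "arr ?S R3 M3" "\<forall>a. a < D \<or> 2 * D \<le> a \<longrightarrow> M3 a = M2 a" for R3 M3
      proof -
        have "wp w INSERT (\<lambda>R' M' t. arr {Suc k..<Suc k + b} R' M' \<and>
          (\<forall>a. a < D \<or> 2 * D \<le> a \<longrightarrow> M' a = M3 a) \<and> t \<le> 20 + 10 * card {y \<in> ?S. inp (k + b) < inp y}) (R3(30 := k + b)) M3"
          unfolding sub[symmetric]
        proof (rule INSERT_arr)
          show "insert (k + b) ?S \<subseteq> {..<D}" "inj_on inp (insert (k + b) ?S)"
            unfolding sub using sm mD inj_on_subset[OF inj_pattern sm(1)] by auto
        qed (use R3 r(4) R1(5) in \<open>auto simp: envf_def env_def arr_def input_def\<close>)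
        \<comment> \<open>Even if all remaining entries have to move, one slide of the window costs
          \<open>O(b)\<close>.\<close>
        moreover have "card {y \<in> ?S. inp (k + b) < inp y} \<le> card {k..<k + b}" by (intro card_mono) auto
        ultimately show ?thesis
          by (elim wp_conseq) (use R3 in \<open>auto simp: envf_def env_def INSERT_def\<close>)
      qed
      have cod: "wp w CODE (\<lambda>R' M' t. R' 40 = Suc k \<and> R' 50 = Suc k + b \<and> envf R' \<and> arr {Suc k..<Suc k + b} R' M' \<and> R' 48 = wcode (Suc k) \<and> M' = M3 \<and> t \<le> 7 * b + 5) R3 M3"
        if R3: "R3 40 = Suc k" "R3 50 = Suc k + b" "envf R3" "arr {Suc k..<Suc k + b} R3 M3" for R3 M3
        by (rule wp_conseq[OF CODE_arr[of R3 "Suc k"]]) (use R3 kb envfD(1,2)[OF R3(3)] in \<open>auto simp: envf_def env_def CODE_def arr_def\<close>)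
      have tab: "I (Suc k) R4 (M4(5 * D + wcode (Suc k) := 1))"
        if "R4 40 = Suc k" "R4 50 = Suc k + b" "arr {Suc k..<Suc k + b} R4 M4" "\<forall>a. a < D \<or> 2 * D \<le> a \<longrightarrow> M4 a = M2 a" for R4 M4
        using that r(4,5) kb by (auto simp: I_def arr_def holds_def lst_props atLeastAtMostSuc_conv)
      have "wp w ?b2 (\<lambda>R' M' t. I (Suc k) R' M' \<and> t \<le> 48 + 25 * b) R2 M2"
      proof (rule wp_Seq[OF rem], goal_cases)
        case (1 R3 M3 t3)
        then have R3: "R3 40 = k" "R3 50 = k + b" "envf R3" "arr ?S R3 M3" "\<forall>a. a < D \<or> 2 * D \<le> a \<longrightarrow> M3 a = M2 a" "t3 \<le> 8 * b + 6"
          by auto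
        note e3 = envfD[OF R3(3)] envD[OF envfD(1)[OF R3(3)]]
        have "wp w (INSERT ;; SETOP Add 40 40 3 ;; SETOP Add 50 50 3 ;; CODE ;; SETOP Add 51 11 48 ;; STORE 51 3)
          (\<lambda>R' M' t. I (Suc k) R' M' \<and> t \<le> 29 + 17 * b) (R3(30 := k + b)) M3"
        proof (rule wp_Seq[OF ins[OF R3(1-5)]], goal_cases)
          case (1 R4 M4 t4)
          then have R4: "R4 40 = k" "R4 50 = k + b" "envf R4" "arr {Suc k..<Suc k + b} R4 M4"
            "\<forall>a. a < D \<or> 2 * D \<le> a \<longrightarrow> M4 a = M2 a" "t4 \<le> 20 + 10 * b"
            by auto
          note e4 = envfD[OF R4(3)] envD[OF envfD(1)[OF R4(3)]]
          let ?R4 = "R4(40 := Suc k, 50 := Suc k + b)"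
          have "wp w (CODE ;; SETOP Add 51 11 48 ;; STORE 51 3) (\<lambda>R' M' t. I (Suc k) R' M' \<and> t \<le> 7 + 7 * b) ?R4 M4"
          proof (rule wp_Seq[OF cod], goal_cases)
            case (5 R5 M5 t5)
            then have R5: "R5 40 = Suc k" "R5 50 = Suc k + b" "envf R5" "arr {Suc k..<Suc k + b} R5 M4" "R5 48 = wcode (Suc k)" "M5 = M4" "t5 \<le> 7 * b + 5"
              by auto
            note e5 = envfD[OF R5(3)] envD[OF envfD(1)[OF R5(3)]]
            have "I (Suc k) (R5(51 := 5 * D + wcode (Suc k))) (M4(5 * D + wcode (Suc k) := 1))"
              by (rule tab) (use R5 R4(5) in \<open>auto simp: arr_def\<close>)
            then show ?case using R5 e5 wcode_less[of "Suc k"] by (simp add: apply_op_exact)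
          qed (use R4 in \<open>auto simp: envf_def env_def arr_def\<close>)
          then show ?case using R4 e4 kb
            by (simp add: wp_pre apply_op_exact del: wp_simps(6)) ((erule wp_conseq, simp)?)
        qed
        then show ?case using R3 e3 kb
          by (simp add: wp_pre apply_op_exact del: wp_simps(6)) ((erule wp_conseq, simp)?)
      qed
      then show ?thesis using r e2 k by simp
    qed
    have "wp w (While 50 5 ?b2) (\<lambda>R' M' t. I (m - b) R' M' \<and> t \<le> (\<Sum>k<m-b. (48 + 25 * b) + 2) + 2) R1 M1"
      by (rule wp_while[of I, OF _ step]) (use R1 e1 mD in \<open>auto simp: I_def INSERT_def REMOVE_def CODE_def\<close>)
    then show ?thesis by (rule wp_conseq) (auto simp: I_def)
  qed
  have tm: "(b * (24 + 10 * b) + 2) + ((m - b) * (50 + 25 * b) + 2) + 7 * b + 10 \<le> 200 * (m * b)"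
  proof -
    have "b * b \<le> m * b" "b \<le> m * b" "1 \<le> m * b" "m \<le> m * b" using mD b_pos by auto
    moreover have "(m - b) * (50 + 25 * b) \<le> m * (50 + 25 * b)" by simp
    moreover have "b * (24 + 10 * b) = 24 * b + 10 * (b * b)" "m * (50 + 25 * b) = 50 * m + 25 * (m * b)"
      by (simp_all add: distrib_left mult.left_commute)
    ultimately show ?thesis by linarith
  qed
  have "wp w (While 50 7 ?b1 ;; SETC 40 0 ;; CODE ;; SETOP Add 51 11 48 ;; STORE 51 3 ;; While 50 5 ?b2)
     (\<lambda>R' M' t. (\<forall>a. a < D \<or> 2 * D \<le> a \<and> a < 5 * D \<longrightarrow> M' a = M a) \<and>
     (\<forall>c. M' (5 * D + c) = (if c \<in> wcode ` {0..m - b} then 1 else 0)) \<and> t + 2 \<le> 200 * (m * b)) (R(37 := 0, 50 := 0)) M"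
  proof (rule wp_Seq[OF wp_conseq[OF fill[of "R(37 := 0, 50 := 0)"],
        where Q' = "\<lambda>R' M' t. envf R' \<and> arr {0..<b} R' M' \<and> R' 50 = b \<and> (\<forall>a. a < D \<or> 2 * D \<le> a \<longrightarrow> M' a = M a) \<and> t \<le> b * (24 + 10 * b) + 2"]], goal_cases)
    case (5 R1 M1 t1)
    then have R1: "envf R1" "arr {0..<b} R1 M1" "R1 50 = b" "\<And>a. a < D \<or> 2 * D \<le> a \<Longrightarrow> M1 a = M a" "t1 \<le> b * (24 + 10 * b) + 2" by auto
    note e1 = envfD[OF R1(1)] envD[OF envfD(1)[OF R1(1)]]
    let ?R1 = "R1(40 := 0)"
    have "wp w (CODE ;; SETOP Add 51 11 48 ;; STORE 51 3 ;; While 50 5 ?b2)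
     (\<lambda>R' M' t. (\<forall>a. a < D \<or> 2 * D \<le> a \<and> a < 5 * D \<longrightarrow> M' a = M a) \<and>
     (\<forall>c. M' (5 * D + c) = (if c \<in> wcode ` {0..m - b} then 1 else 0)) \<and> t1 + t + 3 \<le> 200 * (m * b)) ?R1 M1"
    proof (rule wp_Seq[OF wp_conseq[OF CODE_arr[of ?R1 0],
          where Q' = "\<lambda>R' M' t. envf R' \<and> R' 40 = 0 \<and> R' 50 = b \<and> R' 37 = R1 37 \<and> R' 48 = wcode 0 \<and> M' = M1 \<and> t \<le> 7 * b + 5"]], goal_cases)
      case (7 R2 M2 t2)
      then have R2: "envf R2" "R2 40 = 0" "R2 50 = b" "R2 37 = R1 37" "R2 48 = wcode 0" "M2 = M1" "t2 \<le> 7 * b + 5" by auto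
      note e2 = envfD[OF R2(1)] envD[OF envfD(1)[OF R2(1)]]
      let ?R3 = "R2(51 := 5 * D + wcode 0)" and ?M3 = "M1(5 * D + wcode 0 := 1)"
      have "wp w (While 50 5 ?b2) (\<lambda>R' M' t. (\<forall>a. a < D \<or> 2 * D \<le> a \<and> a < 5 * D \<longrightarrow> M' a = ?M3 a) \<and>
      (\<forall>c. M' (5 * D + c) = (if c \<in> wcode ` {0..m - b} then 1 else 0)) \<and> t \<le> (m - b) * (50 + 25 * b) + 2) ?R3 ?M3"
      proof (rule slide)
        show "arr {0..<b} ?R3 ?M3" using R1(2) R2(4) mD by (auto simp: arr_def holds_def lst_props)
      qed (use R1 R2 zero inp in \<open>auto simp: envf_def env_def input_def\<close>)
      then show ?case using e2 R2 R1 wcode_less[of 0] tm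
        by (simp add: wp_pre apply_op_exact del: wp_simps(6)) ((erule wp_conseq, auto)?)
    qed (use R1 mD e1 in \<open>auto simp: envf_def env_def arr_def CODE_def\<close>)
    then show ?case using e1 by (simp add: wp_pre del: wp_simps(6)) ((erule wp_conseq, auto)?)
  qed (use env in \<open>auto simp: envf_def env_def INSERT_def\<close>)
  then show ?thesis unfolding PRE_def by (simp add: wp_pre del: wp_simps(6)) ((erule wp_conseq, auto)?)
qed

end

section \<open>Sorting a block of the text\<close>

lemma sum_nth_distinct: "distinct xs \<Longrightarrow> (\<Sum>i<length xs. g (xs ! i)) = sum g (set xs)"
  by (rule sum.reindex_bij_betw[OF bij_betw_nth]) auto

text \<open>A window contains the block at \<open>pos\<close> iff its start lies between
  \<open>pos + b - m = pos + 1 - stride\<close> and \<open>pos\<close>, where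
  \<open>stride = m + 1 - b\<close> is in register 13. The range is clipped to the valid starts.
  Since \<open>Sub\<close> wraps around, the truncated difference needs a test.\<close>

definition HIT :: com where
  "HIT = IfLess 55 13 (SETC 20 0) (SETOP Sub 20 55 13 ;; SETOP Add 20 20 3) ;;
    SETOP Add 21 55 3 ;; IfLess 12 21 (SETOP Add 21 12 2) Skip ;; VERIFY"

text \<open>Register 55 is the block position and register 56 the end of the block. Comparing the
  latter with register 14, which holds \<open>n + 1\<close>, keeps the block inside the
  text.\<close>

definition SCAN :: com where
  "SCAN = SETC 55 0 ;; SETOP Add 56 7 2 ;;
    While 56 14
      (SETOP Add 40 55 5 ;; BUCKET ;; COLLECT ;; CODE ;; SETOP Add 51 11 48 ;; LOAD 51 51 ;;
       IfLess 2 51 HIT Skip ;; SETOP Add 55 55 13 ;; SETOP Add 56 56 13)"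

context ramf
begin

text \<open>Dividing by \<open>n + 1\<close> instead of \<open>n\<close> keeps the value
  \<open>n\<close> below bucket \<open>b\<close>.\<close>

definition bk :: "nat \<Rightarrow> nat" where
  "bk y = inp y * b div (n + 1)"

text \<open>Positivity of the addresses separates nodes from the end mark 0 and is what the guard
  \<open>While 2 30\<close> tests.\<close>

fun chain :: "mstate \<Rightarrow> nat \<Rightarrow> nat list \<Rightarrow> bool" where
  "chain M x [] \<longleftrightarrow> x = 0"
| "chain M x (y # ys) \<longleftrightarrow> x = y \<and> 0 < x \<and> chain M (M (3 * D + y)) ys"

lemma chain_cong: "(\<And>y. y \<in> set ys \<Longrightarrow> M' (3 * D + y) = M (3 * D + y)) \<Longrightarrow> chain M' x ys = chain M x ys"
  by (induction ys arbitrary: x) auto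

lemma bk_less: "m \<le> y \<Longrightarrow> y < m + n \<Longrightarrow> bk y < b"
proof -
  assume "m \<le> y" "y < m + n"
  then have "inp y < n + 1" using text_range by (simp add: less_Suc_eq_le)
  then have "inp y * b < (n + 1) * b" using b_pos by (intro mult_strict_right_mono) auto
  then show ?thesis unfolding bk_def by (metis less_mult_imp_div_less mult.commute)
qed

text \<open>Since buckets are collected in increasing order, monotonicity means that a new entry
  passes only entries of its own bucket.\<close>

lemma bk_mono: "inp x \<le> inp y \<Longrightarrow> bk x \<le> bk y"
  unfolding bk_def by (intro div_le_mono mult_right_mono) auto

definition collisions :: "nat \<Rightarrow> nat \<Rightarrow> nat" where
  "collisions l x = card {y \<in> {l..<l + b}. y \<noteq> x \<and> bk y = bk x}"

lemma BUCKET: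
  assumes env: "envf R" and l: "R 40 = l" "m \<le> l" "l + b \<le> D" and inp: "input M"
    and heads: "\<And>j. j < b \<Longrightarrow> M (2 * D + j) = 0"
  shows "wp w BUCKET (\<lambda>R' M' t. (\<forall>j<b. chain M' (M' (2 * D + j)) (rev (filter (\<lambda>y. bk y = j) [l..<l + b]))) \<and>
     (\<forall>a. a < 2 * D \<or> 4 * D \<le> a \<longrightarrow> M' a = M a) \<and> t \<le> 11 * b + 4) R M"
proof -
  let ?body = "LOAD 59 57 ;; SETOP Mul 59 59 7 ;; SETOP Div 59 59 14 ;; SETOP Add 60 8 59 ;;
       LOAD 61 60 ;; SETOP Add 62 9 57 ;; STORE 62 61 ;; STORE 60 57 ;; SETOP Add 57 57 3"
  let ?R = "R(57 := l, 58 := l + b)"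
  note e = word' l envfD[OF env] envD[OF envfD(1)[OF env]]
  have bD: "b \<le> D" using l by simp
  define I where "I = (\<lambda>k (R1::rstate) (M1::mstate). R1 57 = l + k \<and>
    (\<forall>j<b. chain M1 (M1 (2 * D + j)) (rev (filter (\<lambda>y. bk y = j) [l..<l + k]))) \<and>
    (\<forall>a. a < 2 * D \<or> 4 * D \<le> a \<longrightarrow> M1 a = M a))"
  have step: "R1 57 < R1 58 \<and> wp w ?body (\<lambda>R' M' t. I (Suc k) R' M' \<and> t \<le> 9) R1 M1"
    if k: "k < b" and I: "I k R1 M1" and fr: "\<And>r. r \<notin> writes ?body \<Longrightarrow> R1 r = ?R r" for k R1 M1
  proof -
    have c: "R1 3 = 1" "R1 7 = b" "R1 14 = n + 1" "R1 8 = 2 * D" "R1 9 = 3 * D" "R1 58 = l + b" using fr e by auto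
    let ?y = "l + k"
    have r: "R1 57 = ?y" "\<And>j. j < b \<Longrightarrow> chain M1 (M1 (2 * D + j)) (rev (filter (\<lambda>y. bk y = j) [l..<l + k]))"
      "\<And>a. a < 2 * D \<or> 4 * D \<le> a \<Longrightarrow> M1 a = M a" using I by (auto simp: I_def)
    have y: "?y < D" "m \<le> ?y" "?y < m + n" using k l by (auto simp: D_def)
    have y0: "0 < ?y" using y m_pos by linarith
    have My: "M1 ?y = inp ?y" using y r(3) inp unfolding input_def by simp
    \<comment> \<open>The bucket index is computed by multiplying before dividing, so the product
      itself must fit into a word.\<close>
    have "inp ?y * b \<le> n * b" using text_range[of ?y] y by (intro mult_right_mono) auto
    also have "\<dots> \<le> (n + 1) * (n + 1)" using b_le m_le_n by (intro mult_mono) auto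
    also have "\<dots> \<le> (n + 1) ^ 10" using power_increasing[of 2 10 "n + 1"] by (simp add: power2_eq_square)
    finally have mul: "inp ?y * b < 2 ^ w" using word by linarith
    have bky: "bk ?y < b" "inp ?y * b div (n + 1) = bk ?y" using bk_less y by (auto simp: bk_def)
    let ?h = "2 * D + bk ?y"
    let ?M2 = "M1(3 * D + ?y := M1 ?h, ?h := ?y)"
    have bd: "?h < 3 * D" "?h < 2 ^ w" "3 * D + ?y < 2 ^ w" "?y + 1 < 2 ^ w" using bky bD y e by linarith+
    have ch: "chain ?M2 (?M2 (2 * D + j)) (rev (filter (\<lambda>y. bk y = j) [l..<l + Suc k]))" if j: "j < b" for j
    proof -
      let ?ls = "rev (filter (\<lambda>y. bk y = j) [l..<l + k])"
      \<comment> \<open>The nodes of the old list are addresses below \<open>?y\<close>, and heads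
        lie below the links, so neither store touches a link of that list.\<close>
      have old: "chain ?M2 x ?ls = chain M1 x ?ls" for x
        using bd y by (intro chain_cong) auto
      have up: "[l..<l + Suc k] = [l..<l + k] @ [?y]" by simp
      show ?thesis
      proof (cases "bk ?y = j")
        case True
        have "?M2 (3 * D + ?y) = M1 ?h" using bd by simp
        then show ?thesis using r(2)[OF j] old True y y0 unfolding up by simp
      next
        case False
        have "2 * D + j \<noteq> 3 * D + ?y" using j bD by simp
        then have "?M2 (2 * D + j) = M1 (2 * D + j)" using False by simp
        moreover have "filter (\<lambda>y. bk y = j) [l..<l + Suc k] = filter (\<lambda>y. bk y = j) [l..<l + k]"
          unfolding up using False by simp
        ultimately show ?thesis using r(2)[OF j] old by simp
      qed
    qed
    have "I (Suc k) (R1(59 := bk ?y, 60 := ?h, 61 := M1 ?h, 62 := 3 * D + ?y, 57 := Suc ?y)) ?M2"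
      unfolding I_def using ch r(3) y bd by auto
    then show ?thesis using c r(1) k My mul bky bd by (simp add: apply_op_exact del: fun_upd_apply add: fun_upd_same fun_upd_other)
  qed
  have loop: "wp w (While 57 58 ?body) (\<lambda>R' M' t. I b R' M' \<and> t \<le> (\<Sum>k<b. 9 + 2) + 2) ?R M"
    by (rule wp_while[of I, OF _ step]) (use heads in \<open>auto simp: I_def\<close>)
  show ?thesis
    unfolding BUCKET_def using loop e bD
    by (simp add: wp_pre apply_op_exact del: wp_simps(6)) ((erule wp_conseq, auto simp: I_def)?)
qed

lemma COLLECT:
  assumes env: "envf R" and l: "m \<le> l" "l + b \<le> D" and inp: "input M"
    and chains: "\<And>j. j < b \<Longrightarrow> chain M (M (2 * D + j)) (rev (filter (\<lambda>y. bk y = j) [l..<l + b]))"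
  shows "wp w COLLECT (\<lambda>R' M' t. arr {l..<l + b} R' M' \<and> (\<forall>j<b. M' (2 * D + j) = 0) \<and>
     (\<forall>a. a < D \<or> 4 * D \<le> a \<longrightarrow> M' a = M a) \<and> t \<le> 33 * b + 10 * (\<Sum>x=l..<l + b. collisions l x) + 5) R M"
proof -
  let ?in = "INSERT ;; SETOP Add 61 9 30 ;; LOAD 30 61"
  let ?out = "LOAD 30 60 ;; While 2 30 ?in ;; STORE 60 2 ;; SETOP Add 60 60 3"
  let ?R = "R(37 := 0, 60 := 2 * D, 63 := 2 * D + b)"
  let ?B = "{l..<l + b}"
  define ls where "ls = (\<lambda>j. rev (filter (\<lambda>y. bk y = j) [l..<l + b]))"
  let ?lt = "\<lambda>j. {y \<in> ?B. bk y < j}"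
  let ?eq = "\<lambda>j. {y \<in> ?B. bk y = j}"
  note e = word' l envfD[OF env] envD[OF envfD(1)[OF env]]
  have bD: "b \<le> D" using l by simp
  have ij: "inj_on inp ?B" by (rule inj_on_subset[OF inj_text]) (use l in \<open>auto simp: D_def\<close>)
  have lsp: "set (ls j) = ?eq j" "distinct (ls j)" for j by (auto simp: ls_def)
  have inner: "wp w (While 2 30 ?in) (\<lambda>R' M' t. arr (?lt (Suc j)) R' M' \<and>
      (\<forall>a. a < D \<or> 2 * D \<le> a \<longrightarrow> M' a = M1 a) \<and> t \<le> (\<Sum>x\<in>?eq j. 24 + 10 * collisions l x) + 2) R1 M1"
    if R1: "envf R1" "input M1" "arr (?lt j) R1 M1" "chain M1 (R1 30) (ls j)" for R1 M1 j
  proof -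
    let ?S = "\<lambda>i. ?lt j \<union> set (take i (ls j))"
    define N where "N = length (ls j)"
    note e1 = envfD[OF R1(1)] envD[OF envfD(1)[OF R1(1)]]
    define I where "I = (\<lambda>i (R2::rstate) (M2::mstate). arr (?S i) R2 M2 \<and> chain M2 (R2 30) (drop i (ls j)) \<and>
      (\<forall>a. a < D \<or> 2 * D \<le> a \<longrightarrow> M2 a = M1 a))"
    have step: "R2 2 < R2 30 \<and> wp w ?in (\<lambda>R' M' t. I (Suc i) R' M' \<and> t \<le> 22 + 10 * collisions l (ls j ! i)) R2 M2"
      if i: "i < N" and I: "I i R2 M2" and fr: "\<And>r. r \<notin> writes ?in \<Longrightarrow> R2 r = R1 r" for i R2 M2
    proof -
      have c: "R2 2 = 0" "R2 9 = 3 * D" "env R2" using fr e1 by (auto simp: INSERT_def env_def)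
      let ?x = "ls j ! i"
      have dr: "drop i (ls j) = ?x # drop (Suc i) (ls j)" using i unfolding N_def by (rule Cons_nth_drop_Suc[symmetric])
      have r: "arr (?S i) R2 M2" "R2 30 = ?x" "0 < ?x" "chain M2 (M2 (3 * D + ?x)) (drop (Suc i) (ls j))"
        "\<And>a. a < D \<or> 2 * D \<le> a \<Longrightarrow> M2 a = M1 a" using I unfolding I_def dr by auto
      have xin: "?x \<in> ?eq j" using i lsp(1)[of j] nth_mem unfolding N_def by blast
      have tk: "insert ?x (?S i) = ?S (Suc i)"
        using i unfolding N_def by (simp add: take_Suc_conv_app_nth)
      have tks: "set (take i (ls j)) \<subseteq> ?eq j" using set_take_subset[of i "ls j"] unfolding lsp(1) .
      have sub: "?S i \<subseteq> ?B" using tks by blast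
      have subj: "bk y \<le> j" if "y \<in> ?S i" for y using that tks by fastforce
      have "distinct (take i (ls j) @ [?x])"
        using distinct_take[OF lsp(2), of "Suc i" j] i unfolding N_def by (simp only: take_Suc_conv_app_nth)
      then have xn: "?x \<notin> ?S i" using xin by simp
      \<comment> \<open>Entries collected so far lie in buckets up to \<open>j\<close>, and by
        monotonicity a larger value lies in bucket \<open>j\<close> or beyond. The entries that move
        are thus collisions of \<open>?x\<close>.\<close>
      have "{y \<in> ?S i. inp ?x < inp y} \<subseteq> {y \<in> ?B. y \<noteq> ?x \<and> bk y = bk ?x}"
      proof
        fix y assume "y \<in> {y \<in> ?S i. inp ?x < inp y}"
        then have y: "y \<in> ?S i" "inp ?x < inp y" by simp_all
        moreover have "bk y = bk ?x" using subj[OF y(1)] bk_mono[of ?x y] y(2) xin by simp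
        ultimately show "y \<in> {y \<in> ?B. y \<noteq> ?x \<and> bk y = bk ?x}" using sub by blast
      qed
      then have cc: "card {y \<in> ?S i. inp ?x < inp y} \<le> collisions l ?x" unfolding collisions_def by (intro card_mono) auto
      have ins: "wp w INSERT (\<lambda>R' M' t. R' 9 = 3 * D \<and> R' 30 = ?x \<and> arr (?S (Suc i)) R' M' \<and>
         (\<forall>a. a < D \<or> 2 * D \<le> a \<longrightarrow> M' a = M2 a) \<and> t \<le> 20 + 10 * collisions l ?x) R2 M2"
      proof (rule wp_conseq[OF INSERT_arr[of R2 "?S i" M2 ?x]])
        show "insert ?x (?S i) \<subseteq> {..<D}" "inj_on inp (insert ?x (?S i))"
          using sub xin l inj_on_subset[OF ij, of "insert ?x (?S i)"] by auto
        show "input M2" using r(5) R1(2) unfolding input_def by simp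
        fix R' M' t
        assume "arr (insert ?x (?S i)) R' M' \<and> (\<forall>a. a < D \<or> 2 * D \<le> a \<longrightarrow> M' a = M2 a) \<and> t \<le> 20 + 10 * card {y \<in> ?S i. inp ?x < inp y}"
          "\<And>r. r \<notin> writes INSERT \<Longrightarrow> R' r = R2 r"
        then show "R' 9 = 3 * D \<and> R' 30 = ?x \<and> arr (?S (Suc i)) R' M' \<and>
         (\<forall>a. a < D \<or> 2 * D \<le> a \<longrightarrow> M' a = M2 a) \<and> t \<le> 20 + 10 * collisions l ?x"
          unfolding tk using cc c r(2) by (auto simp: INSERT_def)
      qed (use c r xn in auto)
      have xD: "3 * D + ?x < 2 ^ w" using xin l e by auto
      have "wp w ?in (\<lambda>R' M' t. I (Suc i) R' M' \<and> t \<le> 22 + 10 * collisions l ?x) R2 M2"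
      proof (rule wp_Seq[OF ins], goal_cases)
        case (1 R3 M3 t3)
        have "chain M3 (M3 (3 * D + ?x)) (drop (Suc i) (ls j)) = chain M2 (M2 (3 * D + ?x)) (drop (Suc i) (ls j))"
          using 1 by (subst chain_cong[of _ M3 M2]) auto
        then have "I (Suc i) (R3(61 := 3 * D + ?x, 30 := M3 (3 * D + ?x))) M3"
          using 1 r(4,5) by (auto simp: I_def arr_def)
        then show ?case using 1 xD by (simp add: apply_op_exact)
      qed
      then show ?thesis using r c by simp
    qed
    have "wp w (While 2 30 ?in) (\<lambda>R' M' t. I N R' M' \<and> t \<le> (\<Sum>i<N. (22 + 10 * collisions l (ls j ! i)) + 2) + 2) R1 M1"
    proof (rule wp_while[of I, OF _ step])
      show "I 0 R1 M1" using R1 by (auto simp: I_def)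
      show "\<not> R2 2 < R2 30" if "I N R2 M2" for R2 M2 using that by (simp add: I_def N_def)
    qed
    moreover have "(\<Sum>i<N. (22 + 10 * collisions l (ls j ! i)) + 2) = (\<Sum>x\<in>?eq j. 24 + 10 * collisions l x)"
      using sum_nth_distinct[OF lsp(2), of "\<lambda>x. (22 + 10 * collisions l x) + 2" j] unfolding lsp(1) N_def by simp
    moreover have "?S N = ?lt (Suc j)"
    proof -
      have "?S N = ?lt j \<union> ?eq j" unfolding N_def lsp(1)[symmetric] by simp
      also have "\<dots> = ?lt (Suc j)" by auto
      finally show ?thesis .
    qed
    ultimately show ?thesis by (elim wp_conseq) (simp add: I_def)
  qed
  define I where "I = (\<lambda>k (R1::rstate) (M1::mstate). R1 60 = 2 * D + k \<and> arr (?lt k) R1 M1 \<and> (\<forall>j<k. M1 (2 * D + j) = 0) \<and>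
      (\<forall>a. a < D \<or> 2 * D + k \<le> a \<longrightarrow> M1 a = M a))"
  have step: "R1 60 < R1 63 \<and> wp w ?out (\<lambda>R' M' t. I (Suc k) R' M' \<and> t \<le> (\<Sum>x\<in>?eq k. 24 + 10 * collisions l x) + 5) R1 M1"
    if k: "k < b" and I: "I k R1 M1" and fr: "\<And>r. r \<notin> writes ?out \<Longrightarrow> R1 r = ?R r" for k R1 M1
  proof -
    have c: "envf R1" "R1 63 = 2 * D + b" using fr e env by (auto simp: INSERT_def env_def envf_def)
    note e1 = envfD[OF c(1)] envD[OF envfD(1)[OF c(1)]]
    have r: "R1 60 = 2 * D + k" "arr (?lt k) R1 M1" "\<forall>j<k. M1 (2 * D + j) = 0"
      "\<And>a. a < D \<or> 2 * D + k \<le> a \<Longrightarrow> M1 a = M a" using I by (auto simp: I_def)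
    let ?R1 = "R1(30 := M (2 * D + k))"
    have ch: "chain M1 (M (2 * D + k)) (ls k)"
      using chains[OF k] r(4) k bD by (subst chain_cong[of _ M1 M]) (auto simp: ls_def)
    have "wp w (While 2 30 ?in ;; STORE 60 2 ;; SETOP Add 60 60 3)
       (\<lambda>R' M' t. I (Suc k) R' M' \<and> t \<le> (\<Sum>x\<in>?eq k. 24 + 10 * collisions l x) + 4) ?R1 M1"
    proof (rule wp_Seq[OF wp_conseq[OF inner[of ?R1 M1 k],
       where Q' = "\<lambda>R' M' t. R' 2 = 0 \<and> R' 3 = 1 \<and> R' 60 = 2 * D + k \<and> arr (?lt (Suc k)) R' M' \<and>
      (\<forall>a. a < D \<or> 2 * D \<le> a \<longrightarrow> M' a = M1 a) \<and> t \<le> (\<Sum>x\<in>?eq k. 24 + 10 * collisions l x) + 2"]], goal_cases)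
      case (6 R2 M2 t2)
      have "2 * D + k + 1 < 2 ^ w" using k bD e by linarith
      moreover have "I (Suc k) (R2(60 := 2 * D + Suc k)) (M2(2 * D + k := 0))"
        unfolding I_def using 6 r(3,4) k bD
        by (auto simp: arr_def holds_def less_Suc_eq lst_props card_mono
            dest: order.strict_trans2[OF _ card_mono[of "{l..<l+b}"]])
      ultimately show ?case using 6 by (simp add: apply_op_exact)
    qed (use c r e1 ch inp in \<open>auto simp: envf_def env_def arr_def INSERT_def input_def\<close>)
    then show ?thesis using r c k
      by (simp add: wp_pre del: wp_simps(6)) ((erule wp_conseq, simp)?)
  qed
  have loop: "wp w (While 60 63 ?out) (\<lambda>R' M' t. I b R' M' \<and> t \<le> (\<Sum>k<b. ((\<Sum>x\<in>?eq k. 24 + 10 * collisions l x) + 5) + 2) + 2) ?R M"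
    by (rule wp_while[of I, OF _ step]) (auto simp: I_def arr_def holds_def lst_def INSERT_def)
  have bkb: "bk y < b" if "y \<in> ?B" for y using bk_less[of y] that l unfolding D_def by simp
  have "(\<Sum>k<b. \<Sum>x\<in>?eq k. 24 + 10 * collisions l x) = (\<Sum>x\<in>?B. 24 + 10 * collisions l x)"
    using bkb by (intro sum.group) auto
  also have "\<dots> = 24 * b + 10 * (\<Sum>x=l..<l + b. collisions l x)" by (simp add: sum.distrib sum_distrib_left)
  finally have tm: "(\<Sum>k<b. ((\<Sum>x\<in>?eq k. 24 + 10 * collisions l x) + 5) + 2) = 31 * b + 10 * (\<Sum>x=l..<l + b. collisions l x)"
    by (simp add: sum.distrib)
  have lt: "?lt b = ?B" using bkb by auto
  show ?thesis
    unfolding COLLECT_def using loop e bD unfolding tm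
    by (simp add: wp_pre apply_op_exact del: wp_simps(6)) ((erule wp_conseq, use lt in \<open>auto simp: I_def\<close>)?)
qed

definition hit :: "nat \<Rightarrow> bool" where
  "hit l \<longleftrightarrow> wcode l \<in> wcode ` {0..m - b}"

definition stride :: nat where "stride = m + 1 - b"

definition block_cost :: "nat \<Rightarrow> nat" where
  "block_cost l = 100 * b + 10 * (\<Sum>x=l..<l + b. collisions l x) + (if hit l then 60 * m ^ 3 else 0)"

definition num_blocks :: nat where "num_blocks = (n - b) div stride + 1"

text \<open>Sorting the pattern factor at offset \<open>pos - i\<close> and shifting its addresses
  by \<open>m + i\<close> gives a list sorted by text values, since the window matches. By
  uniqueness it is the sorted list of the block, and the code ignores the shift.\<close>

lemma matches_hit:
  assumes "matches i" "i \<le> pos" "pos + b \<le> i + m" "i + m \<le> n"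
  shows "hit (m + pos)"
proof -
  define d where "d = pos - i"
  let ?xs = "lst inp {d..<d + b}"
  let ?g = "\<lambda>x. x + (m + i)"
  have d: "d + b \<le> m" "d \<le> m - b" using assms d_def by auto
  note p = lst_props[of "{d..<d + b}" inp]
  have "sorted_wrt (\<lambda>x y. inp x \<le> inp y) ?xs" using p(1) by (simp add: sorted_map)
  then have "sorted_wrt (\<lambda>x y. inp (?g x) \<le> inp (?g y)) ?xs"
  proof (rule sorted_wrt_mono_rel[rotated])
    fix x y assume "x \<in> set ?xs" "y \<in> set ?xs" "inp x \<le> inp y"
    then have "x < m" "y < m" "\<not> inp y < inp x" using d p(2) by auto
    then have "\<not> inp (m + i + y) < inp (m + i + x)" using assms(1) unfolding matches_def by blast
    then show "inp (?g x) \<le> inp (?g y)" by (simp add: ac_simps)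
  qed
  then have srt: "sorted (map inp (map ?g ?xs))" by (simp add: sorted_map sorted_wrt_map)
  have "?g ` {d..<d + b} = {m + pos..<m + pos + b}"
    using assms(2) by (simp add: d_def add.commute image_add_atLeastLessThan')
  then have "map ?g ?xs = lst inp {m + pos..<m + pos + b}"
    using srt p assms inj_on_subset[OF inj_text, of "{m + pos..<m + pos + b}"]
    by (intro lst_unique) (auto simp: distinct_map)
  then have "wcode (m + pos) = code b (m + pos) (map ?g ?xs)" unfolding wcode_def by simp
  also have mp: "m + pos = d + (m + i)" using assms(2) d_def by simp
  also have "code b (d + (m + i)) (map ?g ?xs) = wcode d"
    unfolding wcode_def using p by (intro code_shift) auto
  finally have "wcode (m + pos) = wcode d" unfolding mp .
  moreover have "d \<in> {0..m - b}" using d by simp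
  ultimately show ?thesis unfolding hit_def by (rule image_eqI)
qed

lemma HIT:
  assumes env: "envf R" and pos: "R 55 = pos" "pos + b \<le> n" and inp: "input M"
    and out: "outputs (map Suc (filter matches [0..<min (pos + 1 - stride) (n + 1 - m)])) R M"
  shows "wp w HIT (\<lambda>R' M' t. outputs (map Suc (filter matches [0..<min (pos + 1) (n + 1 - m)])) R' M' \<and>
     (\<forall>a. a < 4 * D \<or> 5 * D \<le> a \<longrightarrow> M' a = M a) \<and> t + 2 \<le> 60 * m ^ 3) R M"
proof -
  note e = word' envfD[OF env] envD[OF envfD(1)[OF env]]
  define lo where "lo = pos + 1 - stride"
  define hi where "hi = min (pos + 1) (n + 1 - m)"
  let ?ys = "map Suc (filter matches [0..<min lo (n + 1 - m)])"
  have pD: "pos + 1 < 2 ^ w" using pos e unfolding D_def by simp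
  have ys: "length ?ys \<le> lo" using length_filter_le[of matches "[0..<min lo (n + 1 - m)]"] by simp
  \<comment> \<open>Starts below \<open>lo\<close> belong to earlier blocks, so the new range
    continues the old one without gap or overlap. If \<open>lo\<close> is already beyond the last
    valid start, the new range is empty.\<close>
  have split: "[0..<min lo (n + 1 - m)] @ [lo..<hi] = [0..<hi]"
  proof (cases "lo \<le> n + 1 - m")
    case True
    moreover have "lo \<le> pos + 1" unfolding lo_def by simp
    ultimately have "lo \<le> hi" by (simp add: hi_def)
    then show ?thesis using True upt_add_eq_append[of 0 lo "hi - lo"] by simp
  next
    case False
    then have "hi = n + 1 - m" unfolding hi_def lo_def by simp
    then show ?thesis using False by simp
  qed
  \<comment> \<open>At most \<open>stride\<close> starts, each costing order \<open>m ^ 2\<close>,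
    yield the cubic cost of a hit.\<close>
  have hl: "hi - lo \<le> m" unfolding hi_def lo_def stride_def using b_pos b_le by auto
  have m3: "20 \<le> 20 * m ^ 3" using m_pos by simp
  have "(hi - lo) * (40 * m ^ 2) \<le> m * (40 * m ^ 2)" using hl by (rule mult_le_mono1)
  also have "\<dots> = 40 * m ^ 3" by (simp add: power3_eq_cube power2_eq_square)
  finally have tm: "(hi - lo) * (40 * m ^ 2) \<le> 40 * m ^ 3" .
  have ver: "wp w VERIFY (\<lambda>R' M' t. outputs (map Suc (filter matches [0..<hi])) R' M' \<and>
     (\<forall>a. a < 4 * D \<or> 5 * D \<le> a \<longrightarrow> M' a = M a) \<and> t \<le> 40 * m ^ 3 + 2) R1 M"
    if "R1 20 = lo" "R1 21 = hi" "\<And>r. r \<noteq> 20 \<Longrightarrow> r \<noteq> 21 \<Longrightarrow> R1 r = R r" for R1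
  proof (rule wp_conseq[OF VERIFY[of R1 lo hi ?ys M]])
    show "env R1" using e(4) that(3) by (simp add: env_def)
    show "outputs ?ys R1 M" using out that(3) by (simp add: outputs_def lo_def)
    show "hi + m \<le> n + 1" using m_le_n by (simp add: hi_def)
    fix R' M' t
    assume "outputs (?ys @ map Suc (filter matches [lo..<hi])) R' M' \<and>
     (\<forall>a. a < 4 * D \<or> 5 * D \<le> a \<longrightarrow> M' a = M a) \<and> t \<le> (hi - lo) * (40 * m ^ 2) + 2"
    moreover have "?ys @ map Suc (filter matches [lo..<hi]) = map Suc (filter matches [0..<hi])"
      unfolding split[symmetric] by simp
    ultimately show "outputs (map Suc (filter matches [0..<hi])) R' M' \<and>
     (\<forall>a. a < 4 * D \<or> 5 * D \<le> a \<longrightarrow> M' a = M a) \<and> t \<le> 40 * m ^ 3 + 2" using tm by simp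
  qed (use that ys inp in auto)
  have fin: "wp w VERIFY (\<lambda>R' M' t. outputs (map Suc (filter matches [0..<hi])) R' M' \<and>
     (\<forall>a. a < 4 * D \<or> 5 * D \<le> a \<longrightarrow> M' a = M a) \<and> t + 20 \<le> 60 * m ^ 3 + 2) R1 M"
    if "R1 20 = lo" "R1 21 = hi" "\<And>r. r \<noteq> 20 \<Longrightarrow> r \<noteq> 21 \<Longrightarrow> R1 r = R r" for R1
    by (rule wp_conseq[OF ver[OF that]]) (use m3 in auto)
  have p1: "pos + 1 = Suc pos" by simp
  have B: "wp w (SETOP Add 21 55 3 ;; IfLess 12 21 (SETOP Add 21 12 2) Skip ;; VERIFY)
     (\<lambda>R' M' t. outputs (map Suc (filter matches [0..<hi])) R' M' \<and>
     (\<forall>a. a < 4 * D \<or> 5 * D \<le> a \<longrightarrow> M' a = M a) \<and> t + 10 \<le> 60 * m ^ 3) R1 M"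
    if R1: "R1 20 = lo" "\<And>r. r \<noteq> 20 \<Longrightarrow> r \<noteq> 21 \<Longrightarrow> R1 r = R r" for R1
  proof (cases "n + 1 - m < pos + 1")
    case True
    then have hi: "hi = n + 1 - m" by (simp add: hi_def)
    have nm: "n + 1 - m < 2 ^ w" using pD True by simp
    have "wp w VERIFY (\<lambda>R' M' t. outputs (map Suc (filter matches [0..<hi])) R' M' \<and>
     (\<forall>a. a < 4 * D \<or> 5 * D \<le> a \<longrightarrow> M' a = M a) \<and> t + 20 \<le> 60 * m ^ 3 + 2) (R1(21 := Suc pos, 21 := n + 1 - m)) M"
      by (rule fin) (use R1 hi in auto)
    then show ?thesis using True R1(2) pos e pD nm by (simp add: apply_op_exact) ((erule wp_conseq, auto)?)
  next
    case False
    then have hi: "hi = Suc pos" by (simp add: hi_def)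
    have "wp w VERIFY (\<lambda>R' M' t. outputs (map Suc (filter matches [0..<hi])) R' M' \<and>
     (\<forall>a. a < 4 * D \<or> 5 * D \<le> a \<longrightarrow> M' a = M a) \<and> t + 20 \<le> 60 * m ^ 3 + 2) (R1(21 := Suc pos)) M"
      by (rule fin) (use R1 hi in auto)
    then show ?thesis using False R1(2) pos e pD by (simp add: apply_op_exact) ((erule wp_conseq, auto)?)
  qed
  have s13: "R 13 = stride" using e(10) by (simp add: stride_def)
  have A: "wp w (IfLess 55 13 (SETC 20 0) (SETOP Sub 20 55 13 ;; SETOP Add 20 20 3))
     (\<lambda>R' M' t. R' 20 = lo \<and> (\<forall>r. r \<noteq> 20 \<longrightarrow> R' r = R r) \<and> M' = M \<and> t \<le> 4) R M"
  proof (cases "pos < stride")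
    case True
    then show ?thesis using pos s13 by (simp add: lo_def)
  next
    case False
    then have "lo = Suc (pos - stride)" by (simp add: lo_def Suc_diff_le)
    then show ?thesis using False pos s13 pD e by (simp add: apply_op_exact)
  qed
  show ?thesis unfolding HIT_def hi_def[symmetric]
  proof (rule wp_Seq[OF A], goal_cases)
    case (1 R1 M1 t1)
    then show ?case using B[of R1] by (auto elim!: wp_conseq)
  qed
qed

end

section \<open>Scanning the text\<close>

text \<open>Without \<open>1 \<le> b\<close> the value for \<open>m = 1\<close> would be 0, because
  \<open>fact 0 = 1\<close>.\<close>

definition block_len :: "nat \<Rightarrow> nat" where
  "block_len m = (LEAST b. 1 \<le> b \<and> m ^ 4 \<le> fact b)"

lemma block_len: "1 \<le> block_len m" "m ^ 4 \<le> fact (block_len m)"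
  and block_len_least: "1 \<le> b \<Longrightarrow> b < block_len m \<Longrightarrow> fact b < m ^ 4"
proof -
  have "1 \<le> max 1 (m ^ 4) \<and> m ^ 4 \<le> fact (max 1 (m ^ 4))"
    using fact_ge_self[of "m ^ 4"] by (simp add: max_def)
  then have *: "1 \<le> block_len m \<and> m ^ 4 \<le> fact (block_len m)" unfolding block_len_def by (rule LeastI)
  then show "1 \<le> block_len m" "m ^ 4 \<le> fact (block_len m)" by simp_all
  show "fact b < m ^ 4" if "1 \<le> b" "b < block_len m"
    using not_less_Least[of b "\<lambda>b. 1 \<le> b \<and> m ^ 4 \<le> fact b"] that unfolding block_len_def by auto
qed

text \<open>Gauss pairing: \<open>(fact b)\<^sup>2\<close> is the product of all
  \<open>Suc i * (b - i)\<close>, and each of these factors is at least \<open>b\<close>. This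
  replaces Stirling's formula throughout.\<close>

lemma power_self_le_fact_sq: "b ^ b \<le> (fact b)\<^sup>2" for b :: nat
proof -
  have "b ^ b = (\<Prod>i=0..<b. b)" by simp
  also have "\<dots> \<le> (\<Prod>i=0..<b. Suc i * (b - i))"
  proof (rule prod_mono)
    fix i assume "i \<in> {0..<b}"
    then obtain d where "b = Suc (i + d)" using less_imp_Suc_add by fastforce
    then show "0 \<le> b \<and> b \<le> Suc i * (b - i)" by simp
  qed
  also have "\<dots> = (fact b)\<^sup>2"
    using fact_prod_Suc[of b, where ?'a = nat] fact_prod_rev[of b, where ?'a = nat]
    by (simp only: prod.distrib power2_eq_square of_nat_id)
  finally show ?thesis .
qed

text \<open>Minimality bounds the factorial of the predecessor by \<open>m ^ 4\<close>, and the last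
  factor is at most \<open>m\<close>.\<close>

lemma block_len_fact: "1 \<le> m \<Longrightarrow> block_len m \<le> m \<Longrightarrow> fact (block_len m) \<le> m ^ 5"
proof -
  assume m: "1 \<le> m" "block_len m \<le> m"
  show ?thesis
  proof (cases "block_len m = 1")
    case False
    then obtain k where k: "block_len m = Suc k" "1 \<le> k" using block_len(1)[of m] by (cases "block_len m") auto
    then have "fact k < m ^ 4" using block_len_least by simp
    then have "Suc k * fact k \<le> m * m ^ 4" using m k by (intro mult_mono) auto
    then show ?thesis using k by (simp add: numeral_eq_Suc)
  qed (use m in simp)
qed

lemma block_len_pow: "1 \<le> m \<Longrightarrow> block_len m \<le> m \<Longrightarrow> block_len m ^ block_len m \<le> m ^ 10"
proof -
  assume "1 \<le> m" "block_len m \<le> m"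
  then have "(fact (block_len m))\<^sup>2 \<le> (m ^ 5)\<^sup>2" by (intro power_mono block_len_fact) auto
  then show ?thesis using power_self_le_fact_sq[of "block_len m"] by (simp flip: power_mult)
qed

context ramf
begin

lemma SCAN:
  assumes env: "envf R" and inp: "input M" and heads: "\<And>j. j < b \<Longrightarrow> M (2 * D + j) = 0"
    and tab: "\<And>c. M (5 * D + c) = (if c \<in> wcode ` {0..m - b} then 1 else 0)" and cnt: "R 15 = 0"
  shows "wp w SCAN (\<lambda>R' M' t. outputs (map Suc (filter matches [0..<n + 1 - m])) R' M' \<and>
     t \<le> (\<Sum>k<num_blocks. block_cost (m + k * stride) + 2) + 4) R M"
proof -
  let ?body = "SETOP Add 40 55 5 ;; BUCKET ;; COLLECT ;; CODE ;; SETOP Add 51 11 48 ;; LOAD 51 51 ;;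
       IfLess 2 51 HIT Skip ;; SETOP Add 55 55 13 ;; SETOP Add 56 56 13"
  let ?R = "R(55 := 0, 56 := b)"
  note e = word' envfD[OF env] envD[OF envfD(1)[OF env]]
  have st: "1 \<le> stride" "stride \<le> m" "b + stride = m + 1" using b_le b_pos m_pos unfolding stride_def by auto
  have bn: "b \<le> n" using b_le m_le_n by simp
  have hlt: "\<forall>j<b. 2 * D + j < 4 * D" using bn unfolding D_def by auto
  let ?o = "\<lambda>x. map Suc (filter matches [0..<min x (n + 1 - m)])"
  define P where "P = (\<lambda>R1 :: rstate. \<lambda>M1. envf R1 \<and> input M1 \<and> (\<forall>j<b. M1 (2 * D + j) = 0) \<and>
    (\<forall>c. M1 (5 * D + c) = (if c \<in> wcode ` {0..m - b} then 1 else 0)))"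
  \<comment> \<open>Before block \<open>k\<close> all valid starts that precede its own range are
    settled. Truncated subtraction makes this the empty set for \<open>k = 0\<close>, as
    \<open>stride\<close> is positive.\<close>
  define I where "I = (\<lambda>k (R1::rstate) (M1::mstate). P R1 M1 \<and> R1 55 = k * stride \<and> R1 56 = k * stride + b \<and>
    outputs (?o (k * stride + 1 - stride)) R1 M1)"
  have ocong: "outputs (?o x) R2 M2"
    if "outputs (?o x) R1 M1" "R2 15 = R1 15" "\<And>a. 4 * D \<le> a \<Longrightarrow> M2 a = M1 a" for x R1 R2 M1 M2
    using that unfolding outputs_def by simp
  have step: "R1 56 < R1 14 \<and> wp w ?body (\<lambda>R' M' t. I (Suc k) R' M' \<and> t \<le> block_cost (m + k * stride)) R1 M1"
    if k: "k < num_blocks" and I: "I k R1 M1" and fr: "\<And>r. r \<notin> writes ?body \<Longrightarrow> R1 r = ?R r" for k R1 M1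
  proof -
    define pos where "pos = k * stride"
    define l where "l = m + pos"
    have "k \<le> (n - b) div stride" using k unfolding num_blocks_def by simp
    then have "pos \<le> (n - b) div stride * stride" unfolding pos_def by simp
    also have "\<dots> \<le> n - b" by (simp add: div_times_less_eq_dividend)
    finally have pos: "pos + b \<le> n" using bn by simp
    have I1: "P R1 M1" "R1 55 = pos" "R1 56 = pos + b" "outputs (?o (pos + 1 - stride)) R1 M1"
      using I unfolding I_def pos_def by auto
    have c: "envf R1" using I1(1) by (simp add: P_def)
    note e1 = envfD[OF c] envD[OF envfD(1)[OF c]]
    have l: "m \<le> l" "l + b \<le> D" "l < 2 ^ w" using pos e b_pos unfolding l_def D_def by auto
    have bd: "pos + b + stride < 2 ^ w" using pos st e(1) unfolding D_def by simp
    have poss: "Suc k * stride = pos + stride" by (simp add: pos_def)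
    let ?Q1 = "\<lambda>R' M'. P R' M' \<and> R' 55 = pos \<and> R' 56 = pos + b \<and> outputs (?o (pos + 1 - stride)) R' M'"
    have Qcong: "?Q1 R3 M2" if "?Q1 R2 M2" "\<And>r. r \<le> 15 \<or> r = 55 \<or> r = 56 \<Longrightarrow> R3 r = R2 r" for R2 R3 M2
      using that(1) by (simp add: P_def envf_def env_def outputs_def that(2))
    have tail: "wp w (IfLess 2 51 HIT Skip ;; SETOP Add 55 55 13 ;; SETOP Add 56 56 13)
       (\<lambda>R' M' t. I (Suc k) R' M' \<and> t \<le> 5 + (if hit l then 60 * m ^ 3 else 0)) R2 M2"
      if R2: "?Q1 R2 M2" "R2 51 = (if hit l then 1 else 0)" for R2 M2
    proof -
      have c2: "envf R2" using R2 by (simp add: P_def)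
      note e2 = envfD[OF c2] envD[OF envfD(1)[OF c2]]
      have A: "wp w (IfLess 2 51 HIT Skip) (\<lambda>R' M' t. P R' M' \<and> R' 55 = pos \<and> R' 56 = pos + b \<and> outputs (?o (pos + 1)) R' M' \<and>
        t \<le> 3 + (if hit l then 60 * m ^ 3 else 0)) R2 M2"
      proof (cases "hit l")
        case True
        have "wp w HIT (\<lambda>R' M' t. P R' M' \<and> R' 55 = pos \<and> R' 56 = pos + b \<and> outputs (?o (pos + 1)) R' M' \<and>
          t + 2 \<le> 60 * m ^ 3) R2 M2"
          by (rule wp_conseq[OF HIT[of R2 pos M2]])
            (use R2 pos c2 hlt in \<open>auto simp: P_def input_def HIT_def VERIFY_def envf_def env_def\<close>)
        then show ?thesis using True R2 e2 by simp ((erule wp_conseq, auto)?)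
      next
        case False
        \<comment> \<open>A match starting in this range contains the block at \<open>pos\<close>,
          because \<open>b + stride = m + 1\<close>; its code would then be marked.\<close>
        have none: "\<not> matches i" if "i \<in> set [pos + 1 - stride..<min (pos + 1) (n + 1 - m)]" for i
        proof
          assume "matches i"
          moreover have "i \<le> pos" "i + m \<le> n" using that by auto
          moreover have "pos + b \<le> i + m" using that st(3) by auto
          ultimately show False using matches_hit False unfolding l_def by blast
        qed
        have "?o (pos + 1) = ?o (pos + 1 - stride)"
        proof (cases "pos + 1 - stride \<le> n + 1 - m")
          case True
          define x where "x = pos + 1 - stride"
          have "x \<le> min (pos + 1) (n + 1 - m)" "min x (n + 1 - m) = x" using True by (auto simp: x_def)
          then have "[0..<min (pos + 1) (n + 1 - m)] = [0..<min x (n + 1 - m)] @ [x..<min (pos + 1) (n + 1 - m)]"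
            using upt_add_eq_append[of 0 x "min (pos + 1) (n + 1 - m) - x"] by simp
          moreover have "filter matches [x..<min (pos + 1) (n + 1 - m)] = []"
            using none unfolding x_def filter_empty_conv by blast
          ultimately show ?thesis unfolding x_def[symmetric] by simp
        qed (simp add: min_def)
        then show ?thesis using R2 e2 False by simp
      qed
      show ?thesis
      proof (rule wp_Seq[OF A], goal_cases)
        case (1 R3 M3 t3)
        then have R3: "envf R3" "R3 55 = pos" "R3 56 = pos + b" by (auto simp: P_def)
        note e3 = envfD[OF R3(1)] envD[OF envfD(1)[OF R3(1)]]
        have "I (Suc k) (R3(55 := pos + stride, 56 := pos + b + stride)) M3"
          unfolding I_def poss using 1 by (auto simp: P_def envf_def env_def outputs_def)
        moreover have "R3 13 = stride" using e3 by (simp add: stride_def)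
        ultimately show ?case using 1 R3 bd by (simp add: apply_op_exact)
      qed
    qed
    have cod: "wp w (CODE ;; SETOP Add 51 11 48 ;; LOAD 51 51 ;; IfLess 2 51 HIT Skip ;; SETOP Add 55 55 13 ;; SETOP Add 56 56 13)
       (\<lambda>R' M' t. I (Suc k) R' M' \<and> t \<le> 7 * b + 12 + (if hit l then 60 * m ^ 3 else 0)) R2 M2"
      if R2: "?Q1 R2 M2" "R2 40 = l" "arr {l..<l + b} R2 M2" for R2 M2
    proof -
      have c2: "envf R2" using R2 by (simp add: P_def)
      note e2 = envfD[OF c2] envD[OF envfD(1)[OF c2]]
      have A: "wp w CODE (\<lambda>R' M' t. ?Q1 R' M' \<and> R' 48 = wcode l \<and> M' = M2 \<and> t \<le> 7 * b + 5) R2 M2"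
      proof (rule wp_conseq[OF CODE_arr[of R2 l M2]])
        fix R' M' t
        assume a: "R' 48 = wcode l \<and> M' = M2 \<and> t \<le> 7 * b + 5" and f: "\<And>r. r \<notin> writes CODE \<Longrightarrow> R' r = R2 r"
        have "?Q1 R' M2" by (rule Qcong[OF R2(1)]) (rule f, auto simp: CODE_def)
        then show "?Q1 R' M' \<and> R' 48 = wcode l \<and> M' = M2 \<and> t \<le> 7 * b + 5" using a by simp
      qed (rule e2(1) R2(3) e2(2) R2(2) l(2))+
      show ?thesis
      proof (rule wp_Seq[OF A], goal_cases)
        case (1 R3 M3 t3)
        let ?R3 = "R3(51 := 5 * D + wcode l, 51 := if hit l then 1 else 0)"
        have "envf R3" using 1 by (simp add: P_def)
        note e3 = envfD[OF this] envD[OF envfD(1)[OF this]]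
        have rd: "M3 (5 * D + wcode l) = (if hit l then 1 else 0)" using 1 unfolding P_def hit_def by blast
        have tl: "wp w (IfLess 2 51 HIT Skip ;; SETOP Add 55 55 13 ;; SETOP Add 56 56 13)
           (\<lambda>R' M' t. I (Suc k) R' M' \<and> t \<le> 5 + (if hit l then 60 * m ^ 3 else 0)) ?R3 M3"
        proof (rule tail)
          have "?Q1 R3 M3" using 1 by blast
          then show "?Q1 ?R3 M3" by (rule Qcong) auto
        qed simp
        have ad: "apply_op w Add (R3 11) (R3 48) = 5 * D + wcode l"
          using 1 e3 wcode_less[of l] by (simp add: apply_op_exact)
        have "wp w (SETOP Add 51 11 48 ;; LOAD 51 51 ;; IfLess 2 51 HIT Skip ;; SETOP Add 55 55 13 ;; SETOP Add 56 56 13)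
           (\<lambda>R' M' t. I (Suc k) R' M' \<and> t \<le> 7 + (if hit l then 60 * m ^ 3 else 0)) R3 M3"
          unfolding wp_pre ad fun_upd_same rd by (rule wp_conseq[OF tl]) simp
        then show ?case using 1 by (elim wp_conseq) simp
      qed
    qed
    let ?R1 = "R1(40 := l)"
    have Q1: "?Q1 ?R1 M1" by (rule Qcong[of R1]) (use I1 in auto)
    have bu: "wp w BUCKET (\<lambda>R' M' t. envf R' \<and> R' 40 = l \<and> R' 55 = pos \<and> R' 56 = pos + b \<and> R' 15 = R1 15 \<and>
       (\<forall>j<b. chain M' (M' (2 * D + j)) (rev (filter (\<lambda>y. bk y = j) [l..<l + b]))) \<and>
       (\<forall>a. a < 2 * D \<or> 4 * D \<le> a \<longrightarrow> M' a = M1 a) \<and> t \<le> 11 * b + 4) ?R1 M1"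
      by (rule wp_conseq[OF BUCKET[of ?R1 l M1]])
        (use Q1 l in \<open>auto simp: P_def BUCKET_def envf_def env_def\<close>)
    have main: "wp w (BUCKET ;; COLLECT ;; CODE ;; SETOP Add 51 11 48 ;; LOAD 51 51 ;; IfLess 2 51 HIT Skip ;; SETOP Add 55 55 13 ;; SETOP Add 56 56 13)
       (\<lambda>R' M' t. I (Suc k) R' M' \<and> t + 1 \<le> block_cost l) ?R1 M1"
    proof (rule wp_Seq[OF bu], goal_cases)
      case (1 R2 M2 t2)
      then have R2: "envf R2" "R2 40 = l" "R2 55 = pos" "R2 56 = pos + b" "R2 15 = R1 15"
        "\<forall>j<b. chain M2 (M2 (2 * D + j)) (rev (filter (\<lambda>y. bk y = j) [l..<l + b]))"
        "\<forall>a. a < 2 * D \<or> 4 * D \<le> a \<longrightarrow> M2 a = M1 a" "t2 \<le> 11 * b + 4" by auto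
      have inp2: "input M2" using R2(7) Q1 unfolding P_def input_def by simp
      have co: "wp w COLLECT (\<lambda>R' M' t. ?Q1 R' M' \<and> R' 40 = l \<and> arr {l..<l + b} R' M' \<and>
         t \<le> 33 * b + 10 * (\<Sum>x=l..<l + b. collisions l x) + 5) R2 M2"
      proof (rule wp_conseq[OF COLLECT[of R2 l M2]])
        fix R' M' t
        assume a: "arr {l..<l + b} R' M' \<and> (\<forall>j<b. M' (2 * D + j) = 0) \<and>
     (\<forall>a. a < D \<or> 4 * D \<le> a \<longrightarrow> M' a = M2 a) \<and> t \<le> 33 * b + 10 * (\<Sum>x=l..<l + b. collisions l x) + 5"
          and f: "\<And>r. r \<notin> writes COLLECT \<Longrightarrow> R' r = R2 r"
        have "outputs (?o (pos + 1 - stride)) R' M'"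
          by (rule ocong[OF I1(4)]) (use a f R2 in \<open>auto simp: COLLECT_def INSERT_def\<close>)
        moreover have "envf R'" "R' 40 = l" "R' 55 = pos" "R' 56 = pos + b"
          using f R2 by (auto simp: COLLECT_def INSERT_def envf_def env_def)
        moreover have "input M'" using a inp2 unfolding input_def by simp
        moreover have "M' (5 * D + c) = M1 (5 * D + c)" for c using a R2(7) by simp
        ultimately show "?Q1 R' M' \<and> R' 40 = l \<and> arr {l..<l + b} R' M' \<and>
         t \<le> 33 * b + 10 * (\<Sum>x=l..<l + b. collisions l x) + 5"
          using a Q1 by (simp add: P_def)
      qed (use R2 l inp2 in auto)
      show ?case
      proof (rule wp_Seq[OF co], goal_cases)
        case (1 R3 M3 t3)
        then have "wp w (CODE ;; SETOP Add 51 11 48 ;; LOAD 51 51 ;; IfLess 2 51 HIT Skip ;; SETOP Add 55 55 13 ;; SETOP Add 56 56 13)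
       (\<lambda>R' M' t. I (Suc k) R' M' \<and> t \<le> 7 * b + 12 + (if hit l then 60 * m ^ 3 else 0)) R3 M3"
          by (intro cod) auto
        moreover have "t3 \<le> 33 * b + 10 * (\<Sum>x=l..<l + b. collisions l x) + 5" using 1 by blast
        then have "t2 + (t3 + (7 * b + 12 + (if hit l then 60 * m ^ 3 else 0))) + 1 \<le> block_cost l"
          using R2(8) b_pos unfolding block_cost_def by linarith
        ultimately show ?case by (elim wp_conseq) linarith
      qed
    qed
    have ad: "apply_op w Add (R1 55) (R1 5) = l"
      using l(3) I1(2) e1(12) by (simp add: apply_op_exact l_def add.commute)
    have "wp w ?body (\<lambda>R' M' t. I (Suc k) R' M' \<and> t \<le> block_cost l) R1 M1"
      unfolding wp_pre ad by (rule wp_conseq[OF main]) simp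
    moreover have "R1 56 < R1 14" using I1(3) e1(8) pos by simp
    ultimately show ?thesis unfolding l_def pos_def by simp
  qed
  have fin: "n < num_blocks * stride + b"
  proof -
    have "n - b < ((n - b) div stride + 1) * stride" using st dividend_less_times_div[of stride "n - b"] by (simp add: mult.commute)
    then show ?thesis using bn unfolding num_blocks_def by simp
  qed
  have loop: "wp w (While 56 14 ?body) (\<lambda>R' M' t. I num_blocks R' M' \<and> t \<le> (\<Sum>k<num_blocks. block_cost (m + k * stride) + 2) + 2) ?R M"
  proof (rule wp_while[of I, OF _ step])
    have "envf ?R" using env by (simp add: envf_def env_def)
    then have "P ?R M" unfolding P_def using inp heads tab by blast
    moreover have "outputs (?o (0 * stride + 1 - stride)) ?R M" using cnt st by (simp add: outputs_def)
    ultimately show "I 0 ?R M" unfolding I_def by simp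
    show "\<not> R1 56 < R1 14" if "I num_blocks R1 M1" for R1 M1
      using that fin envfD(8)[of R1] by (auto simp: I_def P_def)
  qed
  \<comment> \<open>The first block not treated would end beyond the text. Together with
    \<open>b + stride = m + 1\<close> this shows that the settled starts include all
    \<open>n + 1 - m\<close> valid ones.\<close>
  have "min (num_blocks * stride + 1 - stride) (n + 1 - m) = n + 1 - m" using fin st by simp
  then have W: "wp w (While 56 14 ?body) (\<lambda>R' M' t. outputs (map Suc (filter matches [0..<n + 1 - m])) R' M' \<and>
     t + 2 \<le> (\<Sum>k<num_blocks. block_cost (m + k * stride) + 2) + 4) ?R M"
    by (intro wp_conseq[OF loop]) (auto simp: I_def)
  have "b < 2 ^ w" using bn e(1) unfolding D_def by simp
  then have R: "R(55 := 0 mod 2 ^ w, 56 := apply_op w Add ((R(55 := 0 mod 2 ^ w)) 7) ((R(55 := 0 mod 2 ^ w)) 2)) = ?R"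
    using e(5,12) by (simp add: apply_op_exact)
  show ?thesis unfolding SCAN_def wp_pre R by (rule wp_conseq[OF W]) simp
qed

end

section \<open>The complete program\<close>

text \<open>Two squarings produce \<open>m ^ 4\<close> in register 16. The loop keeps the factorial
  of register 7 in register 17 until it reaches that value, which finds the block length in time
  proportional to it.\<close>

definition INIT :: com where
  "INIT = SETC 2 0 ;; SETC 3 1 ;; SETOP Add 5 0 2 ;; SETOP Add 6 1 2 ;; SETOP Add 4 5 6 ;;
    SETOP Add 8 4 4 ;; SETOP Add 9 8 4 ;; SETOP Add 10 9 4 ;; SETOP Add 11 10 4 ;;
    SETOP Add 14 6 3 ;; SETOP Sub 12 14 5 ;;
    SETOP Mul 16 5 5 ;; SETOP Mul 16 16 16 ;; SETC 7 1 ;; SETC 17 1 ;;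
    While 17 16 (SETOP Add 7 7 3 ;; SETOP Mul 17 17 7) ;;
    SETOP Add 18 7 7"

definition MAIN :: com where
  "MAIN = INIT ;;
    IfLess 5 18
      (SETC 20 0 ;; SETOP Add 21 12 2 ;; VERIFY)
      (SETOP Add 13 5 3 ;; SETOP Sub 13 13 7 ;; PRE ;; SCAN) ;;
    SETOP Add 0 10 2 ;; SETOP Add 1 15 2"

lemma block_len_le: "1 \<le> m \<Longrightarrow> block_len m \<le> m ^ 4"
proof (cases "block_len m = 1")
  case False
  then have "fact (block_len m - 1) < m ^ 4" using block_len(1)[of m] by (intro block_len_least) auto
  then show ?thesis using fact_ge_self[of "block_len m - 1"] by linarith
qed simp

context ram
begin

text \<open>In the factorial loop of \<open>INIT\<close> both factors are at most
  \<open>m ^ 4\<close>, so the product is at most \<open>m ^ 8\<close>.\<close>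

lemma small_powers: "2 * m ^ 4 < 2 ^ w" "m ^ 4 * m ^ 4 < 2 ^ w" "m * m < 2 ^ w" "m * m * (m * m) < 2 ^ w"
proof -
  have a: "m ^ 8 < (n + 1) ^ 10"
  proof -
    have "m ^ 8 \<le> (n + 1) ^ 8" using m_le_n by (intro power_mono) auto
    also have "\<dots> < (n + 1) ^ 10" using m_pos m_le_n by (intro power_strict_increasing) auto
    finally show ?thesis .
  qed
  have "2 * m ^ 4 \<le> (n + 1) * (n + 1) ^ 4" using m_pos m_le_n by (intro mult_mono power_mono) auto
  also have "\<dots> \<le> (n + 1) ^ 10" using power_increasing[of 5 10 "n + 1"] by (simp add: numeral_eq_Suc)
  finally show "2 * m ^ 4 < 2 ^ w" using word by linarith
  show "m ^ 4 * m ^ 4 < 2 ^ w" using a word by (simp flip: power_add)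
  then have "m ^ 8 < 2 ^ w" by (simp flip: power_add)
  moreover have "m * m = m ^ 2" "m * m * (m * m) = m ^ 4" by (simp_all add: numeral_eq_Suc)
  moreover have "m ^ 2 \<le> m ^ 8" "m ^ 4 \<le> m ^ 8" using m_pos by (auto intro: power_increasing)
  ultimately show "m * m < 2 ^ w" "m * m * (m * m) < 2 ^ w" by linarith+
qed

definition ready :: "rstate \<Rightarrow> bool" where
  "ready R \<longleftrightarrow> env R \<and> R 7 = block_len m \<and> R 8 = 2 * D \<and> R 9 = 3 * D \<and> R 11 = 5 * D \<and>
     R 12 = n + 1 - m \<and> R 14 = n + 1 \<and> R 15 = 0 \<and> R 18 = 2 * block_len m"

lemma INIT:
  "wp w INIT (\<lambda>R' M' t. ready R' \<and> M' = M \<and> t \<le> 20 + 4 * block_len m) ((\<lambda>_. 0)(0 := m, 1 := n)) M"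
proof -
  let ?body = "SETOP Add 7 7 3 ;; SETOP Mul 17 17 7"
  let ?b = "block_len m"
  let ?R0 = "(\<lambda>_. 0)(0 := m, 1 := n, 2 := 0, 3 := 1, 5 := m, 6 := n, 4 := D, 8 := 2 * D, 9 := 3 * D, 10 := 4 * D,
    11 := 5 * D, 14 := n + 1, 12 := n + 1 - m, 16 := m * m, 16 := m ^ 4, 7 := 1, 17 := 1)"
  note p = small_powers word'
  have b1: "?b - 1 + 1 = ?b" using block_len(1)[of m] by simp
  define I where "I = (\<lambda>k (R1::rstate) (M1::mstate). R1 7 = k + 1 \<and> R1 17 = fact (k + 1) \<and> M1 = M)"
  have step: "R1 17 < R1 16 \<and> wp w ?body (\<lambda>R' M' t. I (Suc k) R' M' \<and> t \<le> 2) R1 M1"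
    if k: "k < ?b - 1" and I: "I k R1 M1" and fr: "\<And>r. r \<notin> writes ?body \<Longrightarrow> R1 r = ?R0 r" for k R1 M1
  proof -
    have c: "R1 3 = 1" "R1 16 = m ^ 4" using fr by auto
    have r: "R1 7 = k + 1" "R1 17 = fact (k + 1)" "M1 = M" using I by (auto simp: I_def)
    have f: "fact (k + 1) < m ^ 4" using k by (intro block_len_least) auto
    then have k2: "k + 2 \<le> m ^ 4" using fact_ge_self[of "k + 1"] by linarith
    have kw: "k + 1 + 1 < 2 ^ w" using k2 p(1) m_pos by linarith
    have "fact (k + 1) * (k + 2) \<le> m ^ 4 * m ^ 4" using f k2 by (intro mult_mono) auto
    then have fw: "fact (k + 1) * (k + 2) < 2 ^ w" using p(2) by linarith
    have a1: "apply_op w Add (k + 1) 1 = k + 2" using kw by (simp add: apply_op_exact)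
    have a2: "apply_op w Mul (fact (k + 1)) (k + 2) = fact (k + 2)"
      using apply_op_exact(3)[OF fw] by (simp add: algebra_simps)
    show ?thesis using r c f a1 a2 by (simp add: I_def)
  qed
  have loop: "wp w (While 17 16 ?body) (\<lambda>R' M' t. I (?b - 1) R' M' \<and> t \<le> (\<Sum>k<?b - 1. 2 + 2) + 2) ?R0 M"
  proof (rule wp_while[of I, OF _ step])
    show "\<not> R1 17 < R1 16" if "I (?b - 1) R1 M1" "\<And>r. r \<notin> writes ?body \<Longrightarrow> R1 r = ?R0 r" for R1 M1
    proof -
      have "R1 17 = fact ?b" using that(1) unfolding I_def b1 by simp
      moreover have "R1 16 = m ^ 4" using that(2)[of 16] by simp
      ultimately show ?thesis using block_len(2)[of m] by simp
    qed
  qed (simp add: I_def)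
  have tail: "wp w (While 17 16 ?body ;; SETOP Add 18 7 7) (\<lambda>R' M' t. ready R' \<and> M' = M \<and> t \<le> 4 + 4 * ?b) ?R0 M"
  proof (rule wp_Seq[OF wp_conseq[OF loop, where Q' = "\<lambda>R' M' t. (\<forall>r. r \<noteq> 7 \<longrightarrow> r \<noteq> 17 \<longrightarrow> R' r = ?R0 r) \<and> R' 7 = ?b \<and> M' = M \<and> t \<le> 2 + 4 * ?b"]], goal_cases)
    case (1 R' M' t)
    then have "R' 7 = ?b" "M' = M" unfolding I_def b1 by auto
    moreover have "\<forall>r. r \<noteq> 7 \<longrightarrow> r \<noteq> 17 \<longrightarrow> R' r = ?R0 r" using 1(2) by simp
    moreover have "t \<le> (?b - 1) * 4 + 2" using 1(1) by simp
    then have "t \<le> 2 + 4 * ?b" by (simp add: diff_mult_distrib)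
    ultimately show ?case by blast
  next
    case (2 R1 M1 t1)
    have "?b + ?b < 2 ^ w" using block_len_le[OF m_pos] p(1) by linarith
    moreover have "ready (R1(18 := 2 * ?b))" using 2 by (simp add: ready_def env_def)
    ultimately show ?case using 2 by (simp add: apply_op_exact mult_2)
  qed
  have m4: "m * m * (m * m) = m ^ 4" by (simp add: numeral_eq_Suc)
  have dd: "m + n = D" by (simp add: D_def)
  have bd: "m < 2 ^ w" "n < 2 ^ w" "n + 1 < 2 ^ w" "m \<le> n + 1" "D < 2 ^ w" "D + D < 2 ^ w" "2 * D + D < 2 ^ w" "3 * D + D < 2 ^ w" "4 * D + D < 2 ^ w"
    using p m_le_n unfolding D_def by simp_all
  have dm: "D + D = 2 * D" "2 * D + D = 3 * D" "3 * D + D = 4 * D" "4 * D + D = 5 * D" by simp_all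
  have op: "apply_op w Add m 0 = m" "apply_op w Add n 0 = n" "apply_op w Add m n = D" "apply_op w Add D D = 2 * D"
    "apply_op w Add (2 * D) D = 3 * D" "apply_op w Add (3 * D) D = 4 * D" "apply_op w Add (4 * D) D = 5 * D"
    "apply_op w Add n 1 = n + 1" "apply_op w Sub (n + 1) m = n + 1 - m" "apply_op w Mul m m = m * m"
    "apply_op w Mul (m * m) (m * m) = m ^ 4" "0 mod 2 ^ w = (0::nat)" "1 mod 2 ^ w = (1::nat)"
    using bd p m4 dd dm by (simp_all add: apply_op_exact)
  show ?thesis
    unfolding INIT_def using tail
    by (simp add: wp_pre op[simplified] del: wp_simps(6)) ((erule wp_conseq, simp)?)
qed

lemma finish:
  assumes body: "wp w c (\<lambda>R' M' t. outputs ys R' M' \<and> t \<le> T) R M" and "env R" "writes c \<inter> {2, 10} = {}" "length ys < 2 ^ w"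
  shows "wp w (c ;; SETOP Add 0 10 2 ;; SETOP Add 1 15 2)
    (\<lambda>R' M' t. R' 0 = 4 * D \<and> R' 1 = length ys \<and> (\<forall>j<length ys. M' (4 * D + j) = ys ! j) \<and> t \<le> T + 2) R M"
proof (rule wp_Seq[OF wp_conseq[OF body, where Q' = "\<lambda>R' M' t. outputs ys R' M' \<and> R' 2 = 0 \<and> R' 10 = 4 * D \<and> t \<le> T"]], goal_cases)
  case (1 R' M' t)
  have "2 \<notin> writes c" "10 \<notin> writes c" using assms(3) by auto
  then show ?case using 1(1) 1(2)[of 2] 1(2)[of 10] envD(1,6)[OF assms(2)] by simp
next
  case (2 R1 M1 t1)
  have "4 * D < 2 ^ w" using word' by simp
  then show ?case using 2 assms(4) by (simp add: apply_op_exact outputs_def)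
qed

lemma length_outputs: "length (map Suc (filter matches [0..<n + 1 - m])) < 2 ^ w"
proof -
  have "length (map Suc (filter matches [0..<n + 1 - m])) \<le> n"
    using length_filter_le[of matches "[0..<n + 1 - m]"] m_pos by simp
  also have "n < 2 ^ w" using word by simp
  finally show ?thesis .
qed

abbreviation occurrences :: "nat list" where
  "occurrences \<equiv> map Suc (filter matches [0..<n + 1 - m])"

lemma MAIN_small:
  assumes small: "m < 2 * block_len m" and inp: "input M"
  shows "wp w MAIN (\<lambda>R' M' t. R' 0 = 4 * D \<and> R' 1 = length occurrences \<and>
     (\<forall>j<length occurrences. M' (4 * D + j) = occurrences ! j) \<and>
     t \<le> 30 + 4 * block_len m + (n + 1 - m) * (40 * m ^ 2)) ((\<lambda>_. 0)(0 := m, 1 := n)) M"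
  unfolding MAIN_def
proof (rule wp_Seq[OF INIT], goal_cases)
  case (1 R1 M1 t1)
  then have r: "env R1" "R1 5 < R1 18" "R1 2 = 0" "R1 12 = n + 1 - m" "R1 15 = 0" "M1 = M"
    using small envD(1,4)[of R1] by (auto simp: ready_def)
  let ?R = "R1(20 := 0, 21 := n + 1 - m)"
  have "wp w VERIFY (\<lambda>R' M' t. outputs ([] @ map Suc (filter matches [0..<n + 1 - m])) R' M' \<and>
     (\<forall>a. a < 4 * D \<or> 5 * D \<le> a \<longrightarrow> M' a = M a) \<and> t \<le> (n + 1 - m - 0) * (40 * m ^ 2) + 2) ?R M"
    by (rule VERIFY) (use r inp m_le_n in \<open>auto simp: env_def outputs_def\<close>)
  then have "wp w VERIFY (\<lambda>R' M' t. outputs occurrences R' M' \<and> t \<le> (n + 1 - m) * (40 * m ^ 2) + 2) ?R M"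
    by (rule wp_conseq) simp
  moreover have "apply_op w Add (n + 1 - m) 0 = n + 1 - m"
    using word' unfolding D_def by (simp add: apply_op_exact)
  ultimately have "wp w (SETC 20 0 ;; SETOP Add 21 12 2 ;; VERIFY)
      (\<lambda>R' M' t. outputs occurrences R' M' \<and> t \<le> (n + 1 - m) * (40 * m ^ 2) + 4) R1 M"
    unfolding wp_pre using r by (simp del: wp_simps(6))
  then have "wp w (IfLess 5 18 (SETC 20 0 ;; SETOP Add 21 12 2 ;; VERIFY)
      (SETOP Add 13 5 3 ;; SETOP Sub 13 13 7 ;; PRE ;; SCAN))
      (\<lambda>R' M' t. outputs occurrences R' M' \<and> t \<le> (n + 1 - m) * (40 * m ^ 2) + 5) R1 M"
    unfolding wp_simps(7) using r(2) by (auto elim!: wp_conseq)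
  from finish[OF this r(1) _ length_outputs] show ?case
    using 1 by (auto elim!: wp_conseq simp: VERIFY_def PRE_def SCAN_def INSERT_def REMOVE_def CODE_def BUCKET_def
        COLLECT_def HIT_def)
qed

end

text \<open>The zero memory above the input serves at once as the empty code table and as the empty
  bucket heads.\<close>

lemma (in ramf) MAIN_large:
  assumes b: "b = block_len m" and inp: "input M" and zero: "\<And>a. D \<le> a \<Longrightarrow> M a = 0"
  shows "wp w MAIN (\<lambda>R' M' t. R' 0 = 4 * D \<and> R' 1 = length occurrences \<and>
     (\<forall>j<length occurrences. M' (4 * D + j) = occurrences ! j) \<and>
     t \<le> 40 + 4 * b + 200 * (m * b) + (\<Sum>k<num_blocks. block_cost (m + k * stride) + 2)) ((\<lambda>_. 0)(0 := m, 1 := n)) M"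
  unfolding MAIN_def
proof (rule wp_Seq[OF INIT], goal_cases)
  case (1 R1 M1 t1)
  then have r: "env R1" "R1 7 = b" "R1 8 = 2 * D" "R1 9 = 3 * D" "R1 11 = 5 * D" "R1 12 = n + 1 - m" "R1 14 = n + 1"
     "R1 15 = 0" "R1 18 = 2 * b" "M1 = M" "t1 \<le> 20 + 4 * b"
    unfolding b by (auto simp: ready_def)
  note e = envD[OF r(1)]
  let ?R = "R1(13 := m + 1, 13 := m + 1 - b)"
  let ?S = "\<Sum>k<num_blocks. block_cost (m + k * stride) + 2"
  have env: "envf ?R" using r by (simp add: envf_def env_def)
  have z: "M (5 * D + c) = 0" for c by (rule zero) simp
  have heads: "M (2 * D + j) = 0" for j by (rule zero) simp
  have pre: "wp w PRE (\<lambda>R' M' t. envf R' \<and> R' 15 = 0 \<and> input M' \<and> (\<forall>j<b. M' (2 * D + j) = 0) \<and>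
     (\<forall>c. M' (5 * D + c) = (if c \<in> wcode ` {0..m - b} then 1 else 0)) \<and> t \<le> 200 * (m * b)) ?R M"
  proof (rule wp_conseq[OF PRE[OF env inp z]])
    fix R' M' t
    assume a: "(\<forall>a. a < D \<or> 2 * D \<le> a \<and> a < 5 * D \<longrightarrow> M' a = M a) \<and>
     (\<forall>c. M' (5 * D + c) = (if c \<in> wcode ` {0..m - b} then 1 else 0)) \<and> t \<le> 200 * (m * b)"
      and f: "\<And>r. r \<notin> writes PRE \<Longrightarrow> R' r = ?R r"
    have g: "R' r = ?R r" if "r \<le> 15" for r
      by (rule f) (use that in \<open>auto simp: PRE_def INSERT_def REMOVE_def CODE_def\<close>)
    have "envf R'" using env by (simp add: envf_def env_def g)
    moreover have "R' 15 = 0" using g[of 15] r by simp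
    moreover have "input M'" using a inp unfolding input_def by simp
    moreover have "M' (2 * D + j) = 0" if "j < b" for j
    proof -
      have "b \<le> D" using b_le unfolding D_def by simp
      then have "2 * D + j < 5 * D" using that by simp
      then show ?thesis using a heads by simp
    qed
    ultimately show "envf R' \<and> R' 15 = 0 \<and> input M' \<and> (\<forall>j<b. M' (2 * D + j) = 0) \<and>
     (\<forall>c. M' (5 * D + c) = (if c \<in> wcode ` {0..m - b} then 1 else 0)) \<and> t \<le> 200 * (m * b)"
      using a by blast
  qed
  have A: "wp w (PRE ;; SCAN) (\<lambda>R' M' t. outputs occurrences R' M' \<and> t \<le> 200 * (m * b) + ?S + 4) ?R M"
  proof (rule wp_Seq[OF pre], goal_cases)
    case (1 R2 M2 t2)
    then have h: "envf R2" "R2 15 = 0" "input M2" "\<And>j. j < b \<Longrightarrow> M2 (2 * D + j) = 0"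
     "\<And>c. M2 (5 * D + c) = (if c \<in> wcode ` {0..m - b} then 1 else 0)" "t2 \<le> 200 * (m * b)" by auto
    show ?case by (rule wp_conseq[OF SCAN[OF h(1,3,4,5,2)]]) (use h(6) in linarith)+
  qed
  have "m + 1 < 2 ^ w" using word'(1) unfolding D_def by simp
  then have op: "apply_op w Add (R1 5) (R1 3) = m + 1" "apply_op w Sub (m + 1) (R1 7) = m + 1 - b"
    using e r b_le by (simp_all add: apply_op_exact)
  have B: "wp w (SETOP Add 13 5 3 ;; SETOP Sub 13 13 7 ;; PRE ;; SCAN)
    (\<lambda>R' M' t. outputs occurrences R' M' \<and> t \<le> 200 * (m * b) + ?S + 6) R1 M"
  proof -
    have "(R1(13 := m + 1)) 7 = R1 7" "(R1(13 := m + 1)) 13 = m + 1" by simp_all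
    then show ?thesis unfolding wp_pre op using op(2)
      by (simp only:) (rule wp_conseq[OF A], linarith)
  qed
  have nlt: "\<not> R1 5 < R1 18" using e r b_le by simp
  have "wp w (IfLess 5 18 (SETC 20 0 ;; SETOP Add 21 12 2 ;; VERIFY)
      (SETOP Add 13 5 3 ;; SETOP Sub 13 13 7 ;; PRE ;; SCAN))
      (\<lambda>R' M' t. outputs occurrences R' M' \<and> t \<le> 200 * (m * b) + ?S + 8) R1 M"
    unfolding wp_simps(7) if_not_P[OF nlt] by (rule wp_conseq[OF B]) linarith
  note F = finish[OF this r(1) _ length_outputs]
  show ?case unfolding r(10)
  proof (rule wp_conseq[OF F], goal_cases)
    case (2 R' M' t)
    then show ?case using r(11) by auto
  qed (auto simp: VERIFY_def PRE_def SCAN_def INSERT_def REMOVE_def CODE_def BUCKET_def COLLECT_def HIT_def)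
qed

section \<open>Counting permutations\<close>

lemma permutations_of_set_props:
  assumes "t \<in> permutations_of_set A" "card A = n"
  shows "length t = n" "distinct t" "set t = A"
  using assms distinct_card[of t] by (auto simp: permutations_of_set_def)

lemma permute_list_in_permutations:
  assumes "f permutes {..<n}" "card A = n" "t \<in> permutations_of_set A"
  shows "permute_list f t \<in> permutations_of_set A"
proof -
  note t = permutations_of_set_props[OF assms(3,2)]
  then show ?thesis using assms(1) by (auto simp: permutations_of_set_def set_permute_list distinct_permute_list)
qed

lemma bij_permute_list:
  assumes "finite A" "f permutes {..<n}" "card A = n"
  shows "bij_betw (permute_list f) (permutations_of_set A) (permutations_of_set A)"
proof (rule bij_betwI')
  fix t u assume t: "t \<in> permutations_of_set A" "u \<in> permutations_of_set A"
  have l: "length t = n" "length u = n" using t permutations_of_set_props assms(3) by blast+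
  have "permute_list (inv f) (permute_list f v) = v" if "length v = n" for v :: "'a list"
    using permute_list_compose[of "inv f" v f] that permutes_inv[OF assms(2)] assms(2)
    by (simp add: permutes_inv_o)
  then show "permute_list f t = permute_list f u \<longleftrightarrow> t = u" using l by metis
next
  fix u assume u: "u \<in> permutations_of_set A"
  then have "length u = n" using permutations_of_set_props assms(3) by blast
  then have "permute_list f (permute_list (inv f) u) = u"
    using permute_list_compose[of f u "inv f"] permutes_inv[OF assms(2)] assms(2) by (simp add: permutes_inv_o)
  then show "\<exists>t\<in>permutations_of_set A. u = permute_list f t"
    using permute_list_in_permutations[OF permutes_inv[OF assms(2)] assms(3) u] by metis
qed (use permute_list_in_permutations[OF assms(2,3)] in blast)

lemma bij_betw_subset_filter:
  assumes "bij_betw f S S'" "\<And>x. x \<in> S \<Longrightarrow> P x \<longleftrightarrow> Q (f x)"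
  shows "bij_betw f {x \<in> S. P x} {y \<in> S'. Q y}"
  using assms unfolding bij_betw_def by (auto simp: inj_on_def)

lemma sum_card_swap:
  assumes "finite S" "finite I"
  shows "(\<Sum>i\<in>I. card {t \<in> S. P i t}) = (\<Sum>t\<in>S. card {i \<in> I. P i t})"
proof -
  have "card {t \<in> S. P i t} = (\<Sum>t\<in>S. if P i t then 1 else 0)" for i
    using assms(1) by (simp add: sum.If_cases Int_def)
  moreover have "card {i \<in> I. P i t} = (\<Sum>i\<in>I. if P i t then 1 else 0)" for t
    using assms(2) by (simp add: sum.If_cases Int_def)
  ultimately show ?thesis by (simp only: sum.swap[of _ S I])
qed

text \<open>
  The entry at position \<open>i\<close> is exchangeable with the entries at all positions other than \<open>j\<close>,
  so the number of permutations with a collision at \<open>i, j\<close> can be averaged over \<open>i\<close>.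
\<close>

lemma card_permutations_collision:
  fixes h :: "'a \<Rightarrow> 'c"
  assumes A: "finite A" "card A = n" and ij: "i < n" "j < n" "i \<noteq> j"
    and q: "\<And>x. x \<in> A \<Longrightarrow> card {y \<in> A. y \<noteq> x \<and> h y = h x} * b \<le> q"
  shows "(n - 1) * (card {t \<in> permutations_of_set A. h (t ! i) = h (t ! j)} * b) \<le> fact n * q"
proof -
  let ?S = "permutations_of_set A"
  let ?E = "\<lambda>i. {t \<in> ?S. h (t ! i) = h (t ! j)}"
  let ?I = "{..<n} - {j}"
  have fin: "finite ?S" using A by simp
  have len: "length t = n" "distinct t" "set t = A" if "t \<in> ?S" for t
    using permutations_of_set_props[OF that A(2)] by auto
  have same: "card (?E i') = card (?E i)" if i': "i' \<in> ?I" for i'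
  proof -
    let ?f = "Transposition.transpose i i'"
    have f: "?f permutes {..<n}" using ij i' by (intro permutes_swap_id) auto
    have nth: "permute_list ?f t ! i' = t ! i" "permute_list ?f t ! j = t ! j" if "t \<in> ?S" for t
      using permute_list_nth[of ?f t] len(1)[OF that] f ij i' by (auto simp: Transposition.transpose_def)
    have "bij_betw (permute_list ?f) (?E i) (?E i')"
      using bij_permute_list[OF A(1) f A(2)] by (rule bij_betw_subset_filter)
        (simp add: nth)
    then show ?thesis by (simp add: bij_betw_same_card)
  qed
  have "(\<Sum>i'\<in>?I. card (?E i')) = (\<Sum>i'\<in>?I. card (?E i))" by (rule sum.cong[OF refl same])
  then have "(n - 1) * card (?E i) = (\<Sum>i'\<in>?I. card (?E i'))" using ij by simp
  also have "\<dots> = (\<Sum>t\<in>?S. card {i' \<in> ?I. h (t ! i') = h (t ! j)})"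
    using fin by (rule sum_card_swap) auto
  finally have "(n - 1) * (card (?E i) * b) = (\<Sum>t\<in>?S. card {i' \<in> ?I. h (t ! i') = h (t ! j)} * b)"
    by (simp add: sum_distrib_right mult.assoc[symmetric])
  also have "\<dots> \<le> (\<Sum>t\<in>?S. q)"
  proof (rule sum_mono)
    fix t assume t: "t \<in> ?S"
    note l = len[OF t]
    \<comment> \<open>Distinct positions of a permutation carry distinct values, so the colliding
      positions inject into the other values of the same bucket.\<close>
    have "card {i' \<in> ?I. h (t ! i') = h (t ! j)} \<le> card {y \<in> A. y \<noteq> t ! j \<and> h y = h (t ! j)}"
    proof (rule card_inj_on_le[where f = "\<lambda>i. t ! i"])
      show "inj_on ((!) t) {i' \<in> ?I. h (t ! i') = h (t ! j)}"
        using l by (auto simp: inj_on_def nth_eq_iff_index_eq)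
      show "(!) t ` {i' \<in> ?I. h (t ! i') = h (t ! j)} \<subseteq> {y \<in> A. y \<noteq> t ! j \<and> h y = h (t ! j)}"
        using l ij by (auto simp: nth_eq_iff_index_eq)
    qed (use A in auto)
    then have "card {i' \<in> ?I. h (t ! i') = h (t ! j)} * b \<le> card {y \<in> A. y \<noteq> t ! j \<and> h y = h (t ! j)} * b"
      by (rule mult_le_mono1)
    also have "\<dots> \<le> q" using l ij by (intro q) auto
    finally show "card {i' \<in> ?I. h (t ! i') = h (t ! j)} * b \<le> q" .
  qed
  also have "\<dots> = fact n * q" using A by simp
  finally show ?thesis .
qed

text \<open>Double counting with the \<open>fact b\<close> rearrangements of the block: each of them
  preserves the number of permutations counted, and for a fixed \<open>t\<close> at most one makes
  the block increase along \<open>\<sigma>\<close>.\<close>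

lemma card_permutations_sorted:
  fixes A :: "'a :: linorder set"
  assumes A: "finite A" "card A = n" and \<sigma>: "distinct \<sigma>" "set \<sigma> = {pos..<pos + b}" and pos: "pos + b \<le> n"
  shows "fact b * card {t \<in> permutations_of_set A. sorted (map (\<lambda>i. t ! i) \<sigma>)} \<le> fact n"
proof -
  let ?S = "permutations_of_set A"
  let ?B = "{pos..<pos + b}"
  let ?F = "{f. f permutes ?B}"
  let ?E = "{t \<in> ?S. sorted (map (\<lambda>i. t ! i) \<sigma>)}"
  have fin: "finite ?S" using A by simp
  have len: "length t = n" "distinct t" "set t = A" if "t \<in> ?S" for t
    using permutations_of_set_props[OF that A(2)] by auto
  have perm: "f permutes {..<n}" if "f \<in> ?F" for f
    using that pos by (auto intro: permutes_subset)
  have nth: "map (\<lambda>i. permute_list f t ! i) \<sigma> = map (\<lambda>i. t ! f i) \<sigma>" if "f \<in> ?F" "t \<in> ?S" for f t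
    using permute_list_nth[of f t] len(1)[OF that(2)] perm[OF that(1)] \<sigma>(2) pos by auto
  have same: "card {t \<in> ?S. sorted (map (\<lambda>i. t ! f i) \<sigma>)} = card ?E" if f: "f \<in> ?F" for f
  proof -
    have "bij_betw (permute_list f) {t \<in> ?S. sorted (map (\<lambda>i. t ! f i) \<sigma>)} ?E"
      using bij_permute_list[OF A(1) perm[OF f] A(2)] by (rule bij_betw_subset_filter) (simp add: nth[OF f])
    then show ?thesis by (rule bij_betw_same_card)
  qed
  have "(\<Sum>f\<in>?F. card {t \<in> ?S. sorted (map (\<lambda>i. t ! f i) \<sigma>)}) = (\<Sum>f\<in>?F. card ?E)"
    by (rule sum.cong[OF refl same])
  then have "fact b * card ?E = (\<Sum>f\<in>?F. card {t \<in> ?S. sorted (map (\<lambda>i. t ! f i) \<sigma>)})"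
    using card_permutations[of ?B b] by simp
  also have "\<dots> = (\<Sum>t\<in>?S. card {f \<in> ?F. sorted (map (\<lambda>i. t ! f i) \<sigma>)})"
    using fin by (rule sum_card_swap) (simp add: finite_permutations)
  also have "\<dots> \<le> (\<Sum>t\<in>?S. 1)"
  proof (rule sum_mono)
    fix t assume t: "t \<in> ?S"
    note l = len[OF t]
    \<comment> \<open>Both rearrangements list the same set of distinct values in increasing order,
      hence the same list; distinctness of \<open>t\<close> then gives equal positions.\<close>
    have uniq: "f = g" if f: "f \<in> ?F" "sorted (map (\<lambda>i. t ! f i) \<sigma>)" and g: "g \<in> ?F" "sorted (map (\<lambda>i. t ! g i) \<sigma>)" for f g
    proof -
      have st: "set (map (\<lambda>i. t ! f i) \<sigma>) = (\<lambda>i. t ! i) ` ?B" "distinct (map (\<lambda>i. t ! f i) \<sigma>)" if "f \<in> ?F" for f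
      proof -
        have im: "f ` ?B = ?B" and ij: "inj_on f ?B" 
          using that permutes_image[of f ?B] permutes_inj_on[of f ?B] by auto
        have sub: "f i < n" if "i \<in> ?B" for i
          using that \<open>f \<in> ?F\<close> pos permutes_in_image[of f ?B i] by auto
        have "(\<lambda>i. t ! f i) ` ?B = (\<lambda>i. t ! i) ` (f ` ?B)" by (simp add: image_image)
        then show "set (map (\<lambda>i. t ! f i) \<sigma>) = (\<lambda>i. t ! i) ` ?B" using im \<sigma>(2) by simp
        have "inj_on (\<lambda>i. t ! f i) ?B"
          using ij sub l(1,2) by (auto simp: inj_on_def nth_eq_iff_index_eq)
        then show "distinct (map (\<lambda>i. t ! f i) \<sigma>)" using \<sigma> by (simp add: distinct_map)
      qed
      have "map (\<lambda>i. t ! f i) \<sigma> = map (\<lambda>i. t ! g i) \<sigma>"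
        using st[OF f(1)] st[OF g(1)] f(2) g(2) by (intro sorted_distinct_set_unique) auto
      then have "t ! f i = t ! g i" if "i \<in> ?B" for i using that \<sigma>(2) by auto
      moreover have "f i < n" "g i < n" if "i \<in> ?B" for i
        using that f(1) g(1) pos permutes_in_image[of f ?B i] permutes_in_image[of g ?B i] by auto
      ultimately have "f i = g i" if "i \<in> ?B" for i using that l(1,2) by (simp add: nth_eq_iff_index_eq)
      then show "f = g" using f(1) g(1) by (metis ext mem_Collect_eq permutes_not_in)
    qed
    have "card {f \<in> ?F. sorted (map (\<lambda>i. t ! f i) \<sigma>)} \<le> Suc 0"
      using uniq by (subst card_le_Suc0_iff_eq) (auto simp: finite_permutations)
    then show "card {f \<in> ?F. sorted (map (\<lambda>i. t ! f i) \<sigma>)} \<le> 1" by simp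
  qed
  also have "\<dots> = fact n" using A by simp
  finally show ?thesis .
qed

text \<open>The multiples \<open>y * b\<close> for \<open>y\<close> in one bucket lie in a half-open
  interval of length \<open>n + 1\<close>. The number of other values is at most
  \<open>Max Y - Min Y\<close>, and this difference times \<open>b\<close> is at most
  \<open>n\<close>.\<close>

lemma card_bucket:
  fixes n b x :: nat
  assumes "1 \<le> b" "x \<in> {1..n}"
  shows "card {y \<in> {1..n}. y \<noteq> x \<and> y * b div (n + 1) = x * b div (n + 1)} * b \<le> n"
proof -
  define q where "q = x * b div (n + 1)"
  define Y where "Y = {y \<in> {1..n}. y * b div (n + 1) = q}"
  have Y: "finite Y" "x \<in> Y" using assms by (auto simp: Y_def q_def)
  have b: "q * (n + 1) \<le> y * b" "y * b < (q + 1) * (n + 1)" if "y \<in> Y" for y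
  proof -
    have "q = y * b div (n + 1)" using that by (simp add: Y_def)
    then show "q * (n + 1) \<le> y * b" "y * b < (q + 1) * (n + 1)"
      using dividend_less_times_div[of "n + 1" "y * b"] by (simp_all only: div_times_less_eq_dividend) (simp add: algebra_simps)
  qed
  have "Y \<noteq> {}" using Y by blast
  then have mm: "Min Y \<in> Y" "Max Y \<in> Y" using Y by simp_all
  have "card (Y - {x}) = card Y - 1" using Y by simp
  also have "\<dots> \<le> card {Min Y..Max Y} - 1" using Y by (intro diff_le_mono card_mono) auto
  finally have "card (Y - {x}) * b \<le> (Max Y - Min Y) * b" by simp
  also have "\<dots> \<le> n" using b(2)[OF mm(2)] b(1)[OF mm(1)] by (simp add: diff_mult_distrib)
  finally have "card (Y - {x}) * b \<le> n" .
  moreover have "Y - {x} = {y \<in> {1..n}. y \<noteq> x \<and> y * b div (n + 1) = x * b div (n + 1)}"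
    by (auto simp: Y_def q_def)
  ultimately show ?thesis by simp
qed

section \<open>Average running time\<close>

lemma lst_cong:
  assumes "finite S" "inj_on f S" "\<And>x. x \<in> S \<Longrightarrow> f x = g x"
  shows "lst g S = lst f S"
proof (rule lst_unique)
  have e: "map f (lst g S) = map g (lst g S)" using lst_props(2)[OF assms(1), of g] assms(3) by simp
  show "sorted (map f (lst g S))" unfolding e by (rule lst_props(1)[OF assms(1)])
qed (use assms lst_props[OF assms(1), of g] in simp_all)

lemma lst_shift:
  assumes "inj_on f {l..<l + b}" "\<And>x. x \<in> {l..<l + b} \<Longrightarrow> g (x + d) = f x"
  shows "lst g {l + d..<l + d + b} = map (\<lambda>x. x + d) (lst f {l..<l + b :: nat})"
proof (rule lst_unique[symmetric])
  note p = lst_props[of "{l..<l + b}" f]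
  have im: "(\<lambda>x. x + d) ` {l..<l + b} = {l + d..<l + d + b}"
    by (simp add: image_add_atLeastLessThan' ac_simps)
  have e: "map g (map (\<lambda>x. x + d) (lst f {l..<l + b})) = map f (lst f {l..<l + b})"
    using p(2) assms(2) by simp
  show "sorted (map g (map (\<lambda>x. x + d) (lst f {l..<l + b})))" unfolding e using p(1) by simp
  show "inj_on g {l + d..<l + d + b}"
    unfolding im[symmetric] by (rule inj_on_imageI) (use assms in \<open>simp add: inj_on_def\<close>)
  show "distinct (map (\<lambda>x. x + d) (lst f {l..<l + b}))" using p(3) by (simp add: distinct_map)
  show "set (map (\<lambda>x. x + d) (lst f {l..<l + b})) = {l + d..<l + d + b}" using p(2) im by simp
qed simp

text \<open>Counterpart of \<open>wcode\<close> with indices into a single list instead of memory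
  addresses. It is independent of \<open>p @ t\<close>, so that texts can be counted outside the
  locales.\<close>

definition window_code :: "nat \<Rightarrow> nat list \<Rightarrow> nat \<Rightarrow> nat" where
  "window_code b xs l = code b l (lst ((!) xs) {l..<l + b})"

definition bucket_pairs :: "nat \<Rightarrow> nat \<Rightarrow> nat list \<Rightarrow> nat \<Rightarrow> nat" where
  "bucket_pairs n b t pos = (\<Sum>i=pos..<pos + b. card {j \<in> {pos..<pos + b}. j \<noteq> i \<and> t ! j * b div (n + 1) = t ! i * b div (n + 1)})"

definition candidate :: "nat \<Rightarrow> nat list \<Rightarrow> nat list \<Rightarrow> nat \<Rightarrow> bool" where
  "candidate b p t pos \<longleftrightarrow> window_code b t pos \<in> window_code b p ` {0..length p - b}"

text \<open>At most \<open>b ^ 2\<close> ordered pairs collide, each in a fraction of at most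
  \<open>n / ((n - 1) * b)\<close> of all permutations, and \<open>n \<le> 2 * (n - 1)\<close> gives
  the factor 2. Multiplying by \<open>n - 1\<close> and \<open>b\<close> keeps the estimate in the
  natural numbers.\<close>

lemma sum_bucket_pairs:
  assumes b: "1 \<le> b" and pos: "pos + b \<le> n" and n: "2 \<le> n"
  shows "(\<Sum>t\<in>permutations_of_set {1..n}. bucket_pairs n b t pos) \<le> 2 * b * fact n"
proof -
  let ?S = "permutations_of_set {1..n}"
  let ?I = "{pos..<pos + b}"
  let ?h = "\<lambda>v. v * b div (n + 1)"
  have "(\<Sum>t\<in>?S. bucket_pairs n b t pos) = (\<Sum>i\<in>?I. \<Sum>t\<in>?S. card {j \<in> ?I. j \<noteq> i \<and> ?h (t ! j) = ?h (t ! i)})"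
    unfolding bucket_pairs_def by (rule sum.swap)
  also have "\<dots> = (\<Sum>i\<in>?I. \<Sum>j\<in>?I. card {t \<in> ?S. j \<noteq> i \<and> ?h (t ! j) = ?h (t ! i)})"
    by (intro sum.cong refl sum_card_swap[symmetric]) auto
  finally have eq: "(\<Sum>t\<in>?S. bucket_pairs n b t pos) = \<dots>" .
  have one: "(n - 1) * (card {t \<in> ?S. j \<noteq> i \<and> ?h (t ! j) = ?h (t ! i)} * b) \<le> fact n * n"
    if "i \<in> ?I" "j \<in> ?I" for i j
  proof (cases "j = i")
    case False
    then show ?thesis
      using card_permutations_collision[of "{1..n}" n j i ?h b n] card_bucket[OF b] that pos by auto
  qed simp
  have "(n - 1) * (\<Sum>t\<in>?S. bucket_pairs n b t pos) * b
    = (\<Sum>i\<in>?I. \<Sum>j\<in>?I. (n - 1) * (card {t \<in> ?S. j \<noteq> i \<and> ?h (t ! j) = ?h (t ! i)} * b))"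
    unfolding eq by (simp only: sum_distrib_left sum_distrib_right mult.assoc)
  also have "\<dots> \<le> (\<Sum>i\<in>?I. \<Sum>j\<in>?I. fact n * n)" by (intro sum_mono one)
  also have "\<dots> = b * (fact n * n) * b" by simp
  finally have "(n - 1) * (\<Sum>t\<in>?S. bucket_pairs n b t pos) \<le> b * (fact n * n)" using b by simp
  also have "\<dots> \<le> b * (fact n * (2 * (n - 1)))" using n by (intro mult_left_mono) auto
  also have "\<dots> = (n - 1) * (2 * b * fact n)" by simp
  finally show ?thesis using n by (subst (asm) nat_mult_le_cancel1) auto
qed

text \<open>Union bound over the pattern factors. For one code, some text \<open>t0\<close> with
  this code fixes a sorted order \<open>\<sigma>\<close> of the block positions; by injectivity
  every other such text is sorted along the same \<open>\<sigma>\<close>.\<close>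

lemma card_candidates:
  assumes b: "1 \<le> b" "b \<le> length p" and pos: "pos + b \<le> n"
  shows "fact b * card {t \<in> permutations_of_set {1..n}. candidate b p t pos} \<le> length p * fact n"
proof -
  let ?S = "permutations_of_set {1..n}"
  let ?I = "{pos..<pos + b}"
  have fin: "finite ?S" by simp
  have one: "fact b * card {t \<in> ?S. window_code b t pos = c} \<le> fact n" for c
  proof (cases "\<exists>t0 \<in> ?S. window_code b t0 pos = c")
    case True
    then obtain t0 where t0: "window_code b t0 pos = c" by blast
    define \<sigma> where "\<sigma> = lst ((!) t0) ?I"
    note s = lst_props[of ?I "(!) t0", folded \<sigma>_def]
    have "{t \<in> ?S. window_code b t pos = c} \<subseteq> {t \<in> ?S. sorted (map (\<lambda>i. t ! i) \<sigma>)}"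
    proof
      fix t assume "t \<in> {t \<in> ?S. window_code b t pos = c}"
      then have t: "window_code b t pos = c" "t \<in> ?S" by auto
      let ?l = "lst ((!) t) ?I"
      note q = lst_props[of ?I "(!) t"]
      have e: "map (\<lambda>x. x - pos) ?l = map (\<lambda>x. x - pos) \<sigma>"
      proof (rule code_inj[where b = b and l = pos and l' = pos])
        show "code b pos ?l = code b pos \<sigma>" using t t0 by (simp add: window_code_def \<sigma>_def)
        show "length ?l = length \<sigma>" "set ?l \<subseteq> {pos..<pos + b}" "set \<sigma> \<subseteq> {pos..<pos + b}"
          using q(2,4) s(2,4) by simp_all
      qed
      have r: "map ((+) pos) (map (\<lambda>x. x - pos) ys) = ys" if "set ys = ?I" for ys
        unfolding map_map by (rule map_idI) (use that in auto)
      have "?l = \<sigma>" using r[of ?l] r[of \<sigma>] q(2) s(2) unfolding e by simp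
      then show "t \<in> {t \<in> ?S. sorted (map (\<lambda>i. t ! i) \<sigma>)}" using q(1) t(2) by simp
    qed
    then have "card {t \<in> ?S. window_code b t pos = c} \<le> card {t \<in> ?S. sorted (map (\<lambda>i. t ! i) \<sigma>)}"
      using fin by (intro card_mono) auto
    then have "fact b * card {t \<in> ?S. window_code b t pos = c} \<le> fact b * card {t \<in> ?S. sorted (map (\<lambda>i. t ! i) \<sigma>)}"
      by simp
    also have "\<dots> \<le> fact n" using s pos by (intro card_permutations_sorted) auto
    finally show ?thesis .
  next
    case False
    then have "{t \<in> ?S. window_code b t pos = c} = {}" by blast
    then show ?thesis by (simp only: card.empty)
  qed
  let ?K = "{0..length p - b}"
  have "{t \<in> ?S. candidate b p t pos} = (\<Union>d\<in>?K. {t \<in> ?S. window_code b t pos = window_code b p d})"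
    by (auto simp: candidate_def)
  then have "card {t \<in> ?S. candidate b p t pos} \<le> (\<Sum>d\<in>?K. card {t \<in> ?S. window_code b t pos = window_code b p d})"
    by (simp only:) (rule card_UN_le, simp)
  then have "fact b * card {t \<in> ?S. candidate b p t pos} \<le> fact b * (\<Sum>d\<in>?K. card {t \<in> ?S. window_code b t pos = window_code b p d})"
    by simp
  also have "\<dots> = (\<Sum>d\<in>?K. fact b * card {t \<in> ?S. window_code b t pos = window_code b p d})"
    by (rule sum_distrib_left)
  also have "\<dots> \<le> (\<Sum>d\<in>?K. fact n)" by (intro sum_mono one)
  also have "\<dots> = (length p - b + 1) * fact n" by simp
  also have "\<dots> \<le> length p * fact n" using b by (intro mult_right_mono) auto
  finally show ?thesis .
qed

definition block_work :: "nat \<Rightarrow> nat \<Rightarrow> nat list \<Rightarrow> nat list \<Rightarrow> nat \<Rightarrow> nat" where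
  "block_work n b p t pos = 100 * b + 10 * bucket_pairs n b t pos + (if candidate b p t pos then 60 * length p ^ 3 else 0)"

lemma sum_block_work:
  assumes b: "b = block_len (length p)" "b \<le> length p" and p: "1 \<le> length p" and pos: "pos + b \<le> n" and n: "2 \<le> n"
  shows "(\<Sum>t\<in>permutations_of_set {1..n}. block_work n b p t pos) \<le> 180 * b * fact n"
proof -
  let ?S = "permutations_of_set {1..n}"
  let ?m = "length p"
  define N where "N = card {t \<in> ?S. candidate b p t pos}"
  have b1: "1 \<le> b" using block_len(1) b by simp
  \<comment> \<open>Of the four powers of \<open>m\<close> contained in \<open>fact b\<close>, one
    cancels against the number of pattern factors. The other three pay for the verification.\<close>
  have "?m * (?m ^ 3 * N) = ?m ^ 4 * N" by (simp add: numeral_eq_Suc)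
  also have "\<dots> \<le> fact b * N" using block_len(2)[of ?m] b by simp
  also have "\<dots> \<le> ?m * fact n" unfolding N_def using card_candidates[OF b1 b(2) pos] .
  finally have N: "?m ^ 3 * N \<le> fact n" using p by (subst (asm) nat_mult_le_cancel1) auto
  have "(\<Sum>t\<in>?S. block_work n b p t pos)
     = (\<Sum>t\<in>?S. 100 * b) + 10 * (\<Sum>t\<in>?S. bucket_pairs n b t pos) + (\<Sum>t\<in>?S. if candidate b p t pos then 60 * ?m ^ 3 else 0)"
    unfolding block_work_def by (simp only: sum.distrib sum_distrib_left)
  also have "(\<Sum>t\<in>?S. if candidate b p t pos then 60 * ?m ^ 3 else 0) = 60 * (?m ^ 3 * N)"
    by (simp add: sum.If_cases N_def Int_def)
  also have "(\<Sum>t\<in>?S. 100 * b) = 100 * b * fact n" by simp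
  \<comment> \<open>The constants add up as \<open>100 + 10 * 2 + 60 = 180\<close>, using
    \<open>1 \<le> b\<close> for the last summand.\<close>
  finally have "(\<Sum>t\<in>?S. block_work n b p t pos) \<le> 100 * b * fact n + 10 * (2 * b * fact n) + 60 * fact n"
    using N sum_bucket_pairs[OF b1 pos n] by linarith
  also have "\<dots> \<le> 180 * b * fact n" using b1 mult_le_mono1[of 1 b "60 * fact n"] by simp
  finally show ?thesis .
qed

lemma block_cost_eq:
  assumes "ramf w m n ((!) (p @ t)) b" and p: "length p = m" "distinct p" and t: "length t = n" "distinct t"
    and pos: "pos + b \<le> n"
  shows "ramf.block_cost m n ((!) (p @ t)) b (m + pos) = block_work n b p t pos"
proof -
  interpret ramf w m n "(!) (p @ t)" b by fact
  have nth: "(p @ t) ! (j + m) = t ! j" for j using p by (simp add: nth_append)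
  have col: "collisions (m + pos) (i + m) = card {j \<in> {pos..<pos + b}. j \<noteq> i \<and> t ! j * b div (n + 1) = t ! i * b div (n + 1)}" for i
  proof -
    let ?J = "{j \<in> {pos..<pos + b}. j \<noteq> i \<and> t ! j * b div (n + 1) = t ! i * b div (n + 1)}"
    have "{y \<in> {m + pos..<m + pos + b}. y \<noteq> i + m \<and> bk y = bk (i + m)} = (\<lambda>j. j + m) ` ?J"
    proof (rule set_eqI)
      fix y
      show "y \<in> {y \<in> {m + pos..<m + pos + b}. y \<noteq> i + m \<and> bk y = bk (i + m)} \<longleftrightarrow> y \<in> (\<lambda>j. j + m) ` ?J"
      proof (cases "m \<le> y")
        case True
        then obtain j where "y = j + m" by (metis le_add_diff_inverse2)
        then show ?thesis by (auto simp: bk_def nth)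
      qed auto
    qed
    then show ?thesis unfolding collisions_def by (simp add: card_image)
  qed
  have "(\<Sum>x=m + pos..<m + pos + b. collisions (m + pos) x) = (\<Sum>x=pos + m..<(pos + b) + m. collisions (m + pos) x)"
    by (simp add: ac_simps)
  also have "\<dots> = bucket_pairs n b t pos"
    unfolding sum.shift_bounds_nat_ivl col bucket_pairs_def ..
  finally have A: "(\<Sum>x=m + pos..<m + pos + b. collisions (m + pos) x) = bucket_pairs n b t pos" .
  have ti: "inj_on ((!) t) {pos..<pos + b}" using t pos by (auto simp: inj_on_def nth_eq_iff_index_eq)
  have "lst ((!) (p @ t)) {pos + m..<pos + m + b} = map (\<lambda>x. x + m) (lst ((!) t) {pos..<pos + b})"
    by (rule lst_shift[OF ti nth])
  moreover have "set (lst ((!) t) {pos..<pos + b}) \<subseteq> {pos..}" using lst_props(2)[of "{pos..<pos + b}" "(!) t"] by auto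
  ultimately have B: "wcode (m + pos) = window_code b t pos"
    unfolding wcode_def window_code_def add.commute[of m pos] by (simp only: code_shift)
  have C: "wcode d = window_code b p d" if "d \<in> {0..m - b}" for d
  proof -
    have d: "d + b \<le> m" using that b_le by simp
    then have "lst ((!) (p @ t)) {d..<d + b} = lst ((!) p) {d..<d + b}"
      using p by (intro lst_cong) (auto simp: nth_append inj_on_def nth_eq_iff_index_eq)
    then show ?thesis by (simp add: wcode_def window_code_def)
  qed
  have "wcode ` {0..m - b} = window_code b p ` {0..m - b}" by (rule image_cong[OF refl C])
  then have "hit (m + pos) \<longleftrightarrow> candidate b p t pos"
    unfolding hit_def candidate_def B p(1) by (simp only:)
  then show ?thesis unfolding block_cost_def block_work_def A p(1) by simp
qed

text \<open>The definition of \<open>order_iso\<close> compares pairs with \<open>a < b\<close> by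
  \<open>>\<close> alone. Distinctness of both strings turns this into agreement of \<open><\<close>
  on all ordered pairs.\<close>

lemma matches_iff:
  assumes "ram w m n" and p: "length p = m" "distinct p" and t: "length t = n" "distinct t" and i: "i + m \<le> n"
  shows "ram.matches m ((!) (p @ t)) i \<longleftrightarrow> order_iso p (take m (drop i t))"
proof -
  interpret ram w m n "(!) (p @ t)" by fact
  let ?v = "take m (drop i t)"
  have len: "length ?v = m" using t i by simp
  have v: "(p @ t) ! (m + i + a) = ?v ! a" "(p @ t) ! a = p ! a" if "a < m" for a
    using p t i that by (auto simp: nth_append add.assoc)
  have m: "matches i \<longleftrightarrow> (\<forall>a<m. \<forall>c<m. p ! a < p ! c \<longleftrightarrow> ?v ! a < ?v ! c)"
    unfolding matches_def using v by simp
  have "distinct ?v" using t by simp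
  then have ne: "p ! a \<noteq> p ! c" "?v ! a \<noteq> ?v ! c" if "a < m" "c < m" "a \<noteq> c" for a c
    using that p(1) len nth_eq_iff_index_eq[OF p(2), of a c] nth_eq_iff_index_eq[OF \<open>distinct ?v\<close>, of a c]
    by simp_all
  show ?thesis unfolding m order_iso_def
  proof
    assume "\<forall>a<m. \<forall>c<m. p ! a < p ! c \<longleftrightarrow> ?v ! a < ?v ! c"
    then show "length p = length ?v \<and> (\<forall>a c. a < c \<and> c < length p \<longrightarrow> (p ! c < p ! a) = (?v ! c < ?v ! a))"
      using p(1) len by auto
  next
    assume o: "length p = length ?v \<and> (\<forall>a c. a < c \<and> c < length p \<longrightarrow> (p ! c < p ! a) = (?v ! c < ?v ! a))"
    show "\<forall>a<m. \<forall>c<m. p ! a < p ! c \<longleftrightarrow> ?v ! a < ?v ! c"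
    proof (intro allI impI)
      fix a c assume * : "a < m" "c < m"
      show "p ! a < p ! c \<longleftrightarrow> ?v ! a < ?v ! c"
      proof (cases a c rule: linorder_cases)
        case less
        then have "p ! c < p ! a \<longleftrightarrow> ?v ! c < ?v ! a" using o * p(1) by blast
        then show ?thesis using ne[OF *] less by linarith
      next
        case greater
        then show ?thesis using o * p(1) by blast
      qed simp
    qed
  qed
qed

text \<open>A bound on the running time that depends on \<open>t\<close> only through
  \<open>block_work\<close>, so it can be summed over all texts. The two branches mirror the test in
  \<open>MAIN\<close>.\<close>

definition work :: "nat \<Rightarrow> nat list \<Rightarrow> nat list \<Rightarrow> nat" where
  "work n p t = (let m = length p; b = block_len m; s = m + 1 - b in
     if m < 2 * b then 30 + 4 * b + (n + 1 - m) * (40 * m ^ 2)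
     else 40 + 4 * b + 200 * (m * b) + (\<Sum>k<(n - b) div s + 1. block_work n b p t (k * s) + 2))"

lemma run_MAIN:
  assumes m: "1 \<le> length p" and p: "distinct p" "set p \<subseteq> {1..n}" and t: "t \<in> permutations_of_set {1..n}"
    and word: "16 * n + 16 + (n + 1) ^ 10 \<le> 2 ^ w"
  shows "finds_occurrences w (compile 0 MAIN) p t" "run_time w (compile 0 MAIN) (initial p t) \<le> work n p t"
proof -
  define m where "m = length p"
  define b where "b = block_len m"
  let ?inp = "(!) (p @ t)"
  have tp: "length t = n" "distinct t" "set t = {1..n}" using permutations_of_set_props[OF t] by auto
  have mn: "m \<le> n" using card_mono[of "{1..n}" "set p"] p distinct_card[of p] by (simp add: m_def)
  have R: "ram w m n" using m mn word by unfold_locales (auto simp: m_def)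
  interpret ram w m n ?inp by (rule R)
  let ?R = "(\<lambda>_. 0)(0 := m, 1 := n) :: rstate"
  let ?M = "\<lambda>a. if a < m + n then (p @ t) ! a else 0"
  have init: "initial p t = conf 0 ?R ?M" by (simp add: initial_def m_def tp)
  have inp: "input ?M" by (simp add: input_def D_def)
  have "wp w MAIN (\<lambda>R' M' t'. R' 0 = 4 * D \<and> R' 1 = length occurrences \<and>
     (\<forall>j<length occurrences. M' (4 * D + j) = occurrences ! j) \<and> t' \<le> work n p t) ?R ?M"
  proof (cases "m < 2 * b")
    case True
    then show ?thesis
      using MAIN_small[OF _ inp] by (simp add: work_def Let_def m_def[symmetric] b_def[symmetric])
  next
    case False
    have bm: "b \<le> m" "1 \<le> b" using False block_len(1)[of m] by (auto simp: b_def)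
    interpret F: ramf w m n ?inp b
    proof
      have "b ^ b \<le> m ^ 10" using block_len_pow[of m] m bm unfolding b_def m_def by simp
      also have "\<dots> \<le> (n + 1) ^ 10" using mn by (intro power_mono) auto
      finally show "b ^ b \<le> (n + 1) ^ 10" .
      show "inj_on ?inp {..<m}" using p by (auto simp: inj_on_def nth_append m_def nth_eq_iff_index_eq)
      show "inj_on ?inp {m..<m + n}" using tp by (auto simp: inj_on_def nth_append m_def nth_eq_iff_index_eq)
      show "?inp a \<le> n" if "m \<le> a" "a < m + n" for a
        using that tp nth_mem[of "a - m" t] by (auto simp: nth_append m_def)
    qed (use False bm in auto)
    have "(\<Sum>k<F.num_blocks. F.block_cost (m + k * F.stride) + 2) = (\<Sum>k<F.num_blocks. block_work n b p t (k * F.stride) + 2)"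
    proof (rule sum.cong[OF refl])
      fix k assume "k \<in> {..<F.num_blocks}"
      then have "k * F.stride \<le> (n - b) div F.stride * F.stride" by (simp add: F.num_blocks_def)
      also have "\<dots> \<le> n - b" by (rule div_times_less_eq_dividend)
      finally have "k * F.stride + b \<le> n" using bm mn by simp
      then show "F.block_cost (m + k * F.stride) + 2 = block_work n b p t (k * F.stride) + 2"
        using block_cost_eq[OF F.ramf_axioms _ p(1) tp(1,2)] by (simp add: m_def)
    qed
    then have "work n p t = 40 + 4 * b + 200 * (m * b) + (\<Sum>k<F.num_blocks. F.block_cost (m + k * F.stride) + 2)"
      using False by (simp add: work_def Let_def m_def[symmetric] b_def[symmetric] F.num_blocks_def F.stride_def)
    then show ?thesis using F.MAIN_large[OF b_def inp] by (simp add: D_def)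
  qed
  then obtain t' R' M' where run: "bs w MAIN ?R ?M t' R' M'" and R': "R' 0 = 4 * D" "R' 1 = length occurrences"
    "\<And>j. j < length occurrences \<Longrightarrow> M' (4 * D + j) = occurrences ! j" "t' \<le> work n p t"
    unfolding wp_def by blast
  note c = compile_run[OF run init]
  show "run_time w (compile 0 MAIN) (initial p t) \<le> work n p t" using c(2) R'(4) by simp
  have res: "result_of (final_config w (compile 0 MAIN) (initial p t)) = occurrences"
    unfolding c(3) result_of_def by (rule nth_equalityI) (use R' in auto)
  have "set occurrences = {i. occurs_at p t i}"
  proof (rule set_eqI)
    fix i
    show "i \<in> set occurrences \<longleftrightarrow> i \<in> {i. occurs_at p t i}"
    proof (cases i)
      case (Suc j)
      have "occurs_at p t (Suc j) \<longleftrightarrow> j + m \<le> n \<and> matches j"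
        using matches_iff[OF R m_def[symmetric] p(1) tp(1,2), of j] by (auto simp: occurs_at_def m_def tp)
      also have "j + m \<le> n \<longleftrightarrow> j < n + 1 - m" using mn by auto
      finally show ?thesis using Suc by auto
    qed (auto simp: occurs_at_def)
  qed
  then show "finds_occurrences w (compile 0 MAIN) p t"
    unfolding finds_occurrences_def res using c(1) by (simp add: distinct_map)
qed

text \<open>Since the stride \<open>s\<close> is at least \<open>m / 2\<close> and
  \<open>K * s \<le> 2 * n\<close>, the number \<open>K\<close> of blocks satisfies
  \<open>m * K \<le> 4 * n\<close>. Each block costs \<open>182 * b\<close> on average, whence
  \<open>728 = 4 * 182\<close>; the remaining terms give \<open>244 = 40 + 4 + 200\<close>.\<close>

lemma sum_work:
  assumes m: "m = length p" "1 \<le> m" and b: "b = block_len m" "2 * b \<le> m" and n: "m \<le> n"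
  shows "m * (\<Sum>t\<in>permutations_of_set {1..n}. work n p t) \<le> (244 * (m * m * b) + 728 * (b * n)) * fact n"
proof -
  let ?S = "permutations_of_set {1..n}"
  define s where "s = m + 1 - b"
  define K where "K = (n - b) div s + 1"
  have b1: "1 \<le> b" using block_len(1) b by simp
  have s: "1 \<le> s" "m \<le> 2 * s" "s \<le> m" using b b1 unfolding s_def by auto
  have "(n - b) div s * s \<le> n - b" by (rule div_times_less_eq_dividend)
  then have "K * s \<le> n - b + s" unfolding K_def by simp
  then have Ks: "K * s \<le> 2 * n" using s n b by linarith
  have "m * K \<le> 2 * s * K" using s by (intro mult_right_mono) auto
  also have "\<dots> = 2 * (K * s)" by simp
  finally have mK: "m * K \<le> 4 * n" using Ks by linarith
  have "(\<Sum>t\<in>?S. work n p t) = (\<Sum>t\<in>?S. 40 + 4 * b + 200 * (m * b) + (\<Sum>k<K. block_work n b p t (k * s) + 2))"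
    unfolding work_def Let_def m(1)[symmetric] b(1)[symmetric] s_def[symmetric] K_def[symmetric] using b(2) by simp
  also have "\<dots> = (40 + 4 * b + 200 * (m * b)) * fact n + (\<Sum>k<K. \<Sum>t\<in>?S. block_work n b p t (k * s) + 2)"
    by (simp only: sum.distrib sum.swap[of _ "{..<K}"]) (simp add: algebra_simps)
  also have "(\<Sum>k<K. \<Sum>t\<in>?S. block_work n b p t (k * s) + 2) \<le> (\<Sum>k<K. 182 * b * fact n)"
  proof (rule sum_mono)
    fix k assume "k \<in> {..<K}"
    then have "k * s \<le> (n - b) div s * s" by (simp add: K_def)
    also have "\<dots> \<le> n - b" by (rule div_times_less_eq_dividend)
    finally have pos: "k * s + b \<le> n" using b n by simp
    have "(\<Sum>t\<in>?S. block_work n b p t (k * s)) \<le> 180 * b * fact n"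
      using b m b1 n pos by (intro sum_block_work) auto
    moreover have "(\<Sum>t\<in>?S. 2) \<le> 2 * b * fact n" using b1 by simp
    ultimately show "(\<Sum>t\<in>?S. block_work n b p t (k * s) + 2) \<le> 182 * b * fact n"
      unfolding sum.distrib by linarith
  qed
  also have "(40 + 4 * b + 200 * (m * b)) * fact n + (\<Sum>k<K. 182 * b * fact n) = (40 + 4 * b + 200 * (m * b) + K * 182 * b) * fact n"
    by (simp add: algebra_simps)
  finally have "m * (\<Sum>t\<in>?S. work n p t) \<le> m * ((40 + 4 * b + 200 * (m * b) + K * 182 * b) * fact n)" by simp
  also have "\<dots> = (m * (40 + 4 * b + 200 * (m * b)) + 182 * b * (m * K)) * fact n" by (simp add: algebra_simps)
  also have "\<dots> \<le> (m * (244 * (m * b)) + 182 * b * (4 * n)) * fact n"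
  proof (intro mult_right_mono add_mono mult_left_mono mK)
    have "1 \<le> m * b" "b \<le> m * b" using m b1 by auto
    then show "40 + 4 * b + 200 * (m * b) \<le> 244 * (m * b)" by linarith
  qed auto
  also have "m * (244 * (m * b)) + 182 * b * (4 * n) = 244 * (m * m * b) + 728 * (b * n)" by (simp add: algebra_simps)
  finally show ?thesis .
qed

section \<open>Asymptotics of the block length\<close>

lemma fact_half: "15 \<le> k \<Longrightarrow> (2 * k + 1) ^ 4 \<le> fact k" for k :: nat
proof (induction k rule: dec_induct)
  case base
  show ?case by (simp add: fact_numeral)
next
  case (step k)
  \<comment> \<open>The base at most doubles, so the left side grows by at most
    \<open>2 ^ 4\<close>, while the factorial gains the factor \<open>Suc k \<ge> 16\<close>. Hence
    the start at 15.\<close>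
  have "(2 * Suc k + 1) ^ 4 \<le> (2 * (2 * k + 1)) ^ 4" using step by (intro power_mono) auto
  also have "\<dots> = 16 * (2 * k + 1) ^ 4" by (simp only: power_mult_distrib) simp
  also have "\<dots> \<le> Suc k * fact k" using step by (intro mult_mono) auto
  finally show ?case by simp
qed

text \<open>As \<open>m \<le> 2 * (m div 2) + 1\<close>, the number \<open>m div 2\<close> already
  satisfies the condition that defines the least block length.\<close>

lemma block_len_half: "30 \<le> m \<Longrightarrow> 2 * block_len m \<le> m"
proof -
  assume m: "30 \<le> m"
  have "m ^ 4 \<le> (2 * (m div 2) + 1) ^ 4" by (intro power_mono) auto
  also have "\<dots> \<le> fact (m div 2)" using m by (intro fact_half) auto
  finally have "block_len m \<le> m div 2" unfolding block_len_def using m by (intro Least_le) auto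
  then show ?thesis by simp
qed

lemma log2_le: "0 < x \<Longrightarrow> log 2 x \<le> 2 * x"
proof -
  assume x: "0 < x"
  have "ln x \<le> x" using ln_le_minus_one[OF x] by simp
  also have "x \<le> 2 * x * ln 2" using x ln2_ge_two_thirds by (simp add: mult.assoc)
  finally show ?thesis by (simp add: log_def divide_le_eq)
qed

text \<open>The quotient of logarithms is compared with \<open>x = block_len m - 1\<close>. If
  \<open>x\<^sup>2 \<le> L\<close>, then \<open>x\<close> is at most \<open>sqrt L\<close>, which is
  \<open>O(f)\<close>. Otherwise \<open>LL \<le> 2 * log 2 x\<close>, and
  \<open>x * log 2 x \<le> 8 * L\<close> gives \<open>x * LL \<le> 16 * L\<close>.\<close>

lemma log_ratio:
  assumes "3 \<le> m"
  defines "f \<equiv> log 2 (real m) / log 2 (log 2 (real m))"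
  shows "1 / 2 \<le> f" "real (block_len m) \<le> 18 * f"
proof -
  define L where "L = log 2 (real m)"
  define LL where "LL = log 2 L"
  have L: "1 < L" unfolding L_def using assms(1) by (subst less_log_iff) auto
  then have LL: "0 < LL" unfolding LL_def by simp
  have f: "f = L / LL" unfolding f_def L_def LL_def ..
  have "LL \<le> 2 * L" unfolding LL_def using L by (intro log2_le) simp
  then show half: "1 / 2 \<le> f" unfolding f using LL by (simp add: field_simps)
  \<comment> \<open>The crude bound \<open>log2_le\<close>, applied to \<open>sqrt L\<close>, shows
    that \<open>LL\<close> is \<open>O(sqrt L)\<close>, which means that \<open>sqrt L\<close> is
    \<open>O(f)\<close>.\<close>
  have "LL = 2 * log 2 (sqrt L)" unfolding LL_def using L by (simp add: log_def ln_sqrt)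
  also have "\<dots> \<le> 4 * sqrt L" using log2_le[of "sqrt L"] L by simp
  finally have "sqrt L * LL \<le> sqrt L * (4 * sqrt L)" using L by (intro mult_left_mono) auto
  also have "\<dots> = 4 * L" using L by simp
  finally have sq: "sqrt L \<le> 4 * f" unfolding f using LL by (simp add: field_simps)
  define x where "x = block_len m - 1"
  have bx: "block_len m = x + 1" using block_len(1)[of m] by (simp add: x_def)
  have "real x \<le> 16 * f"
  proof (cases "x = 0")
    case False
    have "fact x < m ^ 4" using bx False by (intro block_len_least) auto
    then have "(fact x)\<^sup>2 \<le> (m ^ 4)\<^sup>2" by (intro power_mono) auto
    then have "x ^ x \<le> m ^ 8" using power_self_le_fact_sq[of x] by (simp flip: power_mult)
    then have "real x ^ x \<le> real m ^ 8" by (metis of_nat_le_iff of_nat_power)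
    then have "log 2 (real x ^ x) \<le> log 2 (real m ^ 8)" using False by (intro log_mono) auto
    then have xl: "real x * log 2 (real x) \<le> 8 * L" using False assms(1) by (simp add: log_nat_power L_def)
    show ?thesis
    proof (cases "(real x)\<^sup>2 \<le> L")
      case True
      then have "real x \<le> sqrt L" by (rule real_le_rsqrt)
      then show ?thesis using sq half by linarith
    next
      case nle: False
      then have "LL \<le> log 2 ((real x)\<^sup>2)" unfolding LL_def using L by (intro log_mono) auto
      also have "\<dots> = 2 * log 2 (real x)" using False by (simp add: log_nat_power)
      finally have "real x * LL \<le> real x * (2 * log 2 (real x))" by (intro mult_left_mono) auto
      also have "\<dots> \<le> 16 * L" using xl by simp
      finally show ?thesis unfolding f using LL by (simp add: field_simps)
    qed
  qed (use half in simp)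
  then show "real (block_len m) \<le> 18 * f" using half bx by simp
qed

lemma average_work:
  assumes m: "m = length p" "3 \<le> m" "m \<le> n"
  defines "f \<equiv> log 2 (real m) / log 2 (log 2 (real m))"
  shows "(\<Sum>t\<in>permutations_of_set {1..n}. real (work n p t)) / fact n \<le> 3000000 * (f * (real m + real n / real m))"
proof -
  let ?S = "permutations_of_set {1..n}"
  define b where "b = block_len m"
  note f = log_ratio[OF m(2), folded f_def b_def]
  have f0: "0 < f" using f by simp
  have b1: "1 \<le> b" using block_len(1) by (simp add: b_def)
  show ?thesis
  proof (cases "m < 2 * b")
    \<comment> \<open>In this case \<open>m < 30\<close>, so \<open>m ^ 3 \<le> 27000\<close> is a
      constant, which \<open>f \<ge> 1 / 2\<close> absorbs. The product
      \<open>40 * 27000 * 2\<close> accounts for the size of the final constant.\<close>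
    case True
    then have m30: "m < 30" using block_len_half[of m] unfolding b_def by linarith
    have w: "work n p t \<le> 34 * b * m + 40 * m ^ 2 * n" for t
    proof -
      have "30 + 4 * b \<le> 34 * b * m" using b1 m mult_le_mono2[of 1 m "34 * b"] by linarith
      moreover have "(n + 1 - m) * (40 * m ^ 2) \<le> n * (40 * m ^ 2)" using m by (intro mult_right_mono) auto
      moreover have "n * (40 * m ^ 2) = 40 * m ^ 2 * n" by (rule mult.commute)
      moreover have "work n p t = 30 + 4 * b + (n + 1 - m) * (40 * m ^ 2)"
        using True unfolding work_def Let_def m(1)[symmetric] b_def[symmetric] by (simp only: if_True)
      ultimately show ?thesis by linarith
    qed
    have "(\<Sum>t\<in>?S. real (work n p t)) \<le> (\<Sum>t\<in>?S. real (34 * b * m + 40 * m ^ 2 * n))"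
      by (intro sum_mono of_nat_mono w)
    also have "\<dots> = fact n * real (34 * b * m + 40 * m ^ 2 * n)" by simp
    finally have "(\<Sum>t\<in>?S. real (work n p t)) / fact n \<le> real (34 * b * m + 40 * m ^ 2 * n)"
      by (simp add: divide_le_eq mult.commute)
    also have "\<dots> = 34 * real b * real m + 40 * real m ^ 3 * (real n / real m)"
      using m by (simp add: power3_eq_cube power2_eq_square)
    also have "\<dots> \<le> 34 * (18 * f) * real m + 40 * 27000 * (2 * f) * (real n / real m)"
    proof (intro add_mono mult_right_mono)
      have "real m ^ 3 \<le> 30 ^ 3" using m30 by (intro power_mono) auto
      then have "40 * real m ^ 3 \<le> 40 * 27000" by simp
      also have "\<dots> \<le> 40 * 27000 * (2 * f)" using f by simp
      finally show "40 * real m ^ 3 \<le> 40 * 27000 * (2 * f)" .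
    qed (use f in auto)
    also have "\<dots> \<le> 3000000 * (f * real m) + 3000000 * (f * (real n / real m))"
    proof (rule add_mono)
      show "34 * (18 * f) * real m \<le> 3000000 * (f * real m)" using f0 by simp
      have "0 \<le> f * (real n / real m)" using f0 by simp
      then show "40 * 27000 * (2 * f) * (real n / real m) \<le> 3000000 * (f * (real n / real m))" by linarith
    qed
    finally show ?thesis by (simp add: distrib_left)
  next
    case False
    then have W: "m * (\<Sum>t\<in>?S. work n p t) \<le> (244 * (m * m * b) + 728 * (b * n)) * fact n"
      using m by (intro sum_work) (auto simp: b_def)
    have "real m * (\<Sum>t\<in>?S. real (work n p t)) = real (m * (\<Sum>t\<in>?S. work n p t))" by simp
    also have "\<dots> \<le> real ((244 * (m * m * b) + 728 * (b * n)) * fact n)" using W by (rule of_nat_mono)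
    finally have W': "real m * (\<Sum>t\<in>?S. real (work n p t)) \<le> (244 * (real m * real m * real b) + 728 * (real b * real n)) * fact n"
      by simp
    have div: "x / z \<le> y / a" if "a * x \<le> y * z" "0 < a" "0 < z" for a x y z :: real
      using that by (simp add: field_simps)
    have "(\<Sum>t\<in>?S. real (work n p t)) / fact n \<le> (244 * (real m * real m * real b) + 728 * (real b * real n)) / real m"
      by (rule div[OF W']) (use m in auto)
    also have "\<dots> = real b * (244 * real m + 728 * (real n / real m))"
    proof -
      have eq: "(244 * (x * x * y) + 728 * (y * z)) / x = y * (244 * x + 728 * (z / x))" if "x \<noteq> 0" for x y z :: real
        using that by (simp add: field_simps)
      show ?thesis by (rule eq) (use m(2) in linarith)
    qed
    also have "\<dots> \<le> (18 * f) * (244 * real m + 728 * (real n / real m))" using f by (intro mult_right_mono) auto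
    also have "\<dots> \<le> (18 * f) * (728 * (real m + real n / real m))" using f0 by (intro mult_left_mono) auto
    also have "\<dots> = 13104 * (f * (real m + real n / real m))" by simp
    also have "\<dots> \<le> 3000000 * (f * (real m + real n / real m))" using f0 by (intro mult_right_mono) auto
    finally show ?thesis .
  qed
qed

text \<open>The factor 16 is the exponent: \<open>(n + 1) ^ 16\<close> exceeds
  \<open>(n + 1) ^ 10\<close> by a factor of at least \<open>2 ^ 6\<close>, which leaves room for
  the linear terms.\<close>

lemma word_length:
  assumes "16 * log 2 (real n + 1) \<le> real w" "1 \<le> n"
  shows "16 * n + 16 + (n + 1) ^ 10 \<le> 2 ^ w"
proof -
  have "log 2 ((real n + 1) ^ 16) \<le> real w" using assms by (simp add: log_nat_power)
  then have "(real n + 1) ^ 16 \<le> 2 powr real w" by (subst (asm) log_le_iff) auto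
  then have "real ((n + 1) ^ 16) \<le> real (2 ^ w)" by (simp add: powr_realpow add.commute)
  then have w: "(n + 1) ^ 16 \<le> 2 ^ w" by (rule of_nat_le_iff[THEN iffD1])
  have "2 ^ 6 \<le> (n + 1) ^ 6" using assms(2) by (intro power_mono) auto
  then have "64 * (n + 1) ^ 10 \<le> (n + 1) ^ 6 * (n + 1) ^ 10" by (intro mult_right_mono) auto
  also have "\<dots> = (n + 1) ^ 16" by (simp flip: power_add)
  finally have "64 * (n + 1) ^ 10 \<le> 2 ^ w" using w by simp
  moreover have "n + 1 \<le> (n + 1) ^ 10" by (rule self_le_power) auto
  ultimately show ?thesis by linarith
qed

text \<open>Program and constants are chosen before the word length and the input, so one program
  serves all words of at least \<open>c * log 2 (n + 1)\<close> bits. Correctness holds from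
  \<open>m = 1\<close> on. The time bound starts at \<open>m = 3\<close>, because for
  \<open>m \<le> 2\<close> the right-hand side is 0, by \<open>log 2 1 = 0\<close> and division by
  zero.\<close>

theorem theorem4:
  shows "\<exists>(P :: program) (c :: real) (C :: real).
    \<forall>(w :: nat) (n :: nat) (m :: nat) (p :: nat list).
      1 \<le> m \<and> length p = m \<and> distinct p \<and> set p \<subseteq> {1..n} \<and> c * log 2 (real n + 1) \<le> real w \<longrightarrow>
        (\<forall>t \<in> permutations_of_set {1..n}. finds_occurrences w P p t) \<and>
        (3 \<le> m \<longrightarrow>
          average_time w P p n \<le>
            C * (real m * log 2 (real m) / log 2 (log 2 (real m))
               + real n * log 2 (real m) / (real m * log 2 (log 2 (real m)))))"
proof (intro exI allI impI)
  fix w n m :: nat and p :: "nat list"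
  let ?S = "permutations_of_set {1..n}"
  let ?P = "compile 0 MAIN"
  assume *: "1 \<le> m \<and> length p = m \<and> distinct p \<and> set p \<subseteq> {1..n} \<and> 16 * log 2 (real n + 1) \<le> real w"
  then have mn: "m \<le> n" using card_mono[of "{1..n}" "set p"] distinct_card[of p] by simp
  have word: "16 * n + 16 + (n + 1) ^ 10 \<le> 2 ^ w" using * mn by (intro word_length) auto
  have run: "finds_occurrences w ?P p t" "run_time w ?P (initial p t) \<le> work n p t" if "t \<in> ?S" for t
    using run_MAIN[OF _ _ _ that word, of p] * by auto
  have "average_time w ?P p n \<le> 3000000 * (real m * log 2 (real m) / log 2 (log 2 (real m))
               + real n * log 2 (real m) / (real m * log 2 (log 2 (real m))))" if m3: "3 \<le> m"
  proof -
    have "average_time w ?P p n = (\<Sum>t\<in>?S. real (run_time w ?P (initial p t))) / fact n"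
      unfolding average_time_def by (subst integral_pmf_of_set) (auto simp: permutations_of_set_empty_iff)
    also have "\<dots> \<le> (\<Sum>t\<in>?S. real (work n p t)) / fact n"
      using run(2) by (intro divide_right_mono sum_mono) auto
    also have "\<dots> \<le> 3000000 * (log 2 (real m) / log 2 (log 2 (real m)) * (real m + real n / real m))"
      using * m3 mn by (intro average_work) auto
    also have "log 2 (real m) / log 2 (log 2 (real m)) * (real m + real n / real m)
      = real m * log 2 (real m) / log 2 (log 2 (real m)) + real n * log 2 (real m) / (real m * log 2 (log 2 (real m)))"
    proof -
      have "l / ll * (real m + x / y) = real m * l / ll + x * l / (y * ll)" for l ll x y :: real
        by (simp add: distrib_left mult.commute)
      then show ?thesis .
    qed
    finally show ?thesis .
  qed
  with run(1) show "(\<forall>t \<in> ?S. finds_occurrences w ?P p t) \<and>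
        (3 \<le> m \<longrightarrow>
          average_time w ?P p n \<le>
            3000000 * (real m * log 2 (real m) / log 2 (log 2 (real m))
               + real n * log 2 (real m) / (real m * log 2 (log 2 (real m)))))"
    by blast
qed

end
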